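(* There exist constants $\gamma, \varepsilon_0>0$ such that the following holds. If $0<\varepsilon<\varepsilon_0$ and $K$ is a convex body in $\mathbb{R}^2$ with Santal\'{o} point $s$ such that $$V(K^s)V(K)\geq \frac{\pi^2}{1+\varepsilon},$$ then $$d_{\mathcal{BM}}(K,B)\leq 1+\gamma\,\varepsilon^{\frac{1}{4}}.$$ Furthermore, if in addition $K$ is origin-symmetric, then $$d_{\mathcal{BM}}(K,B)\leq 1+\gamma\,\varepsilon^{\frac{1}{2}}.$$
   Context: A convex body in $\mathbb{R}^n$ is a compact convex subset of $\mathbb{R}^n$ with non-empty interior; $\mathcal{K}^n$ denotes the set of convex bodies in $\mathbb{R}^n$. $K$ is origin-symmetric if $K=-K$. $V$ denotes volume (Lebesgue measure; area when $n=2$), and $B$ is the closed Euclidean unit ball of $\mathbb{R}^n$ (the unit disk when $n=2$). For a convex body $K$ with the origin in its interior, the polar body is $K^{\ast}=\{y\in\mathbb{R}^n: \langle x,y\rangle\leq 1 \text{ for all } x\in K\}$, where $\langle\cdot,\cdot\rangle$ is the standard inner product. For a convex body $K$ and $x\in \operatorname{int} K$, put $K^x:=(K-x)^{\ast}$. The Santal\'{o} point $s$ of $K$ is the unique point of $\operatorname{int} K$ such that $V(K^s)\leq V(K^x)$ for all $x\in\operatorname{int}K$ (for origin-symmetric $K$ it is the origin). The Banach-Mazur distance of $K,\bar K\in\mathcal{K}^n$ is $$d_{\mathcal{BM}}(K,\bar{K})=\min\{ \lambda\geq 1: (K-x)\subseteq \Phi(\bar{K}-y)\subseteq \lambda(K-x),\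 \Phi\in GL(n),\ x,y\in\mathbb{R}^n\}.$$ *)

theory Defs
  imports "HOL-Analysis.Analysis"
begin

definition convex_body :: "'a::euclidean_space set \<Rightarrow> bool" where
  "convex_body K \<longleftrightarrow> compact K \<and> convex K \<and> interior K \<noteq> {}"

definition origin_symmetric :: "'a::euclidean_space set \<Rightarrow> bool" where
  "origin_symmetric K \<longleftrightarrow> K = uminus ` K"

abbreviation volume :: "'a::euclidean_space set \<Rightarrow> real" where
  "volume A \<equiv> measure lebesgue A"

definition shift :: "'a::euclidean_space set \<Rightarrow> 'a \<Rightarrow> 'a set" where
  "shift K x = (\<lambda>z. z - x) ` K"

definition polar :: "'a::euclidean_space set \<Rightarrow> 'a set" where
  "polar K = {y. \<forall>x\<in>K. x \<bullet> y \<le> 1}"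

definition polar_at :: "'a::euclidean_space set \<Rightarrow> 'a \<Rightarrow> 'a set" where
  "polar_at K x = polar (shift K x)"

definition santalo_point :: "'a::euclidean_space set \<Rightarrow> 'a \<Rightarrow> bool" where
  "santalo_point K s \<longleftrightarrow>
     s \<in> interior K \<and> (\<forall>x\<in>interior K. volume (polar_at K s) \<le> volume (polar_at K x))"

definition bm_factors :: "'a::euclidean_space set \<Rightarrow> 'a set \<Rightarrow> real set" where
  "bm_factors K L = {l. 1 \<le> l \<and> (\<exists>\<Phi> x y. linear \<Phi> \<and> bij \<Phi> \<and>
     shift K x \<subseteq> \<Phi> ` shift L y \<and> \<Phi> ` shift L y \<subseteq> (\<lambda>z. l *\<^sub>R z) ` shift K x)}"

text \<open>For convex bodies the infimum is a minimum; see \<open>banach_mazur_dist_attained\<close> below.\<close>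

definition banach_mazur_dist :: "'a::euclidean_space set \<Rightarrow> 'a set \<Rightarrow> real" where
  "banach_mazur_dist K L = Inf (bm_factors K L)"

lemma bm_factors_nonempty:
  assumes "convex_body K" "convex_body L"
  shows "bm_factors K L \<noteq> {}"
proof -
  have c: "compact K" "compact L" using assms by (auto simp: convex_body_def)
  obtain p where "p \<in> interior K" using assms by (auto simp: convex_body_def)
  then obtain r where r: "r > 0" "cball p r \<subseteq> K" using mem_interior_cball by metis
  obtain q where "q \<in> interior L" using assms by (auto simp: convex_body_def)
  then obtain t where t: "t > 0" "cball q t \<subseteq> L" using mem_interior_cball by metis
  obtain R0 where R0: "K \<subseteq> cball p R0"
    using compact_imp_bounded[OF c(1)] unfolding bounded_any_center[of _ p] by fastforce
  obtain T0 where T0: "L \<subseteq> cball q T0"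
    using compact_imp_bounded[OF c(2)] unfolding bounded_any_center[of _ q] by fastforce
  define R where "R = max R0 r"
  define T where "T = max T0 t"
  have R: "K \<subseteq> cball p R" "R \<ge> r" using R0 by (auto simp: R_def)
  have T: "L \<subseteq> cball q T" "T \<ge> t" using T0 by (auto simp: T_def)
  define c where "c = R / t"
  define l where "l = c * T / r"
  have cpos: "c > 0" using R r t by (simp add: c_def)
  have lpos: "l > 0" using cpos T t r by (simp add: l_def)
  have "r * t \<le> R * T" using R T r t by (intro mult_mono) auto
  then have l1: "1 \<le> l" using r t by (simp add: l_def c_def field_simps)
  have lin: "linear (\<lambda>z::'a. c *\<^sub>R z)" by (simp add: linear_scaleR)
  have bij: "bij (\<lambda>z::'a. c *\<^sub>R z)"
    by (rule bij_betw_byWitness[where f' = "\<lambda>z. (1/c) *\<^sub>R z"]) (use cpos in auto)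
  have 1: "shift K p \<subseteq> (\<lambda>z. c *\<^sub>R z) ` shift L q"
  proof
    fix u assume "u \<in> shift K p"
    then obtain z where z: "z \<in> K" "u = z - p" by (auto simp: shift_def)
    then have "norm u \<le> R" using R by (auto simp: dist_norm norm_minus_commute)
    then have "norm ((1/c) *\<^sub>R u) \<le> t" using cpos t by (simp add: c_def field_simps)
    then have "q + (1/c) *\<^sub>R u \<in> L" using t by (auto simp: dist_norm)
    then have "(1/c) *\<^sub>R u \<in> shift L q" unfolding shift_def by (force simp: image_iff)
    then show "u \<in> (\<lambda>z. c *\<^sub>R z) ` shift L q" using cpos by (force simp: image_iff)
  qed
  have 2: "(\<lambda>z. c *\<^sub>R z) ` shift L q \<subseteq> (\<lambda>z. l *\<^sub>R z) ` shift K p"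
  proof
    fix u assume "u \<in> (\<lambda>z. c *\<^sub>R z) ` shift L q"
    then obtain w where w: "w \<in> L" "u = c *\<^sub>R (w - q)" by (auto simp: shift_def)
    then have "norm (w - q) \<le> T" using T by (auto simp: dist_norm norm_minus_commute)
    then have "norm u \<le> c * T" using w cpos by simp
    then have "norm ((1/l) *\<^sub>R u) \<le> r" using lpos r by (simp add: l_def field_simps)
    then have "p + (1/l) *\<^sub>R u \<in> K" using r by (auto simp: dist_norm)
    then have "(1/l) *\<^sub>R u \<in> shift K p" unfolding shift_def by (force simp: image_iff)
    then show "u \<in> (\<lambda>z. l *\<^sub>R z) ` shift K p" using lpos by (force simp: image_iff)
  qed
  have "l \<in> bm_factors K L" unfolding bm_factors_def using l1 lin bij 1 2 by blast
  then show ?thesis by blast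
qed

lemma zero_mem_if_subset_scaled:
  fixes A :: "'a::euclidean_space set"
  assumes "closed A" "A \<noteq> {}" "l > 1" "A \<subseteq> (\<lambda>z. l *\<^sub>R z) ` A"
  shows "0 \<in> A"
proof -
  obtain a where a: "a \<in> A" using assms by blast
  have mem: "(1/l)^k *\<^sub>R a \<in> A" for k
  proof (induction k)
    case (Suc k)
    then obtain b where b: "b \<in> A" "(1/l)^k *\<^sub>R a = l *\<^sub>R b" using assms(4) by blast
    have "(1/l)^Suc k *\<^sub>R a = (1/l) *\<^sub>R ((1/l)^k *\<^sub>R a)" by simp
    also have "\<dots> = b" unfolding b(2) using assms(3) by simp
    finally show ?case using b by simp
  qed (use a in simp)
  have "(\<lambda>k. (1/l)^k *\<^sub>R a) \<longlonglongrightarrow> 0 *\<^sub>R a"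
    by (intro tendsto_intros LIMSEQ_power_zero) (use assms in auto)
  then show ?thesis using closed_sequentially[OF assms(1), of "\<lambda>k. (1/l)^k *\<^sub>R a" 0] mem by simp
qed

lemma closed_metric_projection:
  fixes S :: "'b::metric_space set" and T :: "('b \<times> 'c::metric_space) set"
  assumes "compact S" "closed T"
  shows "closed {y. \<exists>x\<in>S. (x, y) \<in> T}"
  unfolding closed_sequential_limits
proof (intro allI impI, elim conjE)
  fix y l assume y: "\<forall>n. y n \<in> {y. \<exists>x\<in>S. (x, y) \<in> T}" "y \<longlonglongrightarrow> l"
  then obtain x where x: "\<And>n::nat. x n \<in> S" "\<And>n. (x n, y n) \<in> T" by simp metis
  then obtain a r where a: "a \<in> S" "strict_mono r" "(x \<circ> r) \<longlonglongrightarrow> a"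
    using assms(1) unfolding compact_def by metis
  have "(\<lambda>n. ((x \<circ> r) n, (y \<circ> r) n)) \<longlonglongrightarrow> (a, l)"
    by (intro tendsto_Pair a(3) LIMSEQ_subseq_LIMSEQ[OF y(2) a(2)])
  then have "(a, l) \<in> T"
    using closed_sequentially[OF assms(2), of "\<lambda>n. ((x \<circ> r) n, (y \<circ> r) n)"] x by simp
  then show "l \<in> {y. \<exists>x\<in>S. (x, y) \<in> T}" using a by blast
qed

lemma banach_mazur_dist_attained:
  fixes K L :: "'a::euclidean_space set"
  assumes "convex_body K" "convex_body L"
  shows "banach_mazur_dist K L \<in> bm_factors K L"
proof (cases "1 \<in> bm_factors K L")
  case True
  then have "Inf (bm_factors K L) = 1"
    by (intro cInf_eq_minimum) (auto simp: bm_factors_def)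
  then show ?thesis using True by (simp add: banach_mazur_dist_def)
next
  case False
  have cK: "compact K" and cL: "compact L" using assms by (auto simp: convex_body_def)
  obtain l0 where l0: "l0 \<in> bm_factors K L" using bm_factors_nonempty[OF assms] by blast
  obtain q where "q \<in> interior L" using assms by (auto simp: convex_body_def)
  then obtain t where t: "t > 0" "cball q t \<subseteq> L" using mem_interior_cball by metis
  obtain p where p: "p \<in> interior K" using assms by (auto simp: convex_body_def)
  obtain R where R: "R > 0" "\<And>z. z \<in> K \<Longrightarrow> norm z \<le> R"
    using compact_imp_bounded[OF cK] bounded_pos by metis
  define M where "M = l0 * (2 * R) / t"
  define B where "B = {1..l0} \<times> K \<times> L \<times> cball (0::'a \<Rightarrow>\<^sub>L 'a) M"
  define P where "P z = {y. \<exists>w\<in>L. (w, y) \<in>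
      {(w, (l::real, x, y, F::'a \<Rightarrow>\<^sub>L 'a)). z - x = blinfun_apply F (w - y)}}" for z
  define Q where "Q w = {y. \<exists>z\<in>K. (z, y) \<in>
      {(z, (l::real, x, y, F::'a \<Rightarrow>\<^sub>L 'a)). blinfun_apply F (w - y) = l *\<^sub>R (z - x)}}" for w
  define C where "C = B \<inter> (\<Inter>z\<in>K. P z) \<inter> (\<Inter>w\<in>L. Q w)"
  have "compact B" unfolding B_def using cK cL by (intro compact_Times) auto
  moreover have "closed (P z)" for z
    unfolding P_def
    by (rule closed_metric_projection[OF cL])
       (auto simp: case_prod_unfold intro!: closed_Collect_eq continuous_intros)
  moreover have "closed (Q w)" for w
    unfolding Q_def
    by (rule closed_metric_projection[OF cK])
       (auto simp: case_prod_unfold intro!: closed_Collect_eq continuous_intros)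
  ultimately have "compact C" unfolding C_def by (intro compact_Int_closed closed_INT) auto
  then have "compact (fst ` C)" by (intro compact_continuous_image continuous_intros)
  have sub: "fst ` C \<subseteq> bm_factors K L"
  proof
    fix l assume "l \<in> fst ` C"
    then obtain x y F where m: "(l, x, y, F) \<in> C" by force
    have l: "1 \<le> l" using m by (auto simp: C_def B_def)
    have 1: "\<exists>w\<in>L. z - x = blinfun_apply F (w - y)" if "z \<in> K" for z
      using m that unfolding C_def P_def by blast
    have 2: "\<exists>z\<in>K. blinfun_apply F (w - y) = l *\<^sub>R (z - x)" if "w \<in> L" for w
      using m that unfolding C_def Q_def by blast
    have lin: "linear (blinfun_apply F)"
      using blinfun.bounded_linear_right bounded_linear.linear by blast
    have "subspace (range (blinfun_apply F))" using lin by (simp add: linear_subspace_image)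
    have i1: "shift K x \<subseteq> blinfun_apply F ` shift L y"
      using 1 by (auto simp: shift_def image_iff)
    have i2: "blinfun_apply F ` shift L y \<subseteq> (\<lambda>z. l *\<^sub>R z) ` shift K x"
      using 2 by (auto simp: shift_def image_iff)
    have "(\<lambda>z. z - x) ` interior K \<subseteq> range (blinfun_apply F)"
      using i1 interior_subset by (fastforce simp: shift_def)
    moreover have "open ((\<lambda>z. z - x) ` interior K)"
      using open_translation_subtract by blast
    ultimately have "interior (range (blinfun_apply F)) \<noteq> {}"
      using p interior_maximal by blast
    then have "dim (range (blinfun_apply F)) = DIM('a)"
      using empty_interior_lowdim dim_subset_UNIV le_neq_implies_less by blast
    then have "span (range (blinfun_apply F)) = UNIV"
      by (simp only: dim_eq_full)
    then have surj: "surj (blinfun_apply F)"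
      using \<open>subspace _\<close> span_eq_iff by metis
    then have "bij (blinfun_apply F)"
      using linear_surjective_imp_injective[OF lin] by (simp add: bij_def)
    then show "l \<in> bm_factors K L" unfolding bm_factors_def using l lin i1 i2 by blast
  qed
  have sup: "l \<in> fst ` C" if l: "l \<in> bm_factors K L" "l \<le> l0" for l
  proof -
    obtain \<Phi> x y where f: "linear \<Phi>" "bij \<Phi>" "shift K x \<subseteq> \<Phi> ` shift L y"
      "\<Phi> ` shift L y \<subseteq> (\<lambda>z. l *\<^sub>R z) ` shift K x" and "1 \<le> l"
      using l unfolding bm_factors_def by blast
    have l1: "l > 1" using l False \<open>1 \<le> l\<close> by (cases "l = 1") auto
    have "compact (shift K x)" unfolding shift_def
      using cK by (intro compact_continuous_image continuous_intros)
    then have "0 \<in> shift K x"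
      using f p interior_subset
      by (intro zero_mem_if_subset_scaled[OF _ _ l1] compact_imp_closed)
         (auto simp: shift_def)
    then have x: "x \<in> K" by (auto simp: shift_def)
    have "0 \<in> \<Phi> ` shift L y" using \<open>0 \<in> shift K x\<close> f by blast
    then have "0 \<in> shift L y"
      using f(1,2) by (metis bij_is_inj image_iff linear_0 inj_eq)
    then have y: "y \<in> L" by (auto simp: shift_def)
    define F where "F = Blinfun \<Phi>"
    have F: "blinfun_apply F = \<Phi>"
      unfolding F_def using f(1) by (simp add: bounded_linear_Blinfun_apply linear_conv_bounded_linear)
    have bd: "\<exists>z\<in>K. \<Phi> (w - y) = l *\<^sub>R (z - x)" if "w \<in> L" for w
      using f(4) that by (auto simp: shift_def image_iff subset_iff)
    have fw: "\<exists>w\<in>L. z - x = \<Phi> (w - y)" if "z \<in> K" for z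
      using f(3) that by (auto simp: shift_def image_iff subset_iff)
    have b: "norm (\<Phi> v) \<le> l0 * (2 * R)" if v: "norm v \<le> t" for v
    proof -
      have "q + v \<in> L" "q \<in> L" using t v by (auto simp: dist_norm)
      then obtain z z' where z: "z \<in> K" "z' \<in> K" "\<Phi> (q + v - y) = l *\<^sub>R (z - x)"
        "\<Phi> (q - y) = l *\<^sub>R (z' - x)" using bd by metis
      have "\<Phi> v = \<Phi> (q + v - y) - \<Phi> (q - y)"
        using linear_diff[OF f(1), of "q + v - y" "q - y"] by simp
      also have "\<dots> = l *\<^sub>R (z - z')" unfolding z(3,4) by (simp add: algebra_simps)
      finally have "norm (\<Phi> v) = l * norm (z - z')" using l1 by simp
      also have "\<dots> \<le> l0 * (2 * R)"
        using R(2)[OF z(1)] R(2)[OF z(2)] norm_triangle_ineq4[of z z'] l(2) l1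
        by (intro mult_mono) auto
      finally show ?thesis .
    qed
    have "norm F \<le> M"
    proof (rule norm_blinfun_bound)
      have "l0 > 1" using l1 l by simp
      then show "0 \<le> M" using R t by (simp add: M_def)
      fix v :: 'a
      show "norm (blinfun_apply F v) \<le> M * norm v"
      proof (cases "v = 0")
        case False
        have "norm (\<Phi> ((t / norm v) *\<^sub>R v)) \<le> l0 * (2 * R)"
          by (rule b) (use False t in simp)
        then have "(t / norm v) * norm (\<Phi> v) \<le> l0 * (2 * R)"
          using t by (simp add: linear_scale[OF f(1)])
        then show ?thesis using False t by (simp add: F M_def field_simps)
      qed simp
    qed
    then have "(l, x, y, F) \<in> B" using x y l l1 by (simp add: B_def)
    moreover have "(l, x, y, F) \<in> P z" if "z \<in> K" for z
      using fw[OF that] by (auto simp: P_def F)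
    moreover have "(l, x, y, F) \<in> Q w" if "w \<in> L" for w
      using bd[OF that] by (auto simp: Q_def F)
    ultimately have "(l, x, y, F) \<in> C" by (auto simp: C_def)
    then show ?thesis by force
  qed
  have "fst ` C \<noteq> {}" using sup[OF l0] by auto
  then obtain m where m: "m \<in> fst ` C" "\<And>l. l \<in> fst ` C \<Longrightarrow> m \<le> l"
    using compact_attains_inf[OF \<open>compact (fst ` C)\<close>] by blast
  have "m \<le> l" if "l \<in> bm_factors K L" for l
  proof (cases "l \<le> l0")
    case True then show ?thesis using m(2) sup that by blast
  next
    case False then show ?thesis using m(2)[OF sup[OF l0]] by simp
  qed
  then have "Inf (bm_factors K L) = m"
    using m(1) sub by (intro cInf_eq_minimum) auto
  then show ?thesis using m(1) sub by (auto simp: banach_mazur_dist_def)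
qed

end

theory Submission
  imports Defs
begin

text \<open>
  The planar Blaschke-Santalo inequality is an eigenvalue estimate for a Hill equation, and its
  equality case survives perturbation.  Parametrise the boundary of the polar body of \<open>L\<close> by a
  curve \<open>X(t)\<close> such that the sector area swept out from the origin grows linearly in \<open>t\<close> (and \<open>t\<close>
  advances by \<open>2 * pi\<close>).  Then \<open>X'' = - q X\<close> for some \<open>q \<ge> 0\<close>, and the polar duality turns the area
  of \<open>L\<close> into the integral of \<open>q\<close>; explicitly, the volume product equals \<open>pi / 2\<close> times that integral.
  Suppose that a chord through the origin is bisected by it and cuts the polar body into halves of
  equal area.  With the chord on the first coordinate axis, each half is an arc running from \<open>(1, 0)\<close>
  to \<open>(-1, 0)\<close> for \<open>0 \<le> t \<le> pi\<close>.  Write \<open>X = (y, x)\<close>.  Since \<open>x\<close> is a solution which is positive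
  inside the arc and vanishes at its ends, Picone's identity makes the energy
  \<open>E(f) = integral of (f')^2 - q f^2\<close> equal to the integral of \<open>x^2 ((f / x)')^2\<close> for every \<open>f\<close>
  vanishing at the ends.  Taking \<open>f = sin t\<close> and \<open>f = cos t - y\<close> and adding shows that the integral of
  \<open>q\<close> over the arc, with the shares of the corners at its ends, is at most \<open>pi\<close>, the deficit being the sum of the two energies
  (\<open>area_product_deficit\<close>).

  If the deficit is of order \<open>\<epsilon>\<close>, the two weighted derivatives are small in the mean square, and by the
  Cauchy-Schwarz inequality \<open>sin t / x\<close> and \<open>(cos t - y) / x\<close> are nearly constant.  Up to a linear map
  the arc therefore is a half circle with error of order \<open>sqrt \<epsilon>\<close> (\<open>near_circle\<close>).  The weight
  degenerates at the two ends of the arc, where convexity of the curve takes over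
  (\<open>convex_end_point\<close>).  The linear map preserves the chord, so it is determined by a height \<open>c\<close> and
  a shear \<open>k\<close>.

  If \<open>L\<close> is origin-symmetric, the lower half is the reflection of the upper half and the proof is
  complete, with exponent \<open>1/2\<close>.  In general the heights of the two half-ellipses agree
  up to the error because the areas of the halves are equal.  If the shears were different, the
  tangents at the ends of the chord would jump; such a jump is convex at one end of the chord but
  concave at the other, and comparison with a chord at distance of order \<open>\<epsilon>^(1/4)\<close> bounds the
  difference of the shears by a multiple of \<open>\<epsilon>^(1/4)\<close> (\<open>kink_bound\<close>).

  A suitable centre exists for every convex body \<open>K\<close>: for \<open>x\<close> on the line midway between the two
  vertical supporting lines of \<open>K\<close> the horizontal chord of the polar body of \<open>K - x\<close> is bisected by
  the origin, and moving \<open>x\<close> along that line makes either half dominate, so that the halves have equal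
  area for some \<open>x\<close> (\<open>balancing_point\<close>).  The Santalo point minimises the volume of the polar body, so
  the hypothesis passes from the Santalo point to \<open>x\<close>.

  All integrals are replaced by finite sums: the curve is replaced by an inscribed polygon with
  vertices \<open>X_0, ..., X_n\<close>, and \<open>q\<close> by the second difference quotients of its vertices.  The
  discrete forms of the identities above are exact, so that no derivatives occur.
\<close>

section \<open>The discrete Hill equation of a convex arc\<close>

lemma one_minus_cos_le: "1 - cos u \<le> u\<^sup>2 / 2" for u :: real
proof -
  have "(sin (u / 2))\<^sup>2 \<le> (u / 2)\<^sup>2"
    using abs_sin_x_le_abs_x[of "u / 2"] by (metis abs_le_square_iff)
  then show ?thesis using cos_double_sin[of "u / 2"] by (simp add: power_divide)
qed

lemma chord_le_arc: "(sin b - sin a)\<^sup>2 + (cos b - cos a)\<^sup>2 \<le> (b - a)\<^sup>2" for a b :: real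
proof -
  have "(sin b - sin a)\<^sup>2 + (cos b - cos a)\<^sup>2 = 2 - 2 * cos (b - a)"
    using sin_cos_squared_add[of a] sin_cos_squared_add[of b]
    by (simp add: cos_diff power2_eq_square algebra_simps)
  also have "\<dots> \<le> (b - a)\<^sup>2" using one_minus_cos_le[of "b - a"] by simp
  finally show ?thesis .
qed

lemma summation_by_parts:
  fixes a F :: "nat \<Rightarrow> real"
  assumes "1 \<le> n"
  shows "(\<Sum>k<n. a k * (F (Suc k) - F k))
    = a (n - 1) * F n - a 0 * F 0 - (\<Sum>k=1..<n. (a k - a (k - 1)) * F k)"
  using assms
proof (induction n rule: nat_induct_at_least)
  case base
  then show ?case by (simp add: algebra_simps)
next
  case (Suc n)
  then show ?case by (cases n) (simp_all add: algebra_simps)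
qed

text \<open>The discrete Picone identity.  Edge by edge, \<open>(f' - f)^2\<close> differs from
  \<open>x x' (f'/x' - f/x)^2\<close> by \<open>(x' - x) (f'^2/x' - f^2/x)\<close>, where a prime denotes the next index; by
  summation by parts and the recurrence for \<open>x\<close> the sum of these differences is the potential
  term.  At the two end edges the convention \<open>0 / 0 = 0\<close> gives the correct values.\<close>

lemma picone_sum:
  fixes f x d q :: "nat \<Rightarrow> real"
  assumes n: "1 \<le> n" and d: "\<And>k. k < n \<Longrightarrow> d k > 0"
    and x: "\<And>k. 0 < k \<Longrightarrow> k < n \<Longrightarrow> x k > 0"
    and ends: "x 0 = 0" "x n = 0" "f 0 = 0" "f n = 0"
    and rec: "\<And>k. 0 < k \<Longrightarrow> k < n \<Longrightarrow>
      (x (Suc k) - x k) / d k - (x k - x (k - 1)) / d (k - 1) = - q k * x k"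
  shows "(\<Sum>k<n. (f (Suc k) - f k)\<^sup>2 / d k) - (\<Sum>k=1..<n. q k * (f k)\<^sup>2)
    = (\<Sum>k<n. x k * x (Suc k) * (f (Suc k) / x (Suc k) - f k / x k)\<^sup>2 / d k)"
proof -
  define F where "F k = (f k)\<^sup>2 / x k" for k
  define a where "a k = (x (Suc k) - x k) / d k" for k
  have edge: "(f (Suc k) - f k)\<^sup>2 / d k
      = x k * x (Suc k) * (f (Suc k) / x (Suc k) - f k / x k)\<^sup>2 / d k + a k * (F (Suc k) - F k)"
    if k: "k < n" for k
  proof -
    have "d k > 0" using d k by simp
    consider "k = 0" "Suc k = n" | "k = 0" "x (Suc k) > 0" | "k > 0" "x k > 0" "Suc k = n"
      | "x k > 0" "x (Suc k) > 0"
      using x[of k] x[of "Suc k"] k by (metis Suc_lessI gr0I zero_less_Suc)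
    then show ?thesis
    proof cases
      case 1 then show ?thesis using ends by (simp add: F_def a_def)
    next
      case 2 then show ?thesis using ends \<open>d k > 0\<close>
        by (simp add: F_def a_def field_simps power2_eq_square)
    next
      case 3 then show ?thesis using ends \<open>d k > 0\<close>
        by (simp add: F_def a_def field_simps power2_eq_square)
    next
      case 4
      then have "(f (Suc k) - f k)\<^sup>2 = x k * x (Suc k) * (f (Suc k) / x (Suc k) - f k / x k)\<^sup>2
        + (x (Suc k) - x k) * (F (Suc k) - F k)"
        unfolding F_def by (simp add: field_simps power2_eq_square)
      then show ?thesis using \<open>d k > 0\<close> by (simp add: a_def add_divide_distrib)
    qed
  qed
  have "(\<Sum>k<n. a k * (F (Suc k) - F k)) = - (\<Sum>k=1..<n. (a k - a (k - 1)) * F k)"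
    using summation_by_parts[OF n, of a F] ends by (simp add: F_def)
  also have "\<dots> = (\<Sum>k=1..<n. q k * (f k)\<^sup>2)"
    unfolding sum_negf[symmetric]
  proof (rule sum.cong)
    fix k assume k: "k \<in> {1..<n}"
    then have "a k - a (k - 1) = - q k * x k" using rec[of k] by (simp add: a_def)
    moreover have "x k > 0" using x k by simp
    ultimately show "- ((a k - a (k - 1)) * F k) = q k * (f k)\<^sup>2" by (simp add: F_def)
  qed simp
  finally have "(\<Sum>k<n. a k * (F (Suc k) - F k)) = (\<Sum>k=1..<n. q k * (f k)\<^sup>2)" .
  then show ?thesis using edge by (simp add: sum.distrib)
qed

text \<open>The points \<open>(y k, x k)\<close> run counter-clockwise along the boundary of a convex set containing the
  origin, from \<open>(1, 0)\<close> to \<open>(-1, 0)\<close>.  The pair \<open>(0, n)\<close> is excluded from \<open>turn\<close> because the end points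
  are opposite.  The inequality \<open>conv\<close> says that the middle one of three points does not lie on the
  near side of the chord through the other two.\<close>

locale convex_arc =
  fixes n :: nat and y x :: "nat \<Rightarrow> real"
  assumes two_le: "2 \<le> n"
    and ends: "y 0 = 1" "x 0 = 0" "y n = -1" "x n = 0"
    and turn: "\<And>i j. i < j \<Longrightarrow> j \<le> n \<Longrightarrow> (i, j) \<noteq> (0, n) \<Longrightarrow> y i * x j - y j * x i > 0"
    and conv: "\<And>i j k. i < j \<Longrightarrow> j < k \<Longrightarrow> k \<le> n \<Longrightarrow>
      y i * x k - y k * x i \<le> (y i * x j - y j * x i) + (y j * x k - y k * x j)"
begin

text \<open>\<open>d k\<close> is twice the area of the triangle spanned by the \<open>k\<close>-th edge and the origin, \<open>t\<close> is the
  swept area, rescaled so that the whole arc corresponds to \<open>[0, pi]\<close>, and \<open>q\<close> is the potential for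
  which both coordinates satisfy the Hill equation (lemma \<open>hill\<close>).  Geometrically \<open>q k\<close> is twice
  the area of the triangle dual to the \<open>k\<close>-th vertex.  The kinks at \<open>(1, 0)\<close> and \<open>(-1, 0)\<close> involve one
  edge of this arc and one edge of the opposite arc; the last two terms of \<open>Q\<close> are the shares of this
  arc.\<close>

definition d :: "nat \<Rightarrow> real" where "d k = y k * x (Suc k) - y (Suc k) * x k"

definition A :: real where "A = (\<Sum>k<n. d k)"

definition q :: "nat \<Rightarrow> real" where
  "q k = 1 / d k + 1 / d (k - 1)
    - (y (k - 1) * x (Suc k) - y (Suc k) * x (k - 1)) / (d (k - 1) * d k)"

definition Q :: real where
  "Q = (\<Sum>k=1..<n. q k) + (1 - y 1) / d 0 + (1 + y (n - 1)) / d (n - 1)"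

definition t :: "nat \<Rightarrow> real" where "t k = pi / A * (\<Sum>j<k. d j)"

lemma d_pos: "k < n \<Longrightarrow> d k > 0"
  unfolding d_def using turn[of k "Suc k"] two_le by (cases k) auto

lemma x_pos: "0 < k \<Longrightarrow> k < n \<Longrightarrow> x k > 0"
  using turn[of 0 k] ends by auto

lemma A_pos: "A > 0"
  unfolding A_def using two_le d_pos by (intro sum_pos) (auto simp: lessThan_empty_iff)

lemma t_ends: "t 0 = 0" "t n = pi"
  using A_pos by (simp_all add: t_def A_def)

lemma t_diff: "t (Suc k) - t k = pi / A * d k"
  by (simp add: t_def algebra_simps)

lemma t_step: "k < n \<Longrightarrow> t k < t (Suc k)"
proof -
  assume "k < n"
  then have "0 < pi / A * d k" using d_pos A_pos by simp
  then show ?thesis using t_diff[of k] by simp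
qed

lemma t_mono: "i \<le> j \<Longrightarrow> j \<le> n \<Longrightarrow> t i \<le> t j"
proof (induction j rule: nat_induct)
  case (Suc j)
  have "t j \<le> t (Suc j)" if "Suc j \<le> n"
    using t_step[of j] that by simp
  with Suc show ?case by (cases "i = Suc j") auto
qed simp

lemma t_less: "i < j \<Longrightarrow> j \<le> n \<Longrightarrow> t i < t j"
proof -
  assume "i < j" "j \<le> n"
  then have "t i < t (Suc i)" using t_step by simp
  also have "\<dots> \<le> t j" using \<open>i < j\<close> \<open>j \<le> n\<close> by (intro t_mono) auto
  finally show ?thesis .
qed

lemma t_bounds: "0 < k \<Longrightarrow> k < n \<Longrightarrow> 0 < t k \<and> t k < pi"
  using t_less[of 0 k] t_less[of k n] t_ends by auto

lemma sin_t_pos: "0 < k \<Longrightarrow> k < n \<Longrightarrow> 0 < sin (t k)"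
  using t_bounds sin_gt_zero by blast

lemma hill:
  assumes "0 < k" "k < n"
  shows "(x (Suc k) - x k) / d k - (x k - x (k - 1)) / d (k - 1) = - q k * x k"
    and "(y (Suc k) - y k) / d k - (y k - y (k - 1)) / d (k - 1) = - q k * y k"
proof -
  define m where "m = k - 1"
  have m: "Suc m = k" using assms by (simp add: m_def)
  have p: "d m > 0" "d k > 0" using d_pos[of m] d_pos[of k] assms m by auto
  define S where "S = y m * x (Suc k) - y (Suc k) * x m"
  have e: "d m * x (Suc k) + d k * x m = S * x k" "d m * y (Suc k) + d k * y m = S * y k"
    unfolding d_def S_def m by (simp_all add: algebra_simps)
  have q: "q k = 1 / d k + 1 / d m - S / (d m * d k)" by (simp add: q_def m_def S_def)
  have aux: "(c - b) / d k - (b - a) / d m = - q k * b" if "d m * c + d k * a = S * b" for a b c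
  proof -
    have "(c - b) / d k - (b - a) / d m = ((d m * c + d k * a) - (d m + d k) * b) / (d m * d k)"
      using p by (simp add: field_simps)
    also have "\<dots> = - q k * b" unfolding that q using p by (simp add: field_simps)
    finally show ?thesis .
  qed
  show "(x (Suc k) - x k) / d k - (x k - x (k - 1)) / d (k - 1) = - q k * x k"
    using aux[OF e(1)] by (simp add: m_def)
  show "(y (Suc k) - y k) / d k - (y k - y (k - 1)) / d (k - 1) = - q k * y k"
    using aux[OF e(2)] by (simp add: m_def)
qed

text \<open>As \<open>y\<close> solves the Hill equation, replacing \<open>f\<close> by \<open>f - y\<close> changes the energy only by boundary terms,
  and these are the end shares in \<open>Q\<close>.\<close>

lemma energy_shift:
  fixes f :: "nat \<Rightarrow> real"
  assumes f: "f 0 = 1" "f n = -1"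
  shows "(\<Sum>k<n. ((f (Suc k) - y (Suc k)) - (f k - y k))\<^sup>2 / d k) - (\<Sum>k=1..<n. q k * (f k - y k)\<^sup>2)
    = (\<Sum>k<n. (f (Suc k) - f k)\<^sup>2 / d k) - (\<Sum>k=1..<n. q k * (f k)\<^sup>2)
      - ((1 - y 1) / d 0 + (1 + y (n - 1)) / d (n - 1))"
proof -
  define a where "a k = (y (Suc k) - y k) / d k" for k
  have n1: "1 \<le> n" using two_le by simp
  have a0: "a 0 = - ((1 - y 1) / d 0)" using ends by (simp add: a_def diff_divide_distrib)
  have "Suc (n - 1) = n" using two_le by simp
  then have an: "a (n - 1) = - ((1 + y (n - 1)) / d (n - 1))"
    using ends by (simp add: a_def diff_divide_distrib add_divide_distrib)
  have parts: "(\<Sum>k<n. a k * (F (Suc k) - F k)) = a (n - 1) * F n - a 0 * F 0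
      + (\<Sum>k=1..<n. q k * y k * F k)" for F
  proof -
    have "(a k - a (k - 1)) * F k = - (q k * y k * F k)" if "k \<in> {1..<n}" for k
      using hill(2)[of k] that by (simp add: a_def)
    then show ?thesis using summation_by_parts[OF n1, of a F] by (simp add: sum_negf)
  qed
  have "((f (Suc k) - y (Suc k)) - (f k - y k))\<^sup>2 / d k = (f (Suc k) - f k)\<^sup>2 / d k
      - 2 * (a k * (f (Suc k) - f k)) + a k * (y (Suc k) - y k)" for k
    unfolding a_def by (cases "d k = 0") (simp_all add: field_simps power2_eq_square)
  then have 1: "(\<Sum>k<n. ((f (Suc k) - y (Suc k)) - (f k - y k))\<^sup>2 / d k)
      = (\<Sum>k<n. (f (Suc k) - f k)\<^sup>2 / d k)
      - 2 * (\<Sum>k<n. a k * (f (Suc k) - f k)) + (\<Sum>k<n. a k * (y (Suc k) - y k))"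
    by (simp add: sum.distrib sum_subtractf sum_distrib_left)
  have 2: "(\<Sum>k=1..<n. q k * (f k - y k)\<^sup>2) = (\<Sum>k=1..<n. q k * (f k)\<^sup>2)
      - 2 * (\<Sum>k=1..<n. q k * y k * f k) + (\<Sum>k=1..<n. q k * y k * y k)"
    unfolding sum_distrib_left sum_subtractf[symmetric] sum.distrib[symmetric]
    by (rule sum.cong) (simp_all add: power2_eq_square algebra_simps)
  show ?thesis unfolding 1 2 parts a0 an f ends by simp
qed

text \<open>The sum of the energies of \<open>sin t\<close> and \<open>cos t - y\<close>: the potential terms add up to \<open>Q\<close> because
  \<open>sin^2 + cos^2 = 1\<close>, and the derivative terms are squared chords of the unit circle, which
  are at most squared arc lengths.\<close>

lemma area_product_deficit:
  "(\<Sum>k<n. x k * x (Suc k) * (sin (t (Suc k)) / x (Suc k) - sin (t k) / x k)\<^sup>2 / d k)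
   + (\<Sum>k<n. x k * x (Suc k)
        * ((cos (t (Suc k)) - y (Suc k)) / x (Suc k) - (cos (t k) - y k) / x k)\<^sup>2 / d k)
   \<le> pi\<^sup>2 / A - Q"
proof -
  have n1: "1 \<le> n" using two_le by simp
  have S: "(\<Sum>k<n. (sin (t (Suc k)) - sin (t k))\<^sup>2 / d k) - (\<Sum>k=1..<n. q k * (sin (t k))\<^sup>2)
    = (\<Sum>k<n. x k * x (Suc k) * (sin (t (Suc k)) / x (Suc k) - sin (t k) / x k)\<^sup>2 / d k)"
    by (rule picone_sum[OF n1]) (use d_pos x_pos ends hill(1) t_ends in auto)
  have C: "(\<Sum>k<n. ((cos (t (Suc k)) - y (Suc k)) - (cos (t k) - y k))\<^sup>2 / d k)
        - (\<Sum>k=1..<n. q k * (cos (t k) - y k)\<^sup>2)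
    = (\<Sum>k<n. x k * x (Suc k) * ((cos (t (Suc k)) - y (Suc k)) / x (Suc k) - (cos (t k) - y k) / x k)\<^sup>2 / d k)"
    by (rule picone_sum[OF n1]) (use d_pos x_pos ends hill(1) t_ends in auto)
  have "(\<Sum>k<n. (sin (t (Suc k)) - sin (t k))\<^sup>2 / d k) + (\<Sum>k<n. (cos (t (Suc k)) - cos (t k))\<^sup>2 / d k)
      \<le> (\<Sum>k<n. (pi / A)\<^sup>2 * d k)"
    unfolding sum.distrib[symmetric]
  proof (rule sum_mono)
    fix k assume "k \<in> {..<n}"
    then have p: "d k > 0" using d_pos by simp
    have "(sin (t (Suc k)) - sin (t k))\<^sup>2 / d k + (cos (t (Suc k)) - cos (t k))\<^sup>2 / d k
        \<le> (t (Suc k) - t k)\<^sup>2 / d k"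
      unfolding add_divide_distrib[symmetric] using p chord_le_arc by (intro divide_right_mono) auto
    also have "\<dots> = (pi / A)\<^sup>2 * d k" using p by (simp add: t_diff power2_eq_square)
    finally show "(sin (t (Suc k)) - sin (t k))\<^sup>2 / d k + (cos (t (Suc k)) - cos (t k))\<^sup>2 / d k
        \<le> (pi / A)\<^sup>2 * d k" .
  qed
  also have "\<dots> = pi\<^sup>2 / A"
    unfolding sum_distrib_left[symmetric] using A_pos by (simp add: A_def[symmetric] power2_eq_square)
  finally have T: "(\<Sum>k<n. (sin (t (Suc k)) - sin (t k))\<^sup>2 / d k)
      + (\<Sum>k<n. (cos (t (Suc k)) - cos (t k))\<^sup>2 / d k) \<le> pi\<^sup>2 / A" .
  have "(\<Sum>k=1..<n. q k * (sin (t k))\<^sup>2) + (\<Sum>k=1..<n. q k * (cos (t k))\<^sup>2) = (\<Sum>k=1..<n. q k)"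
    unfolding sum.distrib[symmetric] distrib_left[symmetric] by simp
  then show ?thesis
    using T S C energy_shift[of "\<lambda>k. cos (t k)"] t_ends by (simp add: Q_def)
qed

lemma area_product_le: "A * Q \<le> pi\<^sup>2"
proof -
  have "0 \<le> x k * x (Suc k) * c\<^sup>2 / d k" if "k < n" for k c
  proof -
    have "0 \<le> x i" if "i \<le> n" for i
      using x_pos[of i] ends that by (cases "i = 0 \<or> i = n") auto
    then show ?thesis using d_pos that by (simp add: zero_le_mult_iff less_imp_le)
  qed
  then have "0 \<le> pi\<^sup>2 / A - Q"
    by (intro order_trans[OF _ area_product_deficit] add_nonneg_nonneg sum_nonneg) auto
  then show ?thesis using A_pos by (simp add: field_simps)
qed

end

section \<open>Elementary estimates\<close>

lemma sin_ge_half: "0 \<le> u \<Longrightarrow> u \<le> 1 \<Longrightarrow> u / 2 \<le> sin u" for u :: real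
proof -
  assume u: "0 \<le> u" "u \<le> 1"
  have "\<bar>sin u - u\<bar> \<le> u ^ 3 / 6"
    using Maclaurin_sin_bound[of u 3] u
    by (simp add: sin_coeff_def numeral_eq_Suc lessThan_Suc)
  moreover have "u ^ 3 \<le> u" using u power_decreasing[of 1 3 u] by simp
  ultimately show ?thesis by linarith
qed

lemma exp_bounds_two:
  fixes u :: real
  assumes "\<bar>u\<bar> \<le> 2"
  shows "exp u \<le> 9" "1 / 9 \<le> exp u" "\<bar>exp u - 1\<bar> \<le> 9 * \<bar>u\<bar>"
proof -
  have e2: "exp (2::real) \<le> 9"
  proof -
    have "exp (2::real) = exp 1 * exp 1" by (simp flip: exp_add)
    also have "\<dots> \<le> 3 * 3" by (intro mult_mono exp_le) auto
    finally show ?thesis by simp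
  qed
  have le: "exp v \<le> 9" if "\<bar>v\<bar> \<le> 2" for v :: real
    using order_trans[OF _ e2, of "exp v"] that by auto
  show "exp u \<le> 9" using le assms by blast
  have "exp (- u) \<le> 9" using le[of "- u"] assms by simp
  then show "1 / 9 \<le> exp u" by (simp add: exp_minus field_simps)
  have main: "exp v - 1 \<le> 9 * v" "1 - exp (- v) \<le> 9 * v" if "0 \<le> v" "v \<le> 2" for v :: real
  proof -
    have *: "1 - exp (- v) \<le> v" using exp_ge_add_one_self[of "- v"] by simp
    then have "exp v * (1 - exp (- v)) \<le> 9 * v" using le[of v] that by (intro mult_mono) auto
    then show "exp v - 1 \<le> 9 * v" by (simp add: algebra_simps flip: exp_add)
    show "1 - exp (- v) \<le> 9 * v" using * that by simp
  qed
  show "\<bar>exp u - 1\<bar> \<le> 9 * \<bar>u\<bar>"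
  proof (cases "0 \<le> u")
    case True then show ?thesis using main(1)[of u] assms by simp
  next
    case False then show ?thesis using main(2)[of "- u"] assms by simp
  qed
qed

lemma increment_sq_le_energy:
  fixes v p w :: "nat \<Rightarrow> real"
  assumes "i \<le> j" "\<And>k. i \<le> k \<Longrightarrow> k < j \<Longrightarrow> p k > 0" "\<And>k. i \<le> k \<Longrightarrow> k < j \<Longrightarrow> w k > 0"
  shows "(v j - v i)\<^sup>2 \<le> (\<Sum>k=i..<j. p k * (v (Suc k) - v k)\<^sup>2 / w k) * (\<Sum>k=i..<j. w k / p k)"
proof -
  have "v j - v i = (\<Sum>k=i..<j. v (Suc k) - v k)" using assms(1) by (simp add: sum_Suc_diff')
  also have "\<dots> = (\<Sum>k=i..<j. (sqrt (p k / w k) * (v (Suc k) - v k)) * sqrt (w k / p k))"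
    using assms(2,3) by (intro sum.cong) (auto simp: real_sqrt_divide less_imp_neq[symmetric])
  also have "\<dots>\<^sup>2 \<le> (\<Sum>k=i..<j. (sqrt (p k / w k) * (v (Suc k) - v k))\<^sup>2) * (\<Sum>k=i..<j. (sqrt (w k / p k))\<^sup>2)"
    by (rule Cauchy_Schwarz_ineq_sum)
  also have "\<dots> = (\<Sum>k=i..<j. p k * (v (Suc k) - v k)\<^sup>2 / w k) * (\<Sum>k=i..<j. w k / p k)"
    using assms(2,3) by (intro arg_cong2[where f = "(*)"] sum.cong)
      (auto simp: power_mult_distrib real_sqrt_pow2 divide_nonneg_pos less_imp_le)
  finally show ?thesis .
qed

lemma ln_ratio_sq_le:
  fixes a b :: real
  assumes "a > 0" "b > 0"
  shows "(ln b - ln a)\<^sup>2 \<le> (b - a)\<^sup>2 / (a * b)"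
proof -
  have main: "(2 * u)\<^sup>2 \<le> (exp u - exp (- u))\<^sup>2" if "0 \<le> u" for u :: real
  proof -
    have "exp 0 - exp (- 0) - 2 * 0 \<le> exp u - exp (- u) - 2 * u"
    proof (rule DERIV_nonneg_imp_nondecreasing[OF that])
      fix v :: real
      have "2 \<le> exp v + exp (- v)"
        using zero_le_power2[of "exp (v / 2) - exp (- (v / 2))"]
        by (simp add: power2_eq_square algebra_simps flip: exp_add)
      then show "\<exists>D. ((\<lambda>u. exp u - exp (- u) - 2 * u) has_real_derivative D) (at v) \<and> 0 \<le> D"
        by (intro exI[of _ "exp v + exp (- v) - 2"] conjI)
          (auto intro!: derivative_eq_intros)
    qed
    then have "2 * u \<le> exp u - exp (- u)" by simp
    then show ?thesis using that by (intro power_mono) auto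
  qed
  have main': "(2 * u)\<^sup>2 \<le> (exp u - exp (- u))\<^sup>2" for u :: real
    using main[of u] main[of "- u"] by (cases "0 \<le> u") (auto simp: power2_commute)
  define u where "u = (ln b - ln a) / 2"
  have 1: "ln b - ln a = 2 * u" by (simp add: u_def)
  have "exp u * exp u = b / a" "exp (- u) * exp (- u) = a / b" "exp u * exp (- u) = 1"
    using assms by (simp_all add: u_def exp_diff flip: exp_add)
  then have "(exp u - exp (- u))\<^sup>2 = b / a + a / b - 2"
    by (simp add: power2_eq_square algebra_simps)
  also have "\<dots> = (b - a)\<^sup>2 / (a * b)" using assms by (simp add: power2_eq_square field_simps)
  finally show ?thesis using main'[of u] unfolding 1 by simp
qed

text \<open>Control of a boundary point \<open>(z1, z2)\<close> lying between \<open>(1, 0)\<close> and a point \<open>(y1, x1)\<close> that is known to be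
  close to \<open>(1, 0)\<close>, with a further boundary point \<open>(c0, s0)\<close> far away.  Convexity for \<open>(1, 0)\<close>,
  \<open>(z1, z2)\<close>, \<open>(y1, x1)\<close> bounds \<open>z1\<close> from below, and convexity for \<open>(z1, z2)\<close>, \<open>(y1, x1)\<close>, \<open>(c0, s0)\<close>
  bounds it from above.  The lower bound \<open>e / 9\<close> of \<open>x1\<close> keeps \<open>(1 - y1) / x1\<close> bounded.\<close>

lemma convex_end_point:
  fixes e :: real
  assumes e: "0 < e" "e \<le> 1 / 1000000"
    and P: "\<bar>y1 - 1\<bar> \<le> 325 * e" "e / 9 \<le> x1" "x1 \<le> 39 * e"
    and M: "\<bar>c0\<bar> \<le> 1" "7 / 10 \<le> s0" "s0 \<le> 1"
    and Z: "0 < z2" "0 < z1 * x1 - y1 * z2"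
    and H1: "x1 \<le> z2 + (z1 * x1 - y1 * z2)"
    and H2: "z1 * s0 - c0 * z2 \<le> (z1 * x1 - y1 * z2) + (y1 * s0 - c0 * x1)"
  shows "\<bar>z1 - 1\<bar> \<le> 240000 * e" "z2 \<le> 79 * e"
proof -
  have y1: "1 / 2 \<le> y1" using P(1) e by simp
  have x1: "0 < x1" using P e by simp
  have yz: "z2 / 2 \<le> y1 * z2" using mult_right_mono[OF y1, of z2] Z by simp
  then have "0 < z1 * x1" using Z by linarith
  then have z1: "0 < z1" using x1 by (simp add: zero_less_mult_iff)
  have zx: "z1 * x1 \<le> z1 * (39 * e)" using P z1 by (intro mult_left_mono) auto
  have z2: "z2 \<le> 78 * e * z1" proof -
    have "z2 / 2 \<le> z1 * (39 * e)" using yz Z zx by linarith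
    then show ?thesis by (simp add: algebra_simps)
  qed
  have cz: "(c0 - y1) * z2 \<le> 1 * z2" using M P y1 Z by (intro mult_right_mono) auto
  have cx: "- (c0 * x1) \<le> 1 * x1"
    using mult_right_mono[of "- c0" 1 x1] M x1 by simp
  have ys: "y1 * s0 \<le> s0 + 325 * e"
  proof -
    have "(y1 - 1) * s0 \<le> \<bar>y1 - 1\<bar> * 1" using M by (intro mult_mono) auto
    then show ?thesis using P by (simp add: algebra_simps)
  qed
  have "z1 * s0 \<le> s0 + 364 * e + 117 * e * z1"
    using H2 cz cx ys zx z2 P by (simp add: algebra_simps)
  then have w: "(z1 - 1) * (s0 - 117 * e) \<le> 481 * e" by (simp add: algebra_simps)
  have up: "z1 - 1 \<le> 962 * e"
  proof (rule ccontr)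
    assume "\<not> ?thesis"
    then have "962 * e * (1 / 2) < (z1 - 1) * (s0 - 117 * e)"
      using M e by (intro mult_less_le_imp_less) auto
    then show False using w by simp
  qed
  then have "z1 \<le> 79 / 78" using e by simp
  then have "78 * e * z1 \<le> 78 * e * (79 / 78)" using e by (intro mult_left_mono) auto
  then show z2': "z2 \<le> 79 * e" using z2 by simp
  have "- (240000 * e) \<le> z1 - 1"
  proof (rule ccontr)
    assume "\<not> ?thesis"
    then have l: "240000 * e < 1 - z1" by simp
    have "e / 9 * (240000 * e) < x1 * (1 - z1)"
      using l P e by (intro mult_le_less_imp_less) auto
    also have "\<dots> \<le> z2 * (1 - y1)" using H1 by (simp add: algebra_simps)
    also have "\<dots> \<le> z2 * (325 * e)" using P Z by (intro mult_left_mono) auto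
    also have "\<dots> \<le> 79 * e * (325 * e)" using z2' e by (intro mult_right_mono) auto
    finally have "e * e * 240000 < e * e * (79 * 325 * 9)" by (simp add: algebra_simps)
    then show False using e by simp
  qed
  then show "\<bar>z1 - 1\<bar> \<le> 240000 * e" using up e by simp
qed

section \<open>Stability of a nearly extremal arc\<close>

lemma cos_ge_half: "0 \<le> r \<Longrightarrow> r \<le> 1 / 2 \<Longrightarrow> 1 / 2 \<le> cos r" for r :: real
  using one_minus_cos_le[of r] power_mono[of r "1 / 2" 2] by (simp add: power2_eq_square)

context convex_arc
begin

text \<open>The quotients of the trial functions \<open>sin t\<close> and \<open>cos t - y\<close> by the solution \<open>x\<close>; both are
  constant exactly when the vertices lie on a linear image of the half circle at the parameters \<open>t\<close>.\<close>

definition g :: "nat \<Rightarrow> real" where "g k = sin (t k) / x k"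

definition \<kappa> :: "nat \<Rightarrow> real" where "\<kappa> k = (cos (t k) - y k) / x k"

lemma x_nonneg: "k \<le> n \<Longrightarrow> 0 \<le> x k"
  using x_pos[of k] ends by (cases "k = 0 \<or> k = n") auto

lemma energies_le:
  assumes "pi\<^sup>2 - A * Q \<le> pi * e"
  shows "(\<Sum>k<n. x k * x (Suc k) * (g (Suc k) - g k)\<^sup>2 / (t (Suc k) - t k)) \<le> e" (is "?G \<le> e")
    and "(\<Sum>k<n. x k * x (Suc k) * (\<kappa> (Suc k) - \<kappa> k)\<^sup>2 / (t (Suc k) - t k)) \<le> e" (is "?K \<le> e")
proof -
  have nn: "0 \<le> (\<Sum>k<n. x k * x (Suc k) * (v (Suc k) - v k)\<^sup>2 / d k)" for v :: "nat \<Rightarrow> real"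
    using x_nonneg d_pos by (intro sum_nonneg) (simp add: less_imp_le)
  have eq: "(\<Sum>k<n. x k * x (Suc k) * (v (Suc k) - v k)\<^sup>2 / (t (Suc k) - t k))
      = A / pi * (\<Sum>k<n. x k * x (Suc k) * (v (Suc k) - v k)\<^sup>2 / d k)" for v :: "nat \<Rightarrow> real"
    unfolding t_diff sum_distrib_left using A_pos by (intro sum.cong) auto
  have *: "(\<Sum>k<n. x k * x (Suc k) * (g (Suc k) - g k)\<^sup>2 / d k)
      + (\<Sum>k<n. x k * x (Suc k) * (\<kappa> (Suc k) - \<kappa> k)\<^sup>2 / d k) \<le> pi\<^sup>2 / A - Q"
    using area_product_deficit unfolding g_def \<kappa>_def .
  have "A / pi * (pi\<^sup>2 / A - Q) = (pi\<^sup>2 - A * Q) / pi" using A_pos by (simp add: field_simps)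
  also have "\<dots> \<le> e" using assms by (simp add: field_simps)
  finally have e: "A / pi * (pi\<^sup>2 / A - Q) \<le> e" .
  have "A / pi * (\<Sum>k<n. x k * x (Suc k) * (g (Suc k) - g k)\<^sup>2 / d k) \<le> A / pi * (pi\<^sup>2 / A - Q)"
    using * nn[of \<kappa>] A_pos by (intro mult_left_mono) auto
  then show "?G \<le> e" unfolding eq using e by linarith
  have "A / pi * (\<Sum>k<n. x k * x (Suc k) * (\<kappa> (Suc k) - \<kappa> k)\<^sup>2 / d k) \<le> A / pi * (pi\<^sup>2 / A - Q)"
    using * nn[of g] A_pos by (intro mult_left_mono) auto
  then show "?K \<le> e" unfolding eq using e by linarith
qed

text \<open>The discrete form of the fact that \<open>- cot\<close> is an antiderivative of \<open>1 / sin^2\<close>.\<close>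

lemma cot_telescope:
  assumes "0 < i" "i \<le> j" "j < n" and mesh: "\<And>k. k < n \<Longrightarrow> t (Suc k) - t k \<le> 1"
  shows "(\<Sum>k=i..<j. (t (Suc k) - t k) / (sin (t k) * sin (t (Suc k)))) \<le> 2 * (cot (t i) - cot (t j))"
proof -
  have "(\<Sum>k=i..<j. (t (Suc k) - t k) / (sin (t k) * sin (t (Suc k))))
      \<le> (\<Sum>k=i..<j. - 2 * cot (t (Suc k)) - (- 2 * cot (t k)))"
  proof (rule sum_mono)
    fix k assume "k \<in> {i..<j}"
    then have k: "0 < k" "Suc k < n" using assms by auto
    have s: "0 < sin (t k)" "0 < sin (t (Suc k))" using sin_t_pos k by auto
    have "t (Suc k) - t k \<le> 2 * sin (t (Suc k) - t k)"
      using sin_ge_half[of "t (Suc k) - t k"] mesh[of k] t_step[of k] k by simp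
    then have "(t (Suc k) - t k) / (sin (t k) * sin (t (Suc k)))
        \<le> 2 * sin (t (Suc k) - t k) / (sin (t k) * sin (t (Suc k)))"
      using s by (intro divide_right_mono) auto
    also have "\<dots> = - 2 * cot (t (Suc k)) - (- 2 * cot (t k))"
      using s by (simp add: cot_def sin_diff field_simps)
    finally show "(t (Suc k) - t k) / (sin (t k) * sin (t (Suc k)))
        \<le> - 2 * cot (t (Suc k)) - (- 2 * cot (t k))" .
  qed
  also have "\<dots> = 2 * (cot (t i) - cot (t j))"
    using assms(2) by (subst sum_Suc_diff') (auto simp: algebra_simps)
  finally show ?thesis .
qed

text \<open>The Cauchy-Schwarz inequality turns a weighted energy bound into a pointwise bound, which degenerates
  only where the weight \<open>sin^2\<close> does.\<close>

lemma increment_le_cot: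
  fixes v :: "nat \<Rightarrow> real"
  assumes ij: "0 < i" "i \<le> j" "j < n" and mesh: "\<And>k. k < n \<Longrightarrow> t (Suc k) - t k \<le> 1"
    and E: "(\<Sum>k=i..<j. sin (t k) * sin (t (Suc k)) * (v (Suc k) - v k)\<^sup>2 / (t (Suc k) - t k)) \<le> e"
    and "0 \<le> e"
  shows "(v j - v i)\<^sup>2 \<le> 2 * e * (cot (t i) - cot (t j))"
proof -
  have p: "0 < sin (t k) * sin (t (Suc k))" "0 < t (Suc k) - t k" if "i \<le> k" "k < j" for k
    using sin_t_pos[of k] sin_t_pos[of "Suc k"] t_step[of k] ij that by auto
  have "(v j - v i)\<^sup>2 \<le> (\<Sum>k=i..<j. sin (t k) * sin (t (Suc k)) * (v (Suc k) - v k)\<^sup>2 / (t (Suc k) - t k))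
      * (\<Sum>k=i..<j. (t (Suc k) - t k) / (sin (t k) * sin (t (Suc k))))"
    using p by (intro increment_sq_le_energy ij) auto
  also have "\<dots> \<le> e * (2 * (cot (t i) - cot (t j)))"
    using p by (intro mult_mono E cot_telescope ij mesh sum_nonneg divide_nonneg_nonneg \<open>0 \<le> e\<close>)
      (auto simp: less_imp_le)
  finally show ?thesis by (simp add: algebra_simps)
qed

end

text \<open>The number \<open>e\<close> bounds both the deficit and the mesh, so that a single small parameter occurs in the
  error terms.\<close>

locale near_extremal_arc = convex_arc +
  fixes e :: real
  assumes e: "0 < e" "e \<le> 1 / 1000000"
    and mesh: "\<And>k. k < n \<Longrightarrow> t (Suc k) - t k \<le> e"
    and deficit: "pi\<^sup>2 - A * Q \<le> pi * e"
begin

lemma index_after: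
  assumes "0 < a" "a \<le> pi"
  obtains i where "0 < i" "i \<le> n" "a \<le> t i" "t i \<le> a + e" "\<And>j. j < i \<Longrightarrow> t j < a"
proof -
  define i where "i = (LEAST i. a \<le> t i)"
  have ex: "a \<le> t n" using assms t_ends by simp
  have i: "a \<le> t i" "i \<le> n" unfolding i_def using ex by (auto intro: LeastI Least_le)
  have less: "t j < a" if "j < i" for j using not_less_Least[of j "\<lambda>i. a \<le> t i"] that i_def by force
  have "0 < i" using i(1) assms t_ends by (cases i) auto
  moreover have "t i \<le> a + e"
  proof -
    have "Suc (i - 1) = i" "i - 1 < i" "i - 1 < n" using \<open>0 < i\<close> i(2) by auto
    then show ?thesis using less[of "i - 1"] mesh[of "i - 1"] by simp
  qed
  ultimately show ?thesis using that i less by blast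
qed

text \<open>Within \<open>2 * e\<close> of the ends of \<open>[0, pi]\<close> the pointwise bounds become useless: there \<open>e / sin t\<close> is
  no longer bounded.\<close>

definition good :: "nat \<Rightarrow> bool" where
  "good i \<longleftrightarrow> 0 < i \<and> i < n \<and> 2 * e \<le> t i \<and> t i \<le> pi - 2 * e"

lemma good_interval: "good i \<Longrightarrow> good j \<Longrightarrow> i \<le> k \<Longrightarrow> k \<le> j \<Longrightarrow> good k"
  unfolding good_def using t_mono[of i k] t_mono[of k j] by auto

lemma good_sin: "good i \<Longrightarrow> e \<le> sin (t i)"
proof -
  assume i: "good i"
  have se: "e \<le> sin (2 * e)" using sin_ge_half[of "2 * e"] e by simp
  have pi: "3 < pi" by (rule pi_gt3)
  show ?thesis
  proof (cases "t i \<le> pi / 2")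
    case True
    then have "sin (2 * e) \<le> sin (t i)" using i e pi by (intro sin_monotone_2pi_le) (auto simp: good_def)
    then show ?thesis using se by simp
  next
    case False
    then have "sin (2 * e) \<le> sin (pi - t i)" using i e pi by (intro sin_monotone_2pi_le) (auto simp: good_def)
    then show ?thesis using se by simp
  qed
qed

lemma mesh1: "k < n \<Longrightarrow> t (Suc k) - t k \<le> 1"
  using mesh[of k] e by simp

lemma ln_g_increment:
  assumes "0 < i" "i \<le> j" "j < n"
  shows "(ln (g j) - ln (g i))\<^sup>2 \<le> 2 * e * (cot (t i) - cot (t j))"
proof (rule increment_le_cot[OF assms mesh1])
  have "(\<Sum>k=i..<j. sin (t k) * sin (t (Suc k)) * (ln (g (Suc k)) - ln (g k))\<^sup>2 / (t (Suc k) - t k))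
      \<le> (\<Sum>k=i..<j. x k * x (Suc k) * (g (Suc k) - g k)\<^sup>2 / (t (Suc k) - t k))"
  proof (rule sum_mono)
    fix k assume "k \<in> {i..<j}"
    then have k: "0 < k" "Suc k < n" using assms by auto
    have p: "0 < x k" "0 < x (Suc k)" "0 < sin (t k)" "0 < sin (t (Suc k))" "0 < t (Suc k) - t k"
      using x_pos sin_t_pos t_step[of k] k by auto
    have gp: "0 < g k" "0 < g (Suc k)" using p by (simp_all add: g_def)
    have "sin (t k) * sin (t (Suc k)) * (ln (g (Suc k)) - ln (g k))\<^sup>2
        \<le> sin (t k) * sin (t (Suc k)) * ((g (Suc k) - g k)\<^sup>2 / (g k * g (Suc k)))"
      using p ln_ratio_sq_le[OF gp] by (intro mult_left_mono) auto
    also have "\<dots> = x k * x (Suc k) * (g (Suc k) - g k)\<^sup>2"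
    proof -
      have "sin (t k) * sin (t (Suc k)) = x k * x (Suc k) * (g k * g (Suc k))"
        using p by (simp add: g_def)
      then show ?thesis using gp by simp
    qed
    finally show "sin (t k) * sin (t (Suc k)) * (ln (g (Suc k)) - ln (g k))\<^sup>2 / (t (Suc k) - t k)
        \<le> x k * x (Suc k) * (g (Suc k) - g k)\<^sup>2 / (t (Suc k) - t k)"
      using p by (intro divide_right_mono) auto
  qed
  also have "\<dots> \<le> (\<Sum>k<n. x k * x (Suc k) * (g (Suc k) - g k)\<^sup>2 / (t (Suc k) - t k))"
    using x_nonneg t_step assms by (intro sum_mono2) (auto simp: less_imp_le)
  also have "\<dots> \<le> e" by (rule energies_le(1)[OF deficit])
  finally show "(\<Sum>k=i..<j. sin (t k) * sin (t (Suc k)) * (ln (g (Suc k)) - ln (g k))\<^sup>2 / (t (Suc k) - t k)) \<le> e" .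
qed (use e in auto)

lemma kappa_increment:
  assumes ij: "0 < i" "i \<le> j" "j < n" and c: "0 < c"
    and low: "\<And>k. i \<le> k \<Longrightarrow> k \<le> j \<Longrightarrow> c * sin (t k) \<le> x k"
  shows "(\<kappa> j - \<kappa> i)\<^sup>2 \<le> 2 * (e / c\<^sup>2) * (cot (t i) - cot (t j))"
proof (rule increment_le_cot[OF ij mesh1])
  have "(\<Sum>k=i..<j. sin (t k) * sin (t (Suc k)) * (\<kappa> (Suc k) - \<kappa> k)\<^sup>2 / (t (Suc k) - t k))
      \<le> (\<Sum>k=i..<j. 1 / c\<^sup>2 * (x k * x (Suc k) * (\<kappa> (Suc k) - \<kappa> k)\<^sup>2 / (t (Suc k) - t k)))"
  proof (rule sum_mono)
    fix k assume "k \<in> {i..<j}"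
    then have k: "0 < k" "Suc k < n" "i \<le> k" "k < j" using ij by auto
    have p: "0 < x k" "0 < x (Suc k)" "0 < sin (t k)" "0 < sin (t (Suc k))" "0 < t (Suc k) - t k"
      using x_pos sin_t_pos t_step[of k] k by auto
    have "(c * sin (t k)) * (c * sin (t (Suc k))) \<le> x k * x (Suc k)"
      using low k p c by (intro mult_mono) auto
    then have "sin (t k) * sin (t (Suc k)) \<le> 1 / c\<^sup>2 * (x k * x (Suc k))"
      using c by (simp add: field_simps power2_eq_square)
    then have "sin (t k) * sin (t (Suc k)) * ((\<kappa> (Suc k) - \<kappa> k)\<^sup>2 / (t (Suc k) - t k))
        \<le> 1 / c\<^sup>2 * (x k * x (Suc k)) * ((\<kappa> (Suc k) - \<kappa> k)\<^sup>2 / (t (Suc k) - t k))"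
      using p by (intro mult_right_mono) auto
    then show "sin (t k) * sin (t (Suc k)) * (\<kappa> (Suc k) - \<kappa> k)\<^sup>2 / (t (Suc k) - t k)
        \<le> 1 / c\<^sup>2 * (x k * x (Suc k) * (\<kappa> (Suc k) - \<kappa> k)\<^sup>2 / (t (Suc k) - t k))" by simp
  qed
  also have "\<dots> = 1 / c\<^sup>2 * (\<Sum>k=i..<j. x k * x (Suc k) * (\<kappa> (Suc k) - \<kappa> k)\<^sup>2 / (t (Suc k) - t k))"
    by (simp add: sum_distrib_left)
  also have "\<dots> \<le> 1 / c\<^sup>2 * (\<Sum>k<n. x k * x (Suc k) * (\<kappa> (Suc k) - \<kappa> k)\<^sup>2 / (t (Suc k) - t k))"
    using x_nonneg t_step ij by (intro mult_left_mono sum_mono2) (auto simp: less_imp_le)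
  also have "\<dots> \<le> 1 / c\<^sup>2 * e"
    using c by (intro mult_left_mono energies_le(2)[OF deficit]) auto
  finally show "(\<Sum>k=i..<j. sin (t k) * sin (t (Suc k)) * (\<kappa> (Suc k) - \<kappa> k)\<^sup>2 / (t (Suc k) - t k)) \<le> e / c\<^sup>2"
    by simp
qed (use e in auto)

text \<open>On the good indices \<open>x = c sin t exp u\<close> with \<open>u^2 \<le> 4 e / sin t\<close>, where the constant \<open>c\<close> is read off
  near \<open>t = pi / 2\<close>; since \<open>u\<close> is multiplied by \<open>sin t\<close>, the error in \<open>x / c\<close> is
  of order \<open>sqrt (e sin t)\<close>.  The same happens for \<open>y\<close> with the shear \<open>k\<close>.  The remaining indices are
  squeezed between an end of the arc and the first good index by \<open>convex_end_point\<close>.\<close>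

lemma near_circle:
  "\<exists>c>0. \<exists>k. \<forall>i\<le>n. \<bar>y i + k * x i - cos (t i)\<bar> \<le> 300 * sqrt e \<and> \<bar>x i / c - sin (t i)\<bar> \<le> 300 * sqrt e"
proof -
  have pi3: "3 < pi" "pi < 4" using pi_gt3 pi_less_4 by auto
  obtain m where m: "0 < m" "m \<le> n" "pi / 2 \<le> t m" "t m \<le> pi / 2 + e"
    by (rule index_after[of "pi / 2"]) (use e pi3 in auto)
  have "m < n" using m(2,4) t_ends e pi3 by (cases "m = n") auto
  have gm: "good m" unfolding good_def using m \<open>m < n\<close> e pi3 by auto
  have sm: "9 / 10 \<le> sin (t m)"
  proof -
    have "sin (t m) = cos (t m - pi / 2)" by (simp add: cos_diff)
    moreover have "(t m - pi / 2)\<^sup>2 \<le> e\<^sup>2" using m by (intro power_mono) auto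
    moreover have "e\<^sup>2 \<le> 1 / 1000000" using mult_mono[OF e(2), of e 1] e by (simp add: power2_eq_square)
    ultimately show ?thesis using one_minus_cos_le[of "t m - pi / 2"] by linarith
  qed
  have cm: "\<bar>cos (t m)\<bar> \<le> 1 / 2"
  proof -
    have "(cos (t m))\<^sup>2 = 1 - (sin (t m))\<^sup>2" by (simp add: cos_squared_eq)
    also have "\<dots> \<le> 1 - (9 / 10)\<^sup>2" using sm by (intro diff_mono power_mono) auto
    also have "\<dots> \<le> (1 / 2)\<^sup>2" by (simp add: power2_eq_square)
    finally have "\<bar>cos (t m)\<bar> \<le> \<bar>1 / 2\<bar>" by (simp only: abs_le_square_iff)
    then show ?thesis by simp
  qed
  define c where "c = x m / sin (t m)"
  define k where "k = \<kappa> m"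
  have c: "0 < c" using x_pos[of m] m \<open>m < n\<close> sm by (simp add: c_def)
  have cot_bound: "\<bar>cot (t m)\<bar> + \<bar>cot (t i)\<bar> \<le> 2 / sin (t i)" if "0 < i" "i < n" for i
  proof -
    have "0 < sin (t i)" using sin_t_pos that by blast
    have "\<bar>cot (t i)\<bar> \<le> 1 / sin (t i)"
      using \<open>0 < sin (t i)\<close> by (simp add: cot_def abs_divide divide_right_mono)
    moreover have "\<bar>cot (t m)\<bar> \<le> 1" using cm sm by (simp add: cot_def abs_divide field_simps)
    moreover have "1 \<le> 1 / sin (t i)" using \<open>0 < sin (t i)\<close> by simp
    ultimately show ?thesis by simp
  qed
  define u where "u i = ln (g m) - ln (g i)" for i
  have g_pos: "0 < g i" if "0 < i" "i < n" for i
    unfolding g_def using x_pos sin_t_pos that by simp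
  have xu: "x i = c * sin (t i) * exp (u i)" if "0 < i" "i < n" for i
  proof -
    have "exp (u i) = g m / g i" using g_pos that m \<open>m < n\<close> by (simp add: u_def exp_diff)
    then show ?thesis using x_pos[of i] sin_t_pos[of i] sin_t_pos[of m] x_pos[of m] m \<open>m < n\<close> that
      by (simp add: c_def g_def)
  qed
  have u2: "(u i)\<^sup>2 \<le> 4 * e / sin (t i)" if i: "0 < i" "i < n" for i
  proof -
    have "(u i)\<^sup>2 \<le> 2 * e * (\<bar>cot (t m)\<bar> + \<bar>cot (t i)\<bar>)"
    proof (cases "i \<le> m")
      case True
      have "(u i)\<^sup>2 \<le> 2 * e * (cot (t i) - cot (t m))"
        unfolding u_def using ln_g_increment[of i m] i True \<open>m < n\<close> by simp
      also have "\<dots> \<le> 2 * e * (\<bar>cot (t m)\<bar> + \<bar>cot (t i)\<bar>)" using e by (intro mult_left_mono) auto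
      finally show ?thesis .
    next
      case False
      have "(u i)\<^sup>2 \<le> 2 * e * (cot (t m) - cot (t i))"
        unfolding u_def using ln_g_increment[of m i] i False m by (simp add: power2_commute)
      also have "\<dots> \<le> 2 * e * (\<bar>cot (t m)\<bar> + \<bar>cot (t i)\<bar>)" using e by (intro mult_left_mono) auto
      finally show ?thesis .
    qed
    also have "\<dots> \<le> 2 * e * (2 / sin (t i))" using cot_bound[OF i] e by (intro mult_left_mono) auto
    finally show ?thesis by simp
  qed
  have u_abs: "\<bar>u i\<bar> \<le> 2 * sqrt (e / sin (t i))" "\<bar>u i\<bar> \<le> 2" if "good i" for i
  proof -
    have i: "0 < i" "i < n" using that by (auto simp: good_def)
    have "sqrt ((u i)\<^sup>2) \<le> sqrt (4 * (e / sin (t i)))" using u2[OF i] by (intro real_sqrt_le_mono) simp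
    also have "sqrt (4 * (e / sin (t i))) = sqrt 4 * sqrt (e / sin (t i))" by (rule real_sqrt_mult)
    finally show 1: "\<bar>u i\<bar> \<le> 2 * sqrt (e / sin (t i))" by simp
    have "e / sin (t i) \<le> 1" using good_sin[OF that] e by simp
    then have "sqrt (e / sin (t i)) \<le> 1" by simp
    then show "\<bar>u i\<bar> \<le> 2" using 1 by linarith
  qed
  have x_low: "c / 9 * sin (t i) \<le> x i" and x_up: "x i \<le> 9 * c * sin (t i)" if "good i" for i
  proof -
    have i: "0 < i" "i < n" using that by (auto simp: good_def)
    have p: "0 \<le> c * sin (t i)" using c sin_t_pos[OF i] by simp
    show "c / 9 * sin (t i) \<le> x i" "x i \<le> 9 * c * sin (t i)"
      unfolding xu[OF i]
      using mult_left_mono[OF exp_bounds_two(2)[OF u_abs(2)[OF that]] p]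
        mult_left_mono[OF exp_bounds_two(1)[OF u_abs(2)[OF that]] p] by (auto simp: mult_ac)
  qed
  have root: "s * sqrt (e / s) = sqrt (e * s)" if "0 < s" for s
  proof -
    have "s * sqrt (e / s) = sqrt (s\<^sup>2) * sqrt (e / s)" using that by simp
    also have "\<dots> = sqrt (s\<^sup>2 * (e / s))" by (rule real_sqrt_mult[symmetric])
    also have "s\<^sup>2 * (e / s) = e * s" using that by (simp add: power2_eq_square)
    finally show ?thesis .
  qed
  have good_x: "\<bar>x i / c - sin (t i)\<bar> \<le> 18 * sqrt (e * sin (t i))" if "good i" for i
  proof -
    have i: "0 < i" "i < n" using that by (auto simp: good_def)
    have s: "0 < sin (t i)" using sin_t_pos[OF i] .
    have "x i / c - sin (t i) = sin (t i) * (exp (u i) - 1)" using xu[OF i] c by (simp add: field_simps)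
    then have "\<bar>x i / c - sin (t i)\<bar> = sin (t i) * \<bar>exp (u i) - 1\<bar>" using s by (simp add: abs_mult)
    also have "\<dots> \<le> sin (t i) * (9 * (2 * sqrt (e / sin (t i))))"
      using exp_bounds_two(3)[OF u_abs(2)[OF that]] u_abs(1)[OF that] s by (intro mult_left_mono) auto
    also have "\<dots> = 18 * sqrt (e * sin (t i))" using root[OF s] by simp
    finally show ?thesis .
  qed
  have good_y: "\<bar>y i + k * x i - cos (t i)\<bar> \<le> 162 * sqrt (e * sin (t i))" if gi: "good i" for i
  proof -
    have i: "0 < i" "i < n" using gi by (auto simp: good_def)
    have s: "0 < sin (t i)" using sin_t_pos[OF i] .
    have c9: "0 < c / 9" using c by simp
    define E where "E = 2 * (e / (c / 9)\<^sup>2)"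
    have E: "0 \<le> E" using e by (simp add: E_def)
    have "(\<kappa> i - k)\<^sup>2 \<le> E * (\<bar>cot (t m)\<bar> + \<bar>cot (t i)\<bar>)"
    proof (cases "i \<le> m")
      case True
      have "(\<kappa> i - k)\<^sup>2 \<le> E * (cot (t i) - cot (t m))"
        unfolding k_def E_def
        using kappa_increment[of i m, OF _ True _ c9 x_low] i \<open>m < n\<close> good_interval[OF gi gm]
        by (simp add: power2_commute)
      also have "\<dots> \<le> E * (\<bar>cot (t m)\<bar> + \<bar>cot (t i)\<bar>)" using E by (intro mult_left_mono) auto
      finally show ?thesis .
    next
      case False
      have "(\<kappa> i - k)\<^sup>2 \<le> E * (cot (t m) - cot (t i))"
        unfolding k_def E_def
        using kappa_increment[of m i, OF _ _ _ c9 x_low] i m False good_interval[OF gm gi]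
        by simp
      also have "\<dots> \<le> E * (\<bar>cot (t m)\<bar> + \<bar>cot (t i)\<bar>)" using E by (intro mult_left_mono) auto
      finally show ?thesis .
    qed
    also have "\<dots> \<le> E * (2 / sin (t i))" using cot_bound[OF i] E by (intro mult_left_mono) auto
    also have "\<dots> = (18 / c * sqrt (e / sin (t i)))\<^sup>2"
      using s e by (simp add: E_def power_mult_distrib power_divide real_sqrt_pow2)
    finally have "\<bar>\<kappa> i - k\<bar> \<le> \<bar>18 / c * sqrt (e / sin (t i))\<bar>" by (simp only: abs_le_square_iff)
    then have kk: "\<bar>\<kappa> i - k\<bar> \<le> 18 / c * sqrt (e / sin (t i))" using c s e by simp
    have xi: "0 < x i" using x_pos i by simp
    have "y i + k * x i - cos (t i) = - ((\<kappa> i - k) * x i)"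
      using xi by (simp add: \<kappa>_def field_simps)
    then have "\<bar>y i + k * x i - cos (t i)\<bar> = \<bar>\<kappa> i - k\<bar> * x i" using xi by (simp add: abs_mult)
    also have "\<dots> \<le> (18 / c * sqrt (e / sin (t i))) * (9 * c * sin (t i))"
      using kk x_up[OF gi] xi by (intro mult_mono) auto
    also have "\<dots> = 162 * (sin (t i) * sqrt (e / sin (t i)))" using c by simp
    also have "\<dots> = 162 * sqrt (e * sin (t i))" unfolding root[OF s] ..
    finally show ?thesis .
  qed
  \<comment> \<open>The normalised arc. The linear map multiplies determinants by \<open>1 / c\<close> and so preserves convexity.\<close>
  define Y where "Y i = y i + k * x i" for i
  define X where "X i = x i / c" for i
  define D where "D i j = Y i * X j - Y j * X i" for i j
  have D_eq: "D i j = (y i * x j - y j * x i) / c" for i j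
    by (simp add: D_def Y_def X_def algebra_simps add_divide_distrib diff_divide_distrib)
  have D_pos: "0 < D i j" if "i < j" "j \<le> n" "(i, j) \<noteq> (0, n)" for i j
    using turn[OF that] c by (simp add: D_eq)
  have D_conv: "D i j \<le> D i l + D l j" if "i < l" "l < j" "j \<le> n" for i l j
    using conv[OF that] c by (simp add: D_eq divide_right_mono flip: add_divide_distrib)
  have Xm: "X m = sin (t m)" "Y m = cos (t m)"
  proof -
    have "0 < sin (t m)" using sm by simp
    moreover have "0 < x m" using x_pos[of m] m \<open>m < n\<close> by simp
    ultimately show "X m = sin (t m)" "Y m = cos (t m)" by (simp_all add: X_def Y_def c_def k_def \<kappa>_def)
  qed
  have XY_ends: "Y 0 = 1" "X 0 = 0" "Y n = -1" "X n = 0" using ends by (simp_all add: X_def Y_def)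
  have sqrt_e: "e \<le> sqrt e / 1000"
  proof -
    have "sqrt e \<le> sqrt ((1 / 1000)\<^sup>2)" using e by (intro real_sqrt_le_mono) (simp add: power2_eq_square)
    then have "sqrt e * sqrt e \<le> 1 / 1000 * sqrt e" using e by (intro mult_right_mono) auto
    then show ?thesis using e by simp
  qed
  have e_sq: "e\<^sup>2 \<le> e / 1000000" using mult_left_mono[OF e(2), of e] e by (simp add: power2_eq_square)
  \<comment> \<open>A good index next to either end of the arc; \<open>r\<close> is the distance of \<open>t i\<close> from that end.\<close>
  have edge: "\<bar>\<bar>Y i\<bar> - 1\<bar> \<le> 325 * e \<and> e / 9 \<le> X i \<and> X i \<le> 39 * e"
    if gi: "good i" and r: "r = t i \<or> r = pi - t i" "r \<le> 3 * e" "0 \<le> r" for i r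
  proof -
    have s: "sin (t i) \<le> 3 * e" "sin r = sin (t i)" using r sin_x_le_x[of r] by auto
    have ge: "e \<le> sin (t i)" using good_sin[OF gi] .
    have "e * sin (t i) \<le> e * (4 * e)" using s e by (intro mult_left_mono) auto
    then have q: "sqrt (e * sin (t i)) \<le> 2 * e"
      using e by (intro real_le_lsqrt) (auto simp: power2_eq_square)
    have "X i \<le> 39 * e" using good_x[OF gi] s q unfolding X_def by linarith
    moreover have "e / 9 \<le> X i"
    proof -
      have "e / 9 \<le> sin (t i) / 9" using ge by simp
      also have "\<dots> \<le> X i" using x_low[OF gi] c by (simp add: X_def field_simps)
      finally show ?thesis .
    qed
    moreover have "\<bar>\<bar>Y i\<bar> - 1\<bar> \<le> 325 * e"
    proof -
      have "r\<^sup>2 \<le> (3 * e)\<^sup>2" using r by (intro power_mono) auto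
      then have cr: "1 - cos r \<le> e" using one_minus_cos_le[of r] e_sq e unfolding power_mult_distrib by (simp only: power2_eq_square[of "3::real"] power2_eq_square[of "2::real"])
      have "\<bar>cos (t i)\<bar> = cos r" using r(1) cr e by auto
      moreover have "cos r \<le> 1" by simp
      moreover have "\<bar>\<bar>Y i\<bar> - \<bar>cos (t i)\<bar>\<bar> \<le> \<bar>Y i - cos (t i)\<bar>" by (rule abs_triangle_ineq3)
      ultimately show ?thesis using cr good_y[OF gi] q unfolding Y_def by linarith
    qed
    ultimately show ?thesis by blast
  qed
  have final: "\<bar>y i + k * x i - cos (t i)\<bar> \<le> 300 * sqrt e \<and> \<bar>x i / c - sin (t i)\<bar> \<le> 300 * sqrt e"
    if "i \<le> n" for i
  proof -
    consider "i = 0 \<or> i = n" | "good i" | "0 < i" "i < n" "t i < 2 * e" | "0 < i" "i < n" "pi - 2 * e < t i"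
    proof -
      have "i = 0 \<or> i = n \<or> good i \<or> (0 < i \<and> i < n \<and> t i < 2 * e) \<or> (0 < i \<and> i < n \<and> pi - 2 * e < t i)"
        using \<open>i \<le> n\<close> unfolding good_def by auto
      then show ?thesis using that by blast
    qed
    then show ?thesis
    proof cases
      case 1 then show ?thesis using ends t_ends e by auto
    next
      case 2
      have "sqrt (e * sin (t i)) \<le> sqrt e" using e by (intro real_sqrt_le_mono) (simp add: mult_left_le)
      moreover have "0 \<le> sqrt e" using e by simp
      ultimately show ?thesis using good_x[OF 2] good_y[OF 2] by linarith
    next
      case 3
      obtain l where l: "0 < l" "l \<le> n" "2 * e \<le> t l" "t l \<le> 2 * e + e" "\<And>j. j < l \<Longrightarrow> t j < 2 * e"
        by (rule index_after[of "2 * e"]) (use e pi3 in auto)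
      have il: "i < l" using 3 l t_mono[of l i] by force
      have lm: "l < m" using l(4) m e pi3 t_mono[of m l] l by force
      have gl: "good l" unfolding good_def using l e pi3 lm m by auto
      have E: "\<bar>\<bar>Y l\<bar> - 1\<bar> \<le> 325 * e" "e / 9 \<le> X l" "X l \<le> 39 * e"
        using edge[OF gl, of "t l"] l e by auto
      have "0 < Y l"
      proof -
        have "1 / 2 \<le> cos (t l)" by (rule cos_ge_half) (use l(3,4) e in auto)
        moreover have "sqrt (e * sin (t l)) \<le> 1 / 1000"
          by (rule real_le_lsqrt) (use mult_mono[OF e(2), of "sin (t l)" 1] good_sin[OF gl] e in \<open>auto simp: power2_eq_square\<close>)
        ultimately show ?thesis using good_y[OF gl] unfolding Y_def by linarith
      qed
      then have E1: "\<bar>Y l - 1\<bar> \<le> 325 * e" using E by simp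
      have *: "\<bar>Y i - 1\<bar> \<le> 240000 * e \<and> X i \<le> 79 * e"
      proof (rule conjI)
        have "0 < X i" using x_pos[of i] 3 c by (simp add: X_def)
        moreover have "0 < Y i * X l - Y l * X i" using D_pos[of i l] il 3 l by (auto simp: D_def)
        moreover have "X l \<le> X i + (Y i * X l - Y l * X i)"
          using D_conv[of 0 i l] il 3 l by (simp add: D_def XY_ends)
        moreover have "Y i * X m - Y m * X i \<le> (Y i * X l - Y l * X i) + (Y l * X m - Y m * X l)"
          using D_conv[of i l m] il lm m by (simp add: D_def)
        ultimately show "\<bar>Y i - 1\<bar> \<le> 240000 * e" "X i \<le> 79 * e"
          using convex_end_point[OF e E1 E(2,3), of "Y m" "X m" "X i" "Y i"] cm sm Xm by auto
      qed
      have "(t i)\<^sup>2 \<le> (2 * e)\<^sup>2" using 3 t_bounds[of i] by (intro power_mono) auto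
      then have "1 - cos (t i) \<le> e" using one_minus_cos_le[of "t i"] e_sq e unfolding power_mult_distrib by (simp only: power2_eq_square[of "3::real"] power2_eq_square[of "2::real"])
      moreover have "cos (t i) \<le> 1" by simp
      ultimately have "\<bar>Y i - cos (t i)\<bar> \<le> 250000 * e" using * e by linarith
      moreover have "0 < sin (t i)" "sin (t i) \<le> t i" using sin_t_pos[of i] sin_x_le_x[of "t i"] t_bounds[of i] 3 by auto
      moreover have "0 < X i" using x_pos[of i] 3 c by (simp add: X_def)
      ultimately show ?thesis using * 3 sqrt_e e unfolding Y_def X_def by linarith
    next
      case 4
      obtain l where l: "0 < l" "l \<le> n" "pi - 3 * e \<le> t l" "t l \<le> pi - 3 * e + e" "\<And>j. j < l \<Longrightarrow> t j < pi - 3 * e"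
        by (rule index_after[of "pi - 3 * e"]) (use e pi3 in auto)
      have il: "l < i" using 4 l t_mono[of i l] by force
      have lm: "m < l" using l m e pi3 t_mono[of l m] by force
      have gl: "good l" unfolding good_def using l e pi3 lm m il 4 by auto
      have E: "\<bar>\<bar>Y l\<bar> - 1\<bar> \<le> 325 * e" "e / 9 \<le> X l" "X l \<le> 39 * e"
        using edge[OF gl, of "pi - t l"] l e by auto
      have "0 < - Y l"
      proof -
        have "1 / 2 \<le> cos (pi - t l)" by (rule cos_ge_half) (use l(3,4) e in auto)
        then have "cos (t l) \<le> - 1 / 2" by simp
        moreover have "sqrt (e * sin (t l)) \<le> 1 / 1000"
          by (rule real_le_lsqrt) (use mult_mono[OF e(2), of "sin (t l)" 1] good_sin[OF gl] e in \<open>auto simp: power2_eq_square\<close>)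
        ultimately show ?thesis using good_y[OF gl] unfolding Y_def by linarith
      qed
      then have E1: "\<bar>- Y l - 1\<bar> \<le> 325 * e" using E by simp
      have *: "\<bar>- Y i - 1\<bar> \<le> 240000 * e \<and> X i \<le> 79 * e"
      proof (rule conjI)
        have "0 < X i" using x_pos[of i] 4 c by (simp add: X_def)
        moreover have "0 < (- Y i) * X l - (- Y l) * X i" using D_pos[of l i] il 4 l by (auto simp: D_def)
        moreover have "X l \<le> X i + ((- Y i) * X l - (- Y l) * X i)"
          using D_conv[of l i n] il 4 l by (simp add: D_def XY_ends)
        moreover have "(- Y i) * X m - (- Y m) * X i
            \<le> ((- Y i) * X l - (- Y l) * X i) + ((- Y l) * X m - (- Y m) * X l)"
          using D_conv[of m l i] il lm 4 by (simp add: D_def)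
        ultimately show "\<bar>- Y i - 1\<bar> \<le> 240000 * e" "X i \<le> 79 * e"
          using convex_end_point[OF e E1 E(2,3), of "- Y m" "X m" "X i" "- Y i"] cm sm Xm by auto
      qed
      \<comment> \<open>The right end is treated as the left end of the arc reflected in the second axis.\<close>
      define r where "r = pi - t i"
      have r: "cos (t i) = - cos r" "sin (t i) = sin r" "0 \<le> r" "r \<le> 2 * e"
        using t_bounds[of i] 4 by (auto simp: r_def)
      have "r\<^sup>2 \<le> (2 * e)\<^sup>2" using r by (intro power_mono) auto
      then have "1 - cos r \<le> e" using one_minus_cos_le[of r] e_sq e unfolding power_mult_distrib by (simp only: power2_eq_square[of "3::real"] power2_eq_square[of "2::real"])
      moreover have "cos r \<le> 1" by simp
      ultimately have "\<bar>Y i - cos (t i)\<bar> \<le> 250000 * e" using * e r by linarith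
      moreover have "0 < sin (t i)" "sin (t i) \<le> r" using sin_t_pos[of i] sin_x_le_x[of r] r 4 by auto
      moreover have "0 < X i" using x_pos[of i] 4 c by (simp add: X_def)
      ultimately show ?thesis using * r sqrt_e e unfolding Y_def X_def by linarith
    qed
  qed
  then show ?thesis using c by blast
qed

end

section \<open>Support functions and boundary points of the polar body\<close>

definition det2 :: "real^2 \<Rightarrow> real^2 \<Rightarrow> real" where
  "det2 p q = p$1 * q$2 - q$1 * p$2"

definition unit_vec :: "real \<Rightarrow> real^2" where
  "unit_vec a = vector [cos a, sin a]"

definition support :: "(real^2) set \<Rightarrow> real^2 \<Rightarrow> real" where
  "support L y = (SUP z\<in>L. z \<bullet> y)"

lemma inner_2: "(v::real^2) \<bullet> w = v$1 * w$1 + v$2 * w$2"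
  by (simp add: inner_vec_def sum_2)

lemma norm_2: "norm (v::real^2) = sqrt ((v$1)\<^sup>2 + (v$2)\<^sup>2)"
  by (simp add: norm_eq_sqrt_inner inner_2 power2_eq_square)

lemma vec_eq_2: "(v::real^2) = w \<longleftrightarrow> v$1 = w$1 \<and> v$2 = w$2"
  by (simp add: vec_eq_iff forall_2)

lemma unit_vec_nth [simp]: "unit_vec a $ 1 = cos a" "unit_vec a $ 2 = sin a"
  by (simp_all add: unit_vec_def)

lemma norm_unit_vec [simp]: "norm (unit_vec a) = 1"
  by (simp add: norm_2)

lemma unit_vec_nonzero [simp]: "unit_vec a \<noteq> 0"
  using norm_unit_vec[of a] by (metis norm_zero zero_neq_one)

lemma unit_vec_add_pi: "unit_vec (a + pi) = - unit_vec a"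
  by (simp add: vec_eq_2)

lemma polar_upper_half:
  assumes "0 \<le> (y::real^2)$2"
  obtains a where "0 \<le> a" "a \<le> pi" "y = norm y *\<^sub>R unit_vec a"
proof (cases "y = 0")
  case True then show ?thesis using that[of 0] by simp
next
  case False
  then have "0 < norm y" by simp
  have "(y$1 / norm y)\<^sup>2 + (y$2 / norm y)\<^sup>2 = 1"
  proof -
    have "(norm y)\<^sup>2 = (y$1)\<^sup>2 + (y$2)\<^sup>2" by (simp add: norm_2)
    from this[symmetric] show ?thesis using \<open>0 < norm y\<close>
      by (simp only: power_divide add_divide_distrib[symmetric]) simp
  qed
  then obtain a where "0 \<le> a" "a \<le> pi" "y$1 / norm y = cos a" "y$2 / norm y = sin a"
    using sincos_total_pi[of "y$2 / norm y" "y$1 / norm y"] assms by auto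
  then have "y$1 = norm y * cos a" "y$2 = norm y * sin a" using \<open>0 < norm y\<close> by (auto simp: divide_eq_eq)
  then show ?thesis using that[of a] \<open>0 \<le> a\<close> \<open>a \<le> pi\<close> by (simp add: vec_eq_2)
qed

locale planar_body =
  fixes L :: "(real^2) set"
  assumes compact_L: "compact L" and convex_L: "convex L" and zero_interior: "0 \<in> interior L"
begin

lemma zero_mem: "0 \<in> L" using zero_interior interior_subset by blast

lemma inner_bdd: "bdd_above ((\<lambda>z. z \<bullet> y) ` L)"
  by (intro bounded_imp_bdd_above compact_imp_bounded compact_continuous_image compact_L continuous_intros)

lemma support_le_iff: "support L y \<le> c \<longleftrightarrow> (\<forall>z\<in>L. z \<bullet> y \<le> c)"
  unfolding support_def using zero_mem by (intro cSUP_le_iff inner_bdd) auto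

lemma inner_le_support: "z \<in> L \<Longrightarrow> z \<bullet> y \<le> support L y"
  using support_le_iff[of y "support L y"] by simp

lemma support_attained: obtains z where "z \<in> L" "support L y = z \<bullet> y"
proof -
  have "continuous_on L (\<lambda>z. z \<bullet> y)" by (intro continuous_intros)
  then obtain z where "z \<in> L" "\<forall>w\<in>L. w \<bullet> y \<le> z \<bullet> y"
    using continuous_attains_sup[OF compact_L, of "\<lambda>z. z \<bullet> y"] zero_mem by blast
  then show ?thesis using that[of z] support_le_iff[of y "z \<bullet> y"] inner_le_support[of z y] by auto
qed

lemma mem_polar_iff: "y \<in> polar L \<longleftrightarrow> support L y \<le> 1"
  by (simp add: polar_def support_le_iff)

lemma support_scale: "0 \<le> a \<Longrightarrow> support L (a *\<^sub>R y) = a * support L y"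
proof (rule antisym)
  assume a: "0 \<le> a"
  show "support L (a *\<^sub>R y) \<le> a * support L y"
    unfolding support_le_iff using inner_le_support a by (auto intro: mult_left_mono)
  show "a * support L y \<le> support L (a *\<^sub>R y)"
    using support_attained[of y] inner_le_support by (metis inner_scaleR_right)
qed

lemma support_add: "support L (y + z) \<le> support L y + support L z"
  unfolding support_le_iff inner_add_right using inner_le_support by (auto intro: add_mono)

lemma support_bounds:
  obtains r R where "0 < r" "0 < R" "\<And>y. r * norm y \<le> support L y" "\<And>y. support L y \<le> R * norm y"
proof -
  obtain r where r: "r > 0" "cball 0 r \<subseteq> L" using zero_interior mem_interior_cball by metis
  obtain R where R: "R > 0" "\<And>z. z \<in> L \<Longrightarrow> norm z \<le> R"
    using compact_imp_bounded[OF compact_L] bounded_pos by metis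
  have "r * norm y \<le> support L y" for y
  proof (cases "y = 0")
    case True then show ?thesis using inner_le_support[OF zero_mem, of y] by simp
  next
    case False
    have "(r / norm y) *\<^sub>R y \<in> L" using r False by (auto simp: subset_iff)
    from inner_le_support[OF this, of y] show ?thesis
      using False by (simp add: dot_square_norm power2_eq_square)
  qed
  moreover have "support L y \<le> R * norm y" for y
    unfolding support_le_iff
  proof
    fix z assume "z \<in> L"
    have "z \<bullet> y \<le> norm z * norm y" by (rule norm_cauchy_schwarz)
    also have "\<dots> \<le> R * norm y" using R(2)[OF \<open>z \<in> L\<close>] by (simp add: mult_right_mono)
    finally show "z \<bullet> y \<le> R * norm y" .
  qed
  ultimately show ?thesis using that r R by blast
qed

lemma support_pos: "y \<noteq> 0 \<Longrightarrow> 0 < support L y"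
  using support_bounds by (metis mult_pos_pos order_less_le_trans zero_less_norm_iff)

lemma support_nonneg: "0 \<le> support L y"
  using inner_le_support[OF zero_mem, of y] by simp

lemma support_continuous: "continuous_on UNIV (support L)"
proof -
  obtain R where R: "0 < R" "\<And>y. support L y \<le> R * norm y" using support_bounds by metis
  have le: "support L y - support L z \<le> R * norm (y - z)" for y z
    using support_add[of "y - z" z] R(2)[of "y - z"] by simp
  have "R-lipschitz_on UNIV (support L)"
  proof (rule lipschitz_onI)
    show "dist (support L y) (support L z) \<le> R * dist y z" for y z
      using le[of y z] le[of z y] by (simp add: dist_norm norm_minus_commute abs_le_iff)
  qed (use R in simp)
  then show ?thesis by (rule lipschitz_on_continuous_on)
qed

text \<open>The boundary point of the polar body in direction \<open>a\<close>: the support function of \<open>L\<close> is the gauge of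
  its polar.\<close>

definition boundary_point :: "real \<Rightarrow> real^2" where
  "boundary_point a = (1 / support L (unit_vec a)) *\<^sub>R unit_vec a"

lemma support_unit_pos: "0 < support L (unit_vec a)"
  by (rule support_pos) simp

lemma support_boundary_point: "support L (boundary_point a) = 1"
  unfolding boundary_point_def using support_unit_pos[of a] by (subst support_scale) auto

lemma boundary_point_continuous: "continuous_on UNIV boundary_point"
proof -
  have "unit_vec = (\<lambda>a. cos a *\<^sub>R axis 1 1 + sin a *\<^sub>R axis 2 1)"
    by (rule ext) (simp add: vec_eq_2 axis_def)
  moreover have "continuous_on UNIV (\<lambda>a. cos a *\<^sub>R axis 1 1 + sin a *\<^sub>R axis 2 1 :: real^2)"
    by (intro continuous_intros)
  ultimately have u: "continuous_on UNIV unit_vec" by metis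
  have "support L (unit_vec a) \<noteq> 0" for a using support_unit_pos[of a] by simp
  then show ?thesis unfolding boundary_point_def
    by (intro continuous_intros continuous_on_compose2[OF support_continuous u] u) auto
qed

lemma det2_boundary_point:
  "det2 (boundary_point a) (boundary_point b)
     = sin (b - a) / (support L (unit_vec a) * support L (unit_vec b))"
  by (simp add: det2_def boundary_point_def sin_diff diff_divide_distrib mult_ac)

lemma det2_boundary_point_pos:
  "a < b \<Longrightarrow> b < a + pi \<Longrightarrow> 0 < det2 (boundary_point a) (boundary_point b)"
  unfolding det2_boundary_point using support_unit_pos by (intro divide_pos_pos sin_gt_zero) auto

lemma det2_boundary_point_nonneg:
  "a \<le> b \<Longrightarrow> b \<le> a + pi \<Longrightarrow> 0 \<le> det2 (boundary_point a) (boundary_point b)"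
  unfolding det2_boundary_point using support_unit_pos
  by (intro divide_nonneg_pos sin_ge_zero mult_pos_pos) auto

text \<open>Cramer's rule writes the middle point as a combination of the outer ones; subadditivity of the
  gauge shows that the coefficients add up to at least one.\<close>

lemma det2_convex:
  assumes "a \<le> b" "b \<le> c" "c \<le> a + pi"
  shows "det2 (boundary_point a) (boundary_point c)
    \<le> det2 (boundary_point a) (boundary_point b) + det2 (boundary_point b) (boundary_point c)"
proof -
  let ?A = "boundary_point a" and ?B = "boundary_point b" and ?C = "boundary_point c"
  have n: "0 \<le> det2 ?A ?C" "0 \<le> det2 ?A ?B" "0 \<le> det2 ?B ?C"
    using assms by (auto intro!: det2_boundary_point_nonneg)
  have "det2 ?A ?C *\<^sub>R ?B = det2 ?B ?C *\<^sub>R ?A + det2 ?A ?B *\<^sub>R ?C"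
    by (simp add: vec_eq_2 det2_def algebra_simps)
  then have "support L (det2 ?A ?C *\<^sub>R ?B) \<le> support L (det2 ?B ?C *\<^sub>R ?A) + support L (det2 ?A ?B *\<^sub>R ?C)"
    using support_add by simp
  then show ?thesis using n by (simp add: support_scale support_boundary_point)
qed

definition vertex :: "nat \<Rightarrow> nat \<Rightarrow> real^2" where
  "vertex n k = boundary_point (real k * pi / real n)"

lemma upper_cone:
  assumes n: "2 \<le> n" and y: "0 \<le> y$2"
  obtains k a b where "k < n" "0 \<le> a" "0 \<le> b" "y = a *\<^sub>R vertex n k + b *\<^sub>R vertex n (Suc k)"
proof -
  obtain s where s: "0 \<le> s" "s \<le> pi" "y = norm y *\<^sub>R unit_vec s" using polar_upper_half[OF y] by blast
  define k where "k = (if s = pi then n - 1 else nat \<lfloor>s * n / pi\<rfloor>)"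
  have k: "k < n" "real k * pi / n \<le> s" "s \<le> real (Suc k) * pi / n"
  proof -
    have "k < n \<and> real k * pi / n \<le> s \<and> s \<le> real (Suc k) * pi / n"
    proof (cases "s = pi")
      case True
      then show ?thesis using n by (auto simp: k_def of_nat_diff field_simps)
    next
      case False
      have p: "0 \<le> s * n / pi" using s by simp
      then have k: "real k \<le> s * n / pi" "s * n / pi < real k + 1" using False by (auto simp: k_def)
      have "s * n / pi < n" using False s n by (simp add: field_simps)
      then have "k < n" using k by linarith
      then show ?thesis using k n by (simp add: field_simps)
    qed
    then show "k < n" "real k * pi / n \<le> s" "s \<le> real (Suc k) * pi / n" by blast+
  qed
  define p q where "p = real k * pi / n" and "q = real (Suc k) * pi / n"
  have pq: "q - p = pi / n" using n by (simp add: p_def q_def field_simps)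
  have "pi / n \<le> pi" using n by (simp add: field_simps)
  have "0 < sin (pi / n)" using n by (intro sin_gt_zero) (auto simp: field_simps)
    define a b where "a = norm y * (sin (q - s) / sin (pi / n)) * support L (unit_vec p)"
      and "b = norm y * (sin (s - p) / sin (pi / n)) * support L (unit_vec q)"
    show ?thesis
    proof (rule that[OF k(1)])
      show "0 \<le> a" "0 \<le> b" unfolding a_def b_def using k pq \<open>0 < sin (pi / n)\<close> \<open>pi / n \<le> pi\<close>
        by (auto intro!: mult_nonneg_nonneg divide_nonneg_pos sin_ge_zero support_nonneg simp: p_def q_def)
      have "sin (pi / n) *\<^sub>R unit_vec s = sin (q - s) *\<^sub>R unit_vec p + sin (s - p) *\<^sub>R unit_vec q"
      proof -
        have "sin (q - p) * cos s = sin (q - s) * cos p + sin (s - p) * cos q"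
          "sin (q - p) * sin s = sin (q - s) * sin p + sin (s - p) * sin q"
          by (simp_all add: sin_diff algebra_simps)
        then show ?thesis by (simp add: vec_eq_2 pq)
      qed
      then have "unit_vec s = (sin (q - s) / sin (pi / n)) *\<^sub>R unit_vec p + (sin (s - p) / sin (pi / n)) *\<^sub>R unit_vec q"
        using \<open>0 < sin (pi / n)\<close> by (simp add: vec_eq_2 field_simps)
      then have "y = norm y *\<^sub>R ((sin (q - s) / sin (pi / n)) *\<^sub>R unit_vec p + (sin (s - p) / sin (pi / n)) *\<^sub>R unit_vec q)"
        using s(3) by simp
      also have "\<dots> = a *\<^sub>R vertex n k + b *\<^sub>R vertex n (Suc k)"
        using support_unit_pos[of p] support_unit_pos[of q]
        unfolding vertex_def p_def[symmetric] q_def[symmetric] a_def b_def boundary_point_def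
        by (simp add: scaleR_add_right)
      finally show "y = a *\<^sub>R vertex n k + b *\<^sub>R vertex n (Suc k)" .
    qed
qed

end

section \<open>Polygonal bounds for the two areas\<close>

lemma measure_triangle_zero:
  fixes p q :: "real^2"
  shows "measure lebesgue (convex hull {0, p, q}) = \<bar>det2 p q\<bar> / 2"
  using content_triangle[of 0 p q]
  by (simp add: det2_def measure_completion compact_imp_closed finite_imp_compact_convex_hull mult.commute)

lemma mem_triangle_zero:
  fixes p q :: "'a::real_vector"
  assumes "0 \<le> a" "0 \<le> b" "a + b \<le> 1"
  shows "a *\<^sub>R p + b *\<^sub>R q \<in> convex hull {0, p, q}"
  unfolding convex_hull_3 using assms
  by (intro CollectI exI[of _ "1 - a - b"] exI[of _ a] exI[of _ b]) auto

lemma lmeasurable_triangle: "convex hull {0, p, q} \<in> lmeasurable" for p q :: "real^2"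
  by (intro lmeasurable_compact finite_imp_compact_convex_hull) simp

lemma measure_le_sum_triangles:
  fixes S :: "(real^2) set" and p q :: "nat \<Rightarrow> real^2"
  assumes "S \<in> lmeasurable" "finite I" "S \<subseteq> (\<Union>k\<in>I. convex hull {0, p k, q k})"
  shows "measure lebesgue S \<le> (\<Sum>k\<in>I. \<bar>det2 (p k) (q k)\<bar> / 2)"
proof -
  have "measure lebesgue S \<le> measure lebesgue (\<Union>k\<in>I. convex hull {0, p k, q k})"
    using assms lmeasurable_triangle by (intro measure_mono_fmeasurable) (auto intro: fmeasurableD)
  also have "\<dots> \<le> (\<Sum>k\<in>I. measure lebesgue (convex hull {0, p k, q k}))"
    using assms lmeasurable_triangle by (intro measure_UNION_le) (auto intro: fmeasurableD)
  finally show ?thesis by (simp add: measure_triangle_zero)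
qed

lemma det2_scale: "det2 (a *\<^sub>R p) (b *\<^sub>R q) = a * b * det2 p q"
  by (simp add: det2_def algebra_simps)

definition upper :: "(real^2) set \<Rightarrow> (real^2) set" where
  "upper S = S \<inter> {y. 0 \<le> y$2}"

context planar_body
begin

lemma closed_polar: "closed (polar L)"
proof -
  have "polar L = (\<Inter>z\<in>L. {y. z \<bullet> y \<le> 1})" by (auto simp: polar_def)
  then show ?thesis by (auto intro!: closed_INT closed_halfspace_le)
qed

lemma compact_polar: "compact (polar L)"
proof -
  obtain r where r: "0 < r" "\<And>y. r * norm y \<le> support L y" using support_bounds by metis
  have "norm y \<le> 1 / r" if "y \<in> polar L" for y
    using r(2)[of y] that r(1) by (simp add: mem_polar_iff field_simps)
  then have "bounded (polar L)" by (auto simp: bounded_iff)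
  then show ?thesis using closed_polar compact_eq_bounded_closed by blast
qed

lemma convex_polar: "convex (polar L)"
proof -
  have "polar L = (\<Inter>z\<in>L. {y. z \<bullet> y \<le> 1})" by (auto simp: polar_def)
  then show ?thesis by (auto intro!: convex_INT convex_halfspace_le)
qed

lemma compact_upper: "compact (upper (polar L))"
  unfolding upper_def by (intro compact_Int_closed compact_polar closed_Collect_le continuous_intros)

lemma upper_lmeasurable: "upper (polar L) \<in> lmeasurable"
  by (rule lmeasurable_compact[OF compact_upper])

lemma planar_body_uminus: "planar_body (uminus ` L)"
proof
  show "compact (uminus ` L)" by (intro compact_continuous_image compact_L continuous_intros)
  show "convex (uminus ` L)" using convex_L convex_negations by blast
  show "0 \<in> interior (uminus ` L)"
    using zero_interior interior_negations[of L] by (auto simp: image_iff)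
qed

lemma support_uminus: "support (uminus ` L) y = support L (- y)"
  unfolding support_def image_image by simp

lemma boundary_point_uminus:
  "planar_body.boundary_point (uminus ` L) a = - boundary_point (a + pi)"
  unfolding planar_body.boundary_point_def[OF planar_body_uminus] boundary_point_def support_uminus unit_vec_add_pi
  by simp

lemma vertex_uminus: "1 \<le> n \<Longrightarrow> planar_body.vertex (uminus ` L) n k = - vertex n (n + k)"
  unfolding planar_body.vertex_def[OF planar_body_uminus] vertex_def boundary_point_uminus
  by (simp add: field_simps)

lemma vertex_period: "1 \<le> n \<Longrightarrow> vertex n (2 * n + k) = vertex n k"
proof -
  assume "1 \<le> n"
  then have "real (2 * n + k) * pi / n = real k * pi / n + 2 * pi" by (simp add: field_simps)
  then show ?thesis by (simp add: vertex_def boundary_point_def unit_vec_def)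
qed

lemma det2_vertex_pos: "2 \<le> n \<Longrightarrow> 0 < det2 (vertex n k) (vertex n (Suc k))"
  unfolding vertex_def by (intro det2_boundary_point_pos) (auto simp: field_simps)

text \<open>The potential of the discrete Hill equation satisfied by the vertices; it is the length of the edge
  dual to the vertex, measured in units of the vertex rotated by a right angle.\<close>

definition kink :: "nat \<Rightarrow> nat \<Rightarrow> real" where
  "kink n k = 1 / det2 (vertex n k) (vertex n (Suc k)) + 1 / det2 (vertex n (k - 1)) (vertex n k)
    - det2 (vertex n (k - 1)) (vertex n (Suc k)) / (det2 (vertex n (k - 1)) (vertex n k) * det2 (vertex n k) (vertex n (Suc k)))"

lemma kink_nonneg:
  assumes n: "2 \<le> n" and k: "1 \<le> k"
  shows "0 \<le> kink n k"
proof -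
  obtain m where m: "k = Suc m" using k by (cases k) auto
  let ?a = "det2 (vertex n m) (vertex n k)" and ?b = "det2 (vertex n k) (vertex n (Suc k))"
  have p: "0 < ?a" "0 < ?b" using det2_vertex_pos[OF n] m by auto
  have "det2 (vertex n m) (vertex n (Suc k)) \<le> ?a + ?b"
    unfolding vertex_def m using n by (intro det2_convex) (auto simp: field_simps)
  then have "0 \<le> (?a + ?b - det2 (vertex n m) (vertex n (Suc k))) / (?a * ?b)" using p by (intro divide_nonneg_pos) auto
  also have "\<dots> = kink n k" using p by (simp add: kink_def m add_divide_distrib diff_divide_distrib)
  finally show ?thesis .
qed

lemma exists_positive_inner:
  assumes n: "2 \<le> n" and z: "z \<noteq> 0"
  shows "\<exists>k\<in>{1..2*n}. 0 < z \<bullet> vertex n k"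
proof (rule ccontr)
  assume "\<not> ?thesis"
  then have neg: "z \<bullet> vertex n k \<le> 0" if "k \<in> {1..2*n}" for k using that by force
  have "vertex n 0 = vertex n (2 * n)" using vertex_period[of n 0] n by simp
  then have neg': "z \<bullet> vertex n k \<le> 0" if "k \<le> 2 * n" for k
    using neg[of k] neg[of "2 * n"] that n by (cases "k = 0") auto
  obtain k a b where kab: "k < 2 * n" "0 \<le> a" "0 \<le> b" "z = a *\<^sub>R vertex n k + b *\<^sub>R vertex n (Suc k)"
  proof (cases "0 \<le> z$2")
    case True
    then show ?thesis using upper_cone[OF n True] that by (metis less_le_trans le_add1 mult_2)
  next
    case False
    then have "0 \<le> (- z)$2" by simp
    then obtain k a b where "k < n" "0 \<le> a" "0 \<le> b"
      "- z = a *\<^sub>R planar_body.vertex (uminus ` L) n k + b *\<^sub>R planar_body.vertex (uminus ` L) n (Suc k)"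
      by (rule planar_body.upper_cone[OF planar_body_uminus n])
    moreover from this have "z = a *\<^sub>R vertex n (n + k) + b *\<^sub>R vertex n (Suc (n + k))"
    proof -
      have "- z = - (a *\<^sub>R vertex n (n + k) + b *\<^sub>R vertex n (Suc (n + k)))"
        using \<open>- z = _\<close> n by (simp add: vertex_uminus)
      then show ?thesis by (simp only: neg_equal_iff_equal)
    qed
    ultimately show ?thesis using that[of "n + k" a b] by simp
  qed
  have "z \<bullet> z = a * (z \<bullet> vertex n k) + b * (z \<bullet> vertex n (Suc k))"
    by (subst (2) kab(4)) (simp add: inner_add_right)
  also have "\<dots> \<le> 0" using kab neg' by (intro add_nonpos_nonpos mult_nonneg_nonpos) auto
  finally show False using z inner_gt_zero_iff[of z] by linarith
qed

text \<open>The point having inner product one with the vertices \<open>k\<close> and \<open>Suc k\<close>, that is, a vertex of the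
  polygon polar to the inscribed polygon.\<close>

definition dual_vertex :: "nat \<Rightarrow> nat \<Rightarrow> real^2" where
  "dual_vertex n k = (1 / det2 (vertex n k) (vertex n (Suc k))) *\<^sub>R
     vector [vertex n (Suc k) $ 2 - vertex n k $ 2, vertex n k $ 1 - vertex n (Suc k) $ 1]"

lemma det2_dual_vertex: 
  assumes n: "2 \<le> n" and k: "1 \<le> k"
  shows "det2 (dual_vertex n (k - 1)) (dual_vertex n k) = kink n k"
proof -
  obtain m where m: "k = Suc m" using k by (cases k) auto
  let ?a = "det2 (vertex n m) (vertex n k)" and ?b = "det2 (vertex n k) (vertex n (Suc k))"
  have p: "0 < ?a" "0 < ?b" using det2_vertex_pos[OF n] m by auto
  have "det2 (dual_vertex n (k - 1)) (dual_vertex n k) = (?a + ?b - det2 (vertex n m) (vertex n (Suc k))) / (?a * ?b)"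
  proof -
    have "det2 (vector [vertex n k $ 2 - vertex n m $ 2, vertex n m $ 1 - vertex n k $ 1])
        (vector [vertex n (Suc k) $ 2 - vertex n k $ 2, vertex n k $ 1 - vertex n (Suc k) $ 1])
      = ?a + ?b - det2 (vertex n m) (vertex n (Suc k))"
      by (simp add: det2_def algebra_simps)
    then show ?thesis unfolding dual_vertex_def by (simp add: det2_scale m)
  qed
  also have "\<dots> = kink n k" using p by (simp add: kink_def m add_divide_distrib diff_divide_distrib)
  finally show ?thesis .
qed

text \<open>\<open>L\<close> is contained in the dual polygon, which is covered by the triangles between the origin and
  consecutive dual vertices.  The triangle containing a given \<open>z\<close> belongs to the vertex at which the
  inner product with \<open>z\<close> is largest: comparing with the two neighbouring vertices places \<open>z\<close>
  between two consecutive dual vertices.\<close>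

lemma volume_le_kinks:
  assumes n: "2 \<le> n"
  shows "2 * measure lebesgue L \<le> (\<Sum>k=1..2*n. kink n k)"
proof -
  have cover: "L \<subseteq> (\<Union>k\<in>{1..2*n}. convex hull {0, dual_vertex n (k - 1), dual_vertex n k})"
  proof
    fix z assume z: "z \<in> L"
    show "z \<in> (\<Union>k\<in>{1..2*n}. convex hull {0, dual_vertex n (k - 1), dual_vertex n k})"
    proof (cases "z = 0")
      case True
      have "z \<in> convex hull {0, dual_vertex n (1 - 1), dual_vertex n 1}" using True by (simp add: hull_inc)
      then show ?thesis using n by (intro UN_I[of 1]) auto
    next
      case False
      define M where "M = Max ((\<lambda>k. z \<bullet> vertex n k) ` {1..2*n})"
      have fin: "finite ((\<lambda>k. z \<bullet> vertex n k) ` {1..2*n})" by simp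
      have "M \<in> (\<lambda>k. z \<bullet> vertex n k) ` {1..2*n}" unfolding M_def using n by (intro Max_in) auto
      then obtain k where k: "1 \<le> k" "k \<le> 2 * n" "z \<bullet> vertex n k = M" by auto
      have le: "z \<bullet> vertex n j \<le> M" if "1 \<le> j" "j \<le> 2 * n" for j
        unfolding M_def using that by (intro Max_ge) auto
      have "vertex n 0 = vertex n (2 * n)" "vertex n (Suc (2 * n)) = vertex n 1"
        using vertex_period[of n 0] vertex_period[of n 1] n by auto
      then have le': "z \<bullet> vertex n j \<le> M" if "j \<le> Suc (2 * n)" for j
        using le[of j] le[of 1] le[of "2 * n"] that n by (cases "j = 0 \<or> j = Suc (2 * n)") auto
      have Mpos: "0 < M" using exists_positive_inner[OF n False] le by force
      have M1: "M \<le> 1" using inner_le_support[OF z, of "vertex n k"] k(3) support_boundary_point by (simp add: vertex_def)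
      obtain m where m: "k = Suc m" using k by (cases k) auto
      let ?P = "vertex n k" and ?U = "vertex n m" and ?W = "vertex n (Suc k)"
      define a b where "a = det2 ?U ?P" and "b = det2 ?P ?W"
      have ab: "0 < a" "0 < b" unfolding a_def b_def using det2_vertex_pos[OF n] m by auto
      define s s' where "s = (M - z \<bullet> ?W) / b" and "s' = (M - z \<bullet> ?U) / a"
      have ss: "0 \<le> s" "0 \<le> s'" unfolding s_def s'_def using ab le' k m by auto
      have P: "det2 ?P ?W *\<^sub>R z = M *\<^sub>R vector [?W$2 - ?P$2, ?P$1 - ?W$1] - (M - z \<bullet> ?W) *\<^sub>R vector [- ?P$2, ?P$1]"
        "det2 ?U ?P *\<^sub>R z = M *\<^sub>R vector [?P$2 - ?U$2, ?U$1 - ?P$1] + (M - z \<bullet> ?U) *\<^sub>R vector [- ?P$2, ?P$1]"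
        unfolding k(3)[symmetric] by (simp_all add: vec_eq_2 det2_def inner_2 algebra_simps)
      have z1: "z = M *\<^sub>R dual_vertex n k - s *\<^sub>R vector [- ?P$2, ?P$1]"
      proof -
        have "z = (1 / b) *\<^sub>R (b *\<^sub>R z)" using ab by simp
        also have "\<dots> = M *\<^sub>R dual_vertex n k - s *\<^sub>R vector [- ?P$2, ?P$1]"
          unfolding b_def[symmetric] P(1)[folded b_def] by (simp add: dual_vertex_def b_def[symmetric] s_def scaleR_diff_right)
        finally show ?thesis .
      qed
      have z2: "z = M *\<^sub>R dual_vertex n m + s' *\<^sub>R vector [- ?P$2, ?P$1]"
      proof -
        have "z = (1 / a) *\<^sub>R (a *\<^sub>R z)" using ab by simp
        also have "\<dots> = M *\<^sub>R dual_vertex n m + s' *\<^sub>R vector [- ?P$2, ?P$1]"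
          unfolding P(2)[folded a_def] by (simp add: dual_vertex_def m[symmetric] a_def[symmetric] s'_def scaleR_add_right)
        finally show ?thesis .
      qed
      have "\<exists>u v. 0 \<le> u \<and> 0 \<le> v \<and> u + v \<le> 1 \<and> z = u *\<^sub>R dual_vertex n m + v *\<^sub>R dual_vertex n k"
      proof (cases "s + s' = 0")
        case True
        then have "s = 0" using ss by simp
        then show ?thesis using z1 Mpos M1 by (intro exI[of _ 0] exI[of _ M]) auto
      next
        case False
        then have sp: "0 < s + s'" using ss by simp
        have "(s + s') *\<^sub>R z = s *\<^sub>R z + s' *\<^sub>R z" by (rule scaleR_add_left)
        also have "\<dots> = s *\<^sub>R (M *\<^sub>R dual_vertex n m + s' *\<^sub>R vector [- ?P$2, ?P$1]) + s' *\<^sub>R (M *\<^sub>R dual_vertex n k - s *\<^sub>R vector [- ?P$2, ?P$1])"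
          using z1 z2 by simp
        also have "\<dots> = (s * M) *\<^sub>R dual_vertex n m + (s' * M) *\<^sub>R dual_vertex n k"
          by (simp add: algebra_simps)
        finally have eq: "(s + s') *\<^sub>R z = (s * M) *\<^sub>R dual_vertex n m + (s' * M) *\<^sub>R dual_vertex n k" .
        have "z = (1 / (s + s')) *\<^sub>R ((s + s') *\<^sub>R z)" using sp by simp
        also have "\<dots> = (s * M / (s + s')) *\<^sub>R dual_vertex n m + (s' * M / (s + s')) *\<^sub>R dual_vertex n k"
          unfolding eq by (simp add: scaleR_add_right)
        finally have "z = (s * M / (s + s')) *\<^sub>R dual_vertex n m + (s' * M / (s + s')) *\<^sub>R dual_vertex n k" .
        moreover have "s * M / (s + s') + s' * M / (s + s') = M"
          using sp by (simp add: add_divide_distrib[symmetric] distrib_right[symmetric])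
        ultimately show ?thesis using ss sp Mpos M1
          by (intro exI[of _ "s * M / (s + s')"] exI[of _ "s' * M / (s + s')"]) auto
      qed
      then have "z \<in> convex hull {0, dual_vertex n m, dual_vertex n k}" using mem_triangle_zero by blast
      then show ?thesis using k m by (intro UN_I[of k]) auto
    qed
  qed
  have "measure lebesgue L \<le> (\<Sum>k=1..2*n. \<bar>det2 (dual_vertex n (k - 1)) (dual_vertex n k)\<bar> / 2)"
    using measure_le_sum_triangles[OF lmeasurable_compact[OF compact_L] _ cover] by simp
  also have "\<dots> = (\<Sum>k=1..2*n. kink n k) / 2"
    unfolding sum_divide_distrib using det2_dual_vertex[OF n] kink_nonneg[OF n] by (intro sum.cong) auto
  finally show ?thesis by simp
qed

text \<open>The triangles under the edges of the inscribed polygon nearly cover the upper half of the polar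
  body: a point \<open>m\<close> of an edge has gauge at least \<open>1 - \<eta>\<close>, as it differs from a vertex by a fraction of
  that edge.\<close>

lemma upper_area_le:
  assumes n: "2 \<le> n" and \<eta>: "0 \<le> \<eta>" "\<eta> < 1"
    and mesh: "\<And>k. k < n \<Longrightarrow> support L (vertex n k - vertex n (Suc k)) \<le> \<eta>"
  shows "2 * measure lebesgue (upper (polar L)) \<le> (\<Sum>k<n. det2 (vertex n k) (vertex n (Suc k))) / (1 - \<eta>)\<^sup>2"
    and "y \<in> upper (polar L) \<Longrightarrow> \<exists>k<n. \<exists>a b. 0 \<le> a \<and> 0 \<le> b \<and> (a + b) * (1 - \<eta>) \<le> 1
      \<and> y = a *\<^sub>R vertex n k + b *\<^sub>R vertex n (Suc k)"
proof -
  have ex: "\<exists>k<n. \<exists>a b. 0 \<le> a \<and> 0 \<le> b \<and> (a + b) * (1 - \<eta>) \<le> 1 \<and> y = a *\<^sub>R vertex n k + b *\<^sub>R vertex n (Suc k)"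
    if y: "y \<in> upper (polar L)" for y
  proof -
    obtain k a b where k: "k < n" "0 \<le> a" "0 \<le> b" "y = a *\<^sub>R vertex n k + b *\<^sub>R vertex n (Suc k)"
      using upper_cone[OF n, of y] y by (auto simp: upper_def)
    have "a + b = support L ((a + b) *\<^sub>R vertex n k)"
      using k support_boundary_point by (simp add: support_scale vertex_def)
    also have "(a + b) *\<^sub>R vertex n k = y + b *\<^sub>R (vertex n k - vertex n (Suc k))"
      using k(4) by (simp add: algebra_simps)
    also have "support L \<dots> \<le> support L y + support L (b *\<^sub>R (vertex n k - vertex n (Suc k)))" by (rule support_add)
    also have "\<dots> \<le> 1 + b * \<eta>"
      using y mesh[OF k(1)] k by (intro add_mono) (auto simp: upper_def mem_polar_iff support_scale mult_left_mono)
    also have "b * \<eta> \<le> (a + b) * \<eta>" using k \<eta> by (intro mult_right_mono) auto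
    finally have "(a + b) * (1 - \<eta>) \<le> 1" by (simp add: algebra_simps)
    then show ?thesis using k by blast
  qed
  show "y \<in> upper (polar L) \<Longrightarrow> \<exists>k<n. \<exists>a b. 0 \<le> a \<and> 0 \<le> b \<and> (a + b) * (1 - \<eta>) \<le> 1
      \<and> y = a *\<^sub>R vertex n k + b *\<^sub>R vertex n (Suc k)" by (rule ex)
  define s where "s = 1 / (1 - \<eta>)"
  have s: "0 < s" using \<eta> by (simp add: s_def)
  have "upper (polar L) \<subseteq> (\<Union>k\<in>{..<n}. convex hull {0, s *\<^sub>R vertex n k, s *\<^sub>R vertex n (Suc k)})"
  proof
    fix y assume "y \<in> upper (polar L)"
    from ex[OF this] obtain k a b where k: "k < n" "0 \<le> a" "0 \<le> b" "(a + b) * (1 - \<eta>) \<le> 1"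
      "y = a *\<^sub>R vertex n k + b *\<^sub>R vertex n (Suc k)" by blast
    have "(a * (1 - \<eta>)) *\<^sub>R (s *\<^sub>R vertex n k) + (b * (1 - \<eta>)) *\<^sub>R (s *\<^sub>R vertex n (Suc k)) \<in> convex hull {0, s *\<^sub>R vertex n k, s *\<^sub>R vertex n (Suc k)}"
      using k \<eta> by (intro mem_triangle_zero) (auto simp: distrib_right)
    also have "(a * (1 - \<eta>)) *\<^sub>R (s *\<^sub>R vertex n k) + (b * (1 - \<eta>)) *\<^sub>R (s *\<^sub>R vertex n (Suc k)) = y"
      unfolding k(5) s_def using \<eta> by simp
    finally show "y \<in> (\<Union>k\<in>{..<n}. convex hull {0, s *\<^sub>R vertex n k, s *\<^sub>R vertex n (Suc k)})" using k(1) by blast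
  qed
  from measure_le_sum_triangles[OF upper_lmeasurable _ this]
  have "measure lebesgue (upper (polar L)) \<le> (\<Sum>k<n. \<bar>det2 (s *\<^sub>R vertex n k) (s *\<^sub>R vertex n (Suc k))\<bar> / 2)" by simp
  also have "\<dots> = (\<Sum>k<n. s\<^sup>2 * det2 (vertex n k) (vertex n (Suc k)) / 2)"
  proof (rule sum.cong)
    fix k
    have "det2 (s *\<^sub>R vertex n k) (s *\<^sub>R vertex n (Suc k)) = s\<^sup>2 * det2 (vertex n k) (vertex n (Suc k))"
      by (simp add: det2_def power2_eq_square algebra_simps)
    then show "\<bar>det2 (s *\<^sub>R vertex n k) (s *\<^sub>R vertex n (Suc k))\<bar> / 2 = s\<^sup>2 * det2 (vertex n k) (vertex n (Suc k)) / 2"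
      using det2_vertex_pos[OF n, of k] by (simp add: abs_mult)
  qed simp
  also have "\<dots> = (\<Sum>k<n. det2 (vertex n k) (vertex n (Suc k))) / (1 - \<eta>)\<^sup>2 / 2"
    by (simp add: s_def sum_divide_distrib power_divide)
  finally show "2 * measure lebesgue (upper (polar L)) \<le> (\<Sum>k<n. det2 (vertex n k) (vertex n (Suc k))) / (1 - \<eta>)\<^sup>2" by simp
qed

lemma mesh_fine:
  assumes "0 < \<delta>"
  shows "\<exists>N. \<forall>n\<ge>N. \<forall>k<n. norm (vertex n k - vertex n (Suc k)) \<le> \<delta>"
proof -
  have "uniformly_continuous_on {0..pi} boundary_point"
    by (intro compact_uniformly_continuous continuous_on_subset[OF boundary_point_continuous]) auto
  then obtain r where r: "r > 0" "\<And>a b. a \<in> {0..pi} \<Longrightarrow> b \<in> {0..pi} \<Longrightarrow> dist a b < r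
      \<Longrightarrow> dist (boundary_point a) (boundary_point b) < \<delta>"
    unfolding uniformly_continuous_on_def using assms by metis
  define N where "N = Suc (nat \<lceil>pi / r\<rceil>)"
  show ?thesis
  proof (intro exI[of _ N] allI impI)
    fix n k assume n: "N \<le> n" and k: "k < n"
    have "pi / r < n" using n unfolding N_def by linarith
    then have "pi / n < r" using r k by (simp add: field_simps)
    moreover have "real k * pi / n - real (Suc k) * pi / n = - (pi / n)"
      by (simp add: distrib_right add_divide_distrib)
    moreover have "real k * pi / n \<le> pi" "real (Suc k) * pi / n \<le> pi"
      using k by (auto simp: divide_le_eq)
    ultimately show "norm (vertex n k - vertex n (Suc k)) \<le> \<delta>"
      using r(2)[of "real k * pi / n" "real (Suc k) * pi / n"] by (simp add: vertex_def dist_norm less_imp_le)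
  qed
qed

end

section \<open>The upper half of the polar body is close to half an ellipse\<close>

text \<open>The norms whose unit balls are the ellipses meeting the first axis in \<open>(1, 0)\<close> and \<open>(-1, 0)\<close>: \<open>c\<close> is the
  height of the ellipse and \<open>k\<close> its shear.\<close>

definition ellipse_norm :: "real \<Rightarrow> real \<Rightarrow> real^2 \<Rightarrow> real" where
  "ellipse_norm c k y = norm (vector [y$1 + k * y$2, y$2 / c] :: real^2)"

lemma abs_det2_le: "\<bar>det2 p q\<bar> \<le> norm p * norm (q - p)"
proof -
  have "det2 p q = vector [- p$2, p$1] \<bullet> (q - p)" by (simp add: det2_def inner_2 algebra_simps)
  then have "\<bar>det2 p q\<bar> \<le> norm (vector [- p$2, p$1] :: real^2) * norm (q - p)"
    using Cauchy_Schwarz_ineq2 by metis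
  also have "norm (vector [- p$2, p$1] :: real^2) = norm p" by (simp add: norm_2 add.commute)
  finally show ?thesis .
qed

lemma norm_le_abs_sum_2: "norm (v::real^2) \<le> \<bar>v$1\<bar> + \<bar>v$2\<bar>"
  using norm_le_l1_cart[of v] by (simp add: sum_2)

lemma norm_unit_vec_diff_le: "norm (unit_vec a - unit_vec b) \<le> \<bar>a - b\<bar>"
proof -
  have "(norm (unit_vec a - unit_vec b))\<^sup>2 \<le> (a - b)\<^sup>2"
    using chord_le_arc[of a b] by (simp add: norm_2 add.commute)
  then show ?thesis by (metis abs_le_square_iff abs_norm_cancel)
qed

text \<open>The polar body meets the first axis in the segment from \<open>(-1, 0)\<close> to \<open>(1, 0)\<close>, so the vertices
  of its upper half form a convex arc.  Applied to \<open>- L\<close>, every statement about the upper half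
  becomes one about the reflection of the lower half.\<close>

locale balanced_body = planar_body +
  assumes unit_width: "support L (vector [1, 0]) = 1" "support L (vector [-1, 0]) = 1"
begin

lemma balanced_uminus: "balanced_body (uminus ` L)"
proof -
  have "- vector [1, 0] = (vector [-1, 0] :: real^2)" "- vector [-1, 0] = (vector [1, 0] :: real^2)"
    by (simp_all add: vec_eq_2)
  then show ?thesis
    using planar_body_uminus unit_width
    by (simp add: balanced_body_def balanced_body_axioms_def support_uminus)
qed

lemma vertex_ends: "vertex n 0 = vector [1, 0]" "1 \<le> n \<Longrightarrow> vertex n n = vector [-1, 0]"
proof -
  have "unit_vec 0 = vector [1, 0]" "unit_vec pi = vector [-1, 0]" by (simp_all add: vec_eq_2)
  then show "vertex n 0 = vector [1, 0]" "1 \<le> n \<Longrightarrow> vertex n n = vector [-1, 0]"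
    using unit_width by (simp_all add: vertex_def boundary_point_def)
qed

lemma arc:
  assumes n: "2 \<le> n"
  shows "convex_arc n (\<lambda>k. vertex n k $ 1) (\<lambda>k. vertex n k $ 2)"
proof
  show "vertex n 0 $ 1 = 1" "vertex n 0 $ 2 = 0" "vertex n n $ 1 = - 1" "vertex n n $ 2 = 0" using n by (simp_all add: vertex_ends)
next
  fix i j assume ij: "i < j" "j \<le> n" "(i, j) \<noteq> (0, n)"
  then have "j < i + n" by (cases i) auto
  then have "real j * pi < (real i + n) * pi" by (intro mult_strict_right_mono) auto
  then have "0 < det2 (vertex n i) (vertex n j)"
    unfolding vertex_def using ij n by (intro det2_boundary_point_pos) (auto simp: field_simps)
  then show "0 < vertex n i $ 1 * vertex n j $ 2 - vertex n j $ 1 * vertex n i $ 2" by (simp add: det2_def)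
next
  fix i j k assume ijk: "i < j" "j < k" "k \<le> n"
  then have "real k * pi \<le> (real i + n) * pi" by (intro mult_right_mono) auto
  then have "det2 (vertex n i) (vertex n k) \<le> det2 (vertex n i) (vertex n j) + det2 (vertex n j) (vertex n k)"
    unfolding vertex_def using ijk n by (intro det2_convex) (auto simp: field_simps)
  then show "vertex n i $ 1 * vertex n k $ 2 - vertex n k $ 1 * vertex n i $ 2
      \<le> vertex n i $ 1 * vertex n j $ 2 - vertex n j $ 1 * vertex n i $ 2 + (vertex n j $ 1 * vertex n k $ 2 - vertex n k $ 1 * vertex n j $ 2)"
    by (simp add: det2_def)
qed (use n in simp)

abbreviation "arc_area n \<equiv> convex_arc.A n (\<lambda>k. vertex n k $ 1) (\<lambda>k. vertex n k $ 2)"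
abbreviation "arc_kinks n \<equiv> convex_arc.Q n (\<lambda>k. vertex n k $ 1) (\<lambda>k. vertex n k $ 2)"

lemma arc_d: "2 \<le> n \<Longrightarrow> convex_arc.d (\<lambda>k. vertex n k $ 1) (\<lambda>k. vertex n k $ 2) k = det2 (vertex n k) (vertex n (Suc k))"
  by (simp add: convex_arc.d_def[OF arc] det2_def)

lemma arc_area: "2 \<le> n \<Longrightarrow> arc_area n = (\<Sum>k<n. det2 (vertex n k) (vertex n (Suc k)))"
  by (simp add: convex_arc.A_def[OF arc] arc_d)

lemma arc_kinks: 
  assumes n: "2 \<le> n"
  shows "arc_kinks n = (\<Sum>k=1..<n. kink n k) + (1 - vertex n 1 $ 1) / det2 (vertex n 0) (vertex n 1)
      + (1 + vertex n (n - 1) $ 1) / det2 (vertex n (n - 1)) (vertex n n)"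
proof -
  have "convex_arc.q (\<lambda>k. vertex n k $ 1) (\<lambda>k. vertex n k $ 2) k = kink n k" if "k \<in> {1..<n}" for k
    unfolding convex_arc.q_def[OF arc[OF n]] arc_d[OF n] kink_def using that by (simp add: det2_def)
  then show ?thesis unfolding convex_arc.Q_def[OF arc[OF n]] arc_d[OF n] using n by simp
qed

lemma kink_vector:
  assumes n: "2 \<le> n" and k: "1 \<le> k"
  shows "kink n k * vertex n k $ 1 = (vertex n k $ 1 - vertex n (Suc k) $ 1) / det2 (vertex n k) (vertex n (Suc k))
    + (vertex n k $ 1 - vertex n (k - 1) $ 1) / det2 (vertex n (k - 1)) (vertex n k)"
proof -
  obtain m where m: "k = Suc m" using k by (cases k) auto
  define a b S where "a = det2 (vertex n m) (vertex n k)" and "b = det2 (vertex n k) (vertex n (Suc k))"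
    and "S = det2 (vertex n m) (vertex n (Suc k))"
  have p: "0 < a" "0 < b" using det2_vertex_pos[OF n] m by (auto simp: a_def b_def)
  have "S * vertex n k $ 1 = a * vertex n (Suc k) $ 1 + b * vertex n m $ 1"
    by (simp add: S_def a_def b_def det2_def algebra_simps)
  moreover have "(1 / b + 1 / a - S / (a * b)) * vertex n k $ 1 = ((a + b) * vertex n k $ 1 - S * vertex n k $ 1) / (a * b)"
    using p by (simp add: field_simps)
  ultimately have "(1 / b + 1 / a - S / (a * b)) * vertex n k $ 1
      = (vertex n k $ 1 - vertex n (Suc k) $ 1) / b + (vertex n k $ 1 - vertex n m $ 1) / a"
    using p by (simp add: field_simps)
  then show ?thesis unfolding kink_def m by (simp add: a_def b_def S_def m)
qed

text \<open>The kinks at \<open>(1, 0)\<close> and \<open>(-1, 0)\<close> split into a share of the upper and a share of the lower arc.\<close>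

lemma kinks_split:
  assumes n: "2 \<le> n"
  shows "(\<Sum>k=1..2*n. kink n k) = arc_kinks n + balanced_body.arc_kinks (uminus ` L) n"
proof -
  have kn: "planar_body.kink (uminus ` L) n k = kink n (n + k)" if "1 \<le> k" for k
    unfolding planar_body.kink_def[OF planar_body_uminus] kink_def
    using n that by (simp add: vertex_uminus det2_def)
  have "vertex n (2 * n) = vertex n 0" "vertex n (Suc (2 * n)) = vertex n 1"
    using vertex_period[of n 0] vertex_period[of n 1] n by auto
  note per = this
  have 1: "kink n n = (1 + vertex n (Suc n) $ 1) / det2 (vertex n n) (vertex n (Suc n))
      + (1 + vertex n (n - 1) $ 1) / det2 (vertex n (n - 1)) (vertex n n)"
    using kink_vector[OF n, of n] n by (simp add: vertex_ends algebra_simps add_divide_distrib diff_divide_distrib)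
  have 2: "kink n (2 * n) = (1 - vertex n 1 $ 1) / det2 (vertex n 0) (vertex n 1)
      + (1 - vertex n (2 * n - 1) $ 1) / det2 (vertex n (2 * n - 1)) (vertex n 0)"
    using kink_vector[OF n, of "2 * n"] n by (simp add: per vertex_ends)
  have 3: "balanced_body.arc_kinks (uminus ` L) n = (\<Sum>k=1..<n. kink n (n + k))
      + (1 + vertex n (Suc n) $ 1) / det2 (vertex n n) (vertex n (Suc n))
      + (1 - vertex n (2 * n - 1) $ 1) / det2 (vertex n (2 * n - 1)) (vertex n 0)"
  proof -
    have neg: "det2 (- p) (- q) = det2 p q" for p q by (simp add: det2_def)
    have "n + (n - 1) = 2 * n - 1" "n + n = 2 * n" using n by auto
    then show ?thesis
      unfolding balanced_body.arc_kinks[OF balanced_uminus n] using n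
      by (simp add: kn vertex_uminus neg per flip: mult_2)
  qed
  have "(\<Sum>k=1..2*n. kink n k) = (\<Sum>k=1..n. kink n k) + (\<Sum>k=n+1..2*n. kink n k)"
    using sum.ub_add_nat[of 1 n "kink n" n] n by (simp add: mult_2)
  also have "(\<Sum>k=1..n. kink n k) = (\<Sum>k=1..<n. kink n k) + kink n n"
    using n by (simp add: sum.last_plus add.commute)
  also have "(\<Sum>k=n+1..2*n. kink n k) = (\<Sum>k=1..n. kink n (n + k))"
    using sum.shift_bounds_cl_nat_ivl[of "kink n" 1 n n] by (simp add: mult_2 add.commute)
  also have "\<dots> = (\<Sum>k=1..<n. kink n (n + k)) + kink n (2 * n)"
    using n by (simp add: sum.last_plus add.commute mult_2)
  finally show ?thesis unfolding 1 2 3 arc_kinks[OF n] by simp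
qed

text \<open>Both half-arcs satisfy \<open>A Q \<le> pi^2\<close>.  The sum of the two values of \<open>Q\<close> is at least twice the area
  of \<open>L\<close>, and the values of \<open>A\<close> are bounded below by the equal areas of the halves, so a volume
  product close to \<open>pi^2\<close> leaves a deficit of order \<open>\<epsilon>\<close> for each arc.  The polygon is chosen so fine,
  depending on \<open>\<epsilon>\<close>, that the approximation adds no larger error.\<close>

theorem half_ellipse:
  assumes \<epsilon>: "0 < \<epsilon>" "\<epsilon> \<le> 1 / 10 ^ 10"
    and halves: "measure lebesgue (upper (polar (uminus ` L))) = measure lebesgue (upper (polar L))"
    and prod: "pi\<^sup>2 / (1 + \<epsilon>) \<le> measure lebesgue L * (2 * measure lebesgue (upper (polar L)))"
  shows "\<exists>c>0. \<exists>k. \<forall>y. 0 \<le> y$2 \<longrightarrow>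
    (ellipse_norm c k y \<le> 1 - 2500 * sqrt \<epsilon> \<longrightarrow> y \<in> polar L) \<and>
    (y \<in> polar L \<longrightarrow> ellipse_norm c k y \<le> 1 + 2500 * sqrt \<epsilon>)"
proof -
  interpret M: balanced_body "uminus ` L" by (rule balanced_uminus)
  define \<mu> where "\<mu> = measure lebesgue (upper (polar L))"
  have "0 < pi\<^sup>2 / (1 + \<epsilon>)" using \<epsilon> by (intro divide_pos_pos) auto
  then have "0 < measure lebesgue L * (2 * \<mu>)" using prod by (simp add: \<mu>_def)
  then have \<mu>: "0 < \<mu>" by (simp add: zero_less_mult_iff \<mu>_def measure_nonneg not_less)
  obtain r R where r: "0 < r" "0 < R" "\<And>y. r * norm y \<le> support L y" "\<And>y. support L y \<le> R * norm y"
    using support_bounds by metis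
  obtain R' where R': "0 < R'" "\<And>y. support (uminus ` L) y \<le> R' * norm y"
    using M.support_bounds by metis
  define \<delta> where "\<delta> = min (\<epsilon> / 4 / R) (min (\<epsilon> / 4 / R') (16 * \<epsilon> * \<mu> * r / 4))"
  have \<delta>: "0 < \<delta>" "R * \<delta> \<le> \<epsilon> / 4" "R' * \<delta> \<le> \<epsilon> / 4" "4 * \<delta> \<le> 16 * \<epsilon> * \<mu> * r"
  proof -
    show "0 < \<delta>" using r R' \<epsilon> \<mu> by (simp add: \<delta>_def)
    have "\<delta> \<le> \<epsilon> / 4 / R" "\<delta> \<le> \<epsilon> / 4 / R'" "\<delta> \<le> 16 * \<epsilon> * \<mu> * r / 4" by (simp_all add: \<delta>_def)
    then show "R * \<delta> \<le> \<epsilon> / 4" "R' * \<delta> \<le> \<epsilon> / 4" "4 * \<delta> \<le> 16 * \<epsilon> * \<mu> * r"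
      using r R' by (simp_all add: field_simps)
  qed
  obtain N1 where N1: "\<forall>n\<ge>N1. \<forall>k<n. norm (vertex n k - vertex n (Suc k)) \<le> \<delta>"
    using mesh_fine[OF \<delta>(1)] ..
  obtain N2 where N2: "\<forall>n\<ge>N2. \<forall>k<n. norm (M.vertex n k - M.vertex n (Suc k)) \<le> \<delta>"
    using M.mesh_fine[OF \<delta>(1)] ..
  define n where "n = Max {2, N1, N2}"
  have n: "2 \<le> n" "N1 \<le> n" "N2 \<le> n" by (simp_all add: n_def)
  have supp: "support L (vertex n k - vertex n (Suc k)) \<le> \<epsilon> / 4"
    "support (uminus ` L) (M.vertex n k - M.vertex n (Suc k)) \<le> \<epsilon> / 4" if "k < n" for k
    using order_trans[OF r(4) mult_left_mono[OF N1[rule_format, OF n(2) that], of R]]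
      order_trans[OF R'(2) mult_left_mono[OF N2[rule_format, OF n(3) that], of R']] r R' \<delta> by auto
  interpret C: convex_arc n "\<lambda>k. vertex n k $ 1" "\<lambda>k. vertex n k $ 2" by (rule arc[OF n(1)])
  interpret C': convex_arc n "\<lambda>k. M.vertex n k $ 1" "\<lambda>k. M.vertex n k $ 2" by (rule M.arc[OF n(1)])
  have \<epsilon>4: "0 \<le> \<epsilon> / 4" "\<epsilon> / 4 < 1" using \<epsilon> by auto
  have inv: "1 / (1 - \<epsilon> / 4)\<^sup>2 \<le> 1 + \<epsilon>"
  proof -
    have "\<epsilon> * \<epsilon> * \<epsilon> \<ge> 0" "\<epsilon> * \<epsilon> \<le> \<epsilon> * 1" using \<epsilon> by (auto intro: mult_left_mono)
    moreover have "(1 + \<epsilon>) * (1 - \<epsilon> / 4)\<^sup>2 = 1 + \<epsilon> / 2 - 7 / 16 * (\<epsilon> * \<epsilon>) + \<epsilon> * \<epsilon> * \<epsilon> / 16"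
      by (simp add: power2_eq_square field_simps)
    ultimately have "1 \<le> (1 + \<epsilon>) * (1 - \<epsilon> / 4)\<^sup>2"
      using \<epsilon> by linarith
    then show ?thesis using \<epsilon>4 by (simp add: divide_le_eq)
  qed
  have area: "2 * \<mu> \<le> C.A * (1 + \<epsilon>)" "2 * \<mu> \<le> C'.A * (1 + \<epsilon>)"
  proof -
    have "2 * \<mu> \<le> C.A * (1 / (1 - \<epsilon> / 4)\<^sup>2)"
      using upper_area_le(1)[OF n(1) \<epsilon>4 supp(1)] by (simp add: arc_area[OF n(1)] \<mu>_def)
    also have "\<dots> \<le> C.A * (1 + \<epsilon>)" using inv C.A_pos by (intro mult_left_mono) auto
    finally show "2 * \<mu> \<le> C.A * (1 + \<epsilon>)" .
    have "2 * \<mu> \<le> C'.A * (1 / (1 - \<epsilon> / 4)\<^sup>2)"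
      using M.upper_area_le(1)[OF n(1) \<epsilon>4 supp(2)] halves by (simp add: M.arc_area[OF n(1)] \<mu>_def)
    also have "\<dots> \<le> C'.A * (1 + \<epsilon>)" using inv C'.A_pos by (intro mult_left_mono) auto
    finally show "2 * \<mu> \<le> C'.A * (1 + \<epsilon>)" .
  qed
  have QQ: "pi\<^sup>2 / (1 + \<epsilon>) \<le> (C.Q + C'.Q) * \<mu>"
  proof -
    have "2 * measure lebesgue L \<le> C.Q + C'.Q" using volume_le_kinks[OF n(1)] kinks_split[OF n(1)] by simp
    then have "measure lebesgue L * 2 * \<mu> \<le> (C.Q + C'.Q) * \<mu>" using \<mu> by (intro mult_right_mono) auto
    then show ?thesis using prod by (simp add: \<mu>_def algebra_simps)
  qed
  have Q': "C'.Q * \<mu> \<le> pi\<^sup>2 * (1 + \<epsilon>) / 2"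
  proof (cases "0 \<le> C'.Q")
    case True
    have "C'.Q * (2 * \<mu>) \<le> C'.Q * (C'.A * (1 + \<epsilon>))" using area(2) True by (intro mult_left_mono) auto
    also have "\<dots> = (C'.A * C'.Q) * (1 + \<epsilon>)" by simp
    also have "\<dots> \<le> pi\<^sup>2 * (1 + \<epsilon>)" using C'.area_product_le \<epsilon> by (intro mult_right_mono) auto
    finally show ?thesis by simp
  next
    case False
    then have "C'.Q * \<mu> \<le> 0" using \<mu> by (simp add: mult_le_0_iff)
    also have "0 \<le> pi\<^sup>2 * (1 + \<epsilon>) / 2" using \<epsilon> by simp
    finally show ?thesis .
  qed
  define e where "e = 16 * \<epsilon>"
  have e: "0 < e" "e \<le> 1 / 1000000" using \<epsilon> by (auto simp: e_def)
  \<comment> \<open>The factor 16 comes from \<open>4 * \<epsilon> * pi^2 \<le> 16 * \<epsilon> * pi\<close>.\<close>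
  have deficit: "pi\<^sup>2 - C.A * C.Q \<le> pi * e"
  proof -
    define w where "w = 1 / (1 + \<epsilon>) - (1 + \<epsilon>) / 2"
    have i1: "1 - \<epsilon> \<le> 1 / (1 + \<epsilon>)" using \<epsilon> by (simp add: field_simps)
    have "(1 + \<epsilon>) / 2 \<le> 1 - \<epsilon>" using \<epsilon> by simp
    from order_trans[OF this i1] have w0: "0 \<le> w" by (simp only: w_def diff_ge_0_iff_ge)
    have "pi\<^sup>2 * w = pi\<^sup>2 / (1 + \<epsilon>) - pi\<^sup>2 * (1 + \<epsilon>) / 2" by (simp add: w_def right_diff_distrib)
    also have "\<dots> \<le> (C.Q + C'.Q) * \<mu> - C'.Q * \<mu>" using QQ Q' by (rule diff_mono)
    also have "\<dots> = C.Q * \<mu>" by (simp add: algebra_simps)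
    finally have "pi\<^sup>2 * w \<le> C.Q * \<mu>" .
    then have "C.A * (pi\<^sup>2 * w) \<le> C.A * (C.Q * \<mu>)" using C.A_pos by (intro mult_left_mono) auto
    moreover have "2 * \<mu> / (1 + \<epsilon>) * (pi\<^sup>2 * w) \<le> C.A * (pi\<^sup>2 * w)"
      using area(1) \<epsilon> w0 by (intro mult_right_mono) (auto simp: divide_le_eq)
    ultimately have "(2 / (1 + \<epsilon>) * (pi\<^sup>2 * w)) * \<mu> \<le> (C.A * C.Q) * \<mu>" by (simp add: mult_ac)
    then have "2 / (1 + \<epsilon>) * (pi\<^sup>2 * w) \<le> C.A * C.Q" using \<mu> by (rule mult_right_le_imp_le)
    then have "pi\<^sup>2 - C.A * C.Q \<le> pi\<^sup>2 * (1 - 2 / (1 + \<epsilon>) * w)" by (simp add: algebra_simps)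
    also have "1 - 2 / (1 + \<epsilon>) * w = 2 - 2 * (1 / (1 + \<epsilon>)) * (1 / (1 + \<epsilon>))"
      using \<epsilon> by (simp add: w_def right_diff_distrib)
    also have "\<dots> \<le> 4 * \<epsilon>"
    proof -
      have "(1 - \<epsilon>) * (1 - \<epsilon>) \<le> 1 / (1 + \<epsilon>) * (1 / (1 + \<epsilon>))" using i1 \<epsilon> by (intro mult_mono) auto
      moreover have "1 - 2 * \<epsilon> \<le> (1 - \<epsilon>) * (1 - \<epsilon>)" by (simp add: algebra_simps)
      ultimately have "1 - 2 * \<epsilon> \<le> 1 / (1 + \<epsilon>) * (1 / (1 + \<epsilon>))" by (rule order_trans[rotated])
      then show ?thesis by (simp add: mult.assoc)
    qed
    finally have "pi\<^sup>2 - C.A * C.Q \<le> pi\<^sup>2 * (4 * \<epsilon>)" by simp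
    also have "\<dots> = pi * (pi * (4 * \<epsilon>))" by (simp add: power2_eq_square)
    also have "\<dots> \<le> pi * (4 * (4 * \<epsilon>))" using pi_less_4 \<epsilon> by (intro mult_left_mono mult_right_mono) auto
    finally show ?thesis by (simp add: e_def)
  qed
  have mesh: "C.t (Suc k) - C.t k \<le> e" if "k < n" for k
  proof -
    have "r * norm (vertex n k) \<le> 1" using r(3)[of "vertex n k"] support_boundary_point by (simp add: vertex_def)
    then have Xr: "norm (vertex n k) \<le> 1 / r" using r by (simp add: field_simps)
    have "C.d k \<le> norm (vertex n k) * norm (vertex n (Suc k) - vertex n k)"
      unfolding arc_d[OF n(1)] using abs_det2_le[of "vertex n k" "vertex n (Suc k)"] by linarith
    also have "\<dots> \<le> 1 / r * \<delta>"
      using Xr N1[rule_format, OF n(2) that] r by (intro mult_mono) (auto simp: norm_minus_commute)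
    finally have dk: "C.d k \<le> 1 / r * \<delta>" .
    have "C.A * (1 + \<epsilon>) \<le> C.A * 2" using C.A_pos \<epsilon> by (intro mult_left_mono) auto
    then have "\<mu> \<le> C.A" using area(1) by simp
    then have "pi / C.A \<le> 4 / \<mu>" using \<mu> pi_less_4 by (intro frac_le) auto
    then have "pi / C.A * C.d k \<le> 4 / \<mu> * (1 / r * \<delta>)"
      using dk C.d_pos[OF that] C.A_pos \<mu> by (intro mult_mono) auto
    also have "\<dots> = 4 * \<delta> / (\<mu> * r)" by simp
    also have "\<dots> \<le> e" using \<delta>(4) \<mu> r by (simp add: e_def divide_le_eq mult.assoc)
    finally show ?thesis by (simp add: C.t_diff)
  qed
  interpret E: near_extremal_arc n "\<lambda>k. vertex n k $ 1" "\<lambda>k. vertex n k $ 2" e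
    by unfold_locales (use e mesh deficit in auto)
  obtain c k where c: "0 < c" and near: "\<And>i. i \<le> n \<Longrightarrow>
      \<bar>vertex n i $ 1 + k * vertex n i $ 2 - cos (C.t i)\<bar> \<le> 300 * sqrt e \<and> \<bar>vertex n i $ 2 / c - sin (C.t i)\<bar> \<le> 300 * sqrt e"
    using E.near_circle by blast
  define \<sigma> where "\<sigma> = sqrt \<epsilon>"
  have \<sigma>: "0 < \<sigma>" "\<sigma> \<le> 1 / 100000" "\<epsilon> = \<sigma> * \<sigma>" "sqrt e = 4 * \<sigma>"
  proof -
    show "0 < \<sigma>" "\<epsilon> = \<sigma> * \<sigma>" using \<epsilon> by (auto simp: \<sigma>_def)
    show "\<sigma> \<le> 1 / 100000" unfolding \<sigma>_def using \<epsilon> by (intro real_le_lsqrt) (auto simp: power2_eq_square)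
    have "sqrt e = sqrt 16 * sqrt \<epsilon>" unfolding e_def by (rule real_sqrt_mult)
    also have "sqrt 16 = (4::real)" by (rule real_sqrt_unique) auto
    finally show "sqrt e = 4 * \<sigma>" by (simp add: \<sigma>_def)
  qed
  have \<epsilon>\<sigma>: "\<epsilon> \<le> \<sigma> / 100000" using mult_left_mono[OF \<sigma>(2), of \<sigma>] \<sigma> by simp
  define T where "T y = (vector [y$1 + k * y$2, y$2 / c] :: real^2)" for y :: "real^2"
  have T_lin: "T (a *\<^sub>R p + b *\<^sub>R q) = a *\<^sub>R T p + b *\<^sub>R T q" for a b p q
    by (simp add: T_def vec_eq_2 algebra_simps add_divide_distrib)
  have T_near: "norm (T (vertex n i) - unit_vec (C.t i)) \<le> 2400 * \<sigma>" if "i \<le> n" for i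
    using norm_le_abs_sum_2[of "T (vertex n i) - unit_vec (C.t i)"] near[OF that] \<sigma> by (simp add: T_def)
  have T_near': "norm (T (vertex n (Suc i)) - unit_vec (C.t i)) \<le> 2401 * \<sigma>" if "i < n" for i
  proof -
    have "norm (unit_vec (C.t (Suc i)) - unit_vec (C.t i)) \<le> e"
      using norm_unit_vec_diff_le[of "C.t (Suc i)" "C.t i"] mesh[OF that] C.t_step[OF that] by simp
    moreover have "e \<le> \<sigma>" using \<epsilon>\<sigma> \<sigma> by (simp add: e_def)
    moreover have "norm (T (vertex n (Suc i)) - unit_vec (C.t i))
        \<le> norm (T (vertex n (Suc i)) - unit_vec (C.t (Suc i))) + norm (unit_vec (C.t (Suc i)) - unit_vec (C.t i))"
      using norm_triangle_ineq[of "T (vertex n (Suc i)) - unit_vec (C.t (Suc i))" "unit_vec (C.t (Suc i)) - unit_vec (C.t i)"]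
      by simp
    ultimately show ?thesis using T_near[of "Suc i"] that by simp
  qed
  \<comment> \<open>A nonnegative combination of two neighbouring vertices is nearly the same combination of a single unit vector.\<close>
  have cmp: "\<bar>norm (T (a *\<^sub>R vertex n i + b *\<^sub>R vertex n (Suc i))) - (a + b)\<bar> \<le> (a + b) * (2401 * \<sigma>)"
    if ab: "0 \<le> a" "0 \<le> b" "i < n" for a b i
  proof -
    have *: "T (a *\<^sub>R vertex n i + b *\<^sub>R vertex n (Suc i)) - (a + b) *\<^sub>R unit_vec (C.t i)
        = a *\<^sub>R (T (vertex n i) - unit_vec (C.t i)) + b *\<^sub>R (T (vertex n (Suc i)) - unit_vec (C.t i))"
      by (simp add: T_lin algebra_simps)
    have "\<bar>norm (T (a *\<^sub>R vertex n i + b *\<^sub>R vertex n (Suc i))) - norm ((a + b) *\<^sub>R unit_vec (C.t i))\<bar>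
        \<le> norm (a *\<^sub>R (T (vertex n i) - unit_vec (C.t i)) + b *\<^sub>R (T (vertex n (Suc i)) - unit_vec (C.t i)))"
      unfolding *[symmetric] by (rule norm_triangle_ineq3)
    also have "\<dots> \<le> a * norm (T (vertex n i) - unit_vec (C.t i)) + b * norm (T (vertex n (Suc i)) - unit_vec (C.t i))"
      using ab by (intro order_trans[OF norm_triangle_ineq]) simp
    also have "\<dots> \<le> a * (2401 * \<sigma>) + b * (2401 * \<sigma>)"
      using ab T_near[of i] T_near'[of i] \<sigma> by (intro add_mono mult_left_mono) auto
    also have "norm ((a + b) *\<^sub>R unit_vec (C.t i)) = a + b" using ab by simp
    finally show ?thesis by (simp only: distrib_right)
  qed
  have "ellipse_norm c k y \<le> 1 - 2500 * \<sigma> \<longrightarrow> y \<in> polar L"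
    and "y \<in> polar L \<longrightarrow> ellipse_norm c k y \<le> 1 + 2500 * \<sigma>" if y2: "0 \<le> y$2" for y
  proof -
    show "ellipse_norm c k y \<le> 1 - 2500 * \<sigma> \<longrightarrow> y \<in> polar L"
    proof
      assume le: "ellipse_norm c k y \<le> 1 - 2500 * \<sigma>"
      obtain i a b where i: "i < n" "0 \<le> a" "0 \<le> b" and y: "y = a *\<^sub>R vertex n i + b *\<^sub>R vertex n (Suc i)"
        by (rule upper_cone[OF n(1) y2])
      have "(a + b) * (1 - 2401 * \<sigma>) \<le> ellipse_norm c k y"
        using cmp[OF i(2,3,1)] by (simp add: y[symmetric] ellipse_norm_def T_def algebra_simps)
      also have "\<dots> \<le> 1 * (1 - 2401 * \<sigma>)" using le \<sigma> by simp
      finally have "a + b \<le> 1" using \<sigma> by (simp only: mult_le_cancel_right)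
      have "support L y \<le> support L (a *\<^sub>R vertex n i) + support L (b *\<^sub>R vertex n (Suc i))"
        unfolding y by (rule support_add)
      also have "\<dots> = a + b" using i by (simp add: support_scale vertex_def support_boundary_point)
      finally show "y \<in> polar L" using \<open>a + b \<le> 1\<close> by (simp add: mem_polar_iff)
    qed
    show "y \<in> polar L \<longrightarrow> ellipse_norm c k y \<le> 1 + 2500 * \<sigma>"
    proof
      assume "y \<in> polar L"
      then have "y \<in> upper (polar L)" using y2 by (simp add: upper_def)
      from upper_area_le(2)[OF n(1) \<epsilon>4 supp(1) this]
      obtain i a b where i: "i < n" "0 \<le> a" "0 \<le> b" "(a + b) * (1 - \<epsilon> / 4) \<le> 1"
        and y: "y = a *\<^sub>R vertex n i + b *\<^sub>R vertex n (Suc i)" by blast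
      have "(1 + \<sigma>) * (1 - \<epsilon> / 4) \<ge> 1"
      proof -
        have "\<sigma> * \<epsilon> \<le> 1 * \<epsilon>" using \<sigma> \<epsilon> by (intro mult_right_mono) auto
        then show ?thesis using \<epsilon>\<sigma> \<sigma>(1,2) by (simp add: algebra_simps)
      qed
      then have "(a + b) * (1 - \<epsilon> / 4) \<le> (1 + \<sigma>) * (1 - \<epsilon> / 4)" using i(4) by linarith
      then have ab: "a + b \<le> 1 + \<sigma>" using \<epsilon>4 by (simp only: mult_le_cancel_right)
      have "ellipse_norm c k y \<le> (a + b) * (1 + 2401 * \<sigma>)"
        using cmp[OF i(2,3,1)] by (simp add: y[symmetric] ellipse_norm_def T_def algebra_simps)
      also have "\<dots> \<le> (1 + \<sigma>) * (1 + 2401 * \<sigma>)" using ab \<sigma> by (intro mult_right_mono) auto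
      also have "\<dots> = 1 + 2402 * \<sigma> + 2401 * (\<sigma> * \<sigma>)" by (simp add: algebra_simps)
      also have "\<dots> \<le> 1 + 2500 * \<sigma>" unfolding \<sigma>(3)[symmetric] using \<epsilon>\<sigma> \<sigma>(1,2) by simp
      finally show "ellipse_norm c k y \<le> 1 + 2500 * \<sigma>" .
    qed
  qed
  then show ?thesis using c unfolding \<sigma>_def by blast
qed

end

section \<open>From the halves to the whole body\<close>

lemma banach_mazur_dist_le: "l \<in> bm_factors K L \<Longrightarrow> banach_mazur_dist K L \<le> l"
  unfolding banach_mazur_dist_def by (rule cInf_lower) (auto simp: bm_factors_def intro: bdd_belowI[of _ 1])

lemma (in planar_body) exists_polar_gt_one:
  assumes "z \<notin> L"
  shows "\<exists>y\<in>polar L. 1 < z \<bullet> y"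
proof -
  obtain a b where ab: "a \<bullet> z < b" "\<forall>x\<in>L. b < a \<bullet> x"
    using separating_hyperplane_closed_point[OF convex_L compact_imp_closed[OF compact_L] assms] by blast
  have b: "b < 0" using ab(2) zero_mem by fastforce
  have "x \<bullet> ((1 / b) *\<^sub>R a) \<le> 1" if "x \<in> L" for x
  proof -
    have "b \<le> a \<bullet> x" using ab(2) that by (simp add: less_imp_le)
    then have "(a \<bullet> x) / b \<le> 1" using b by (simp add: divide_le_eq)
    then show ?thesis by (simp add: inner_commute)
  qed
  then have "(1 / b) *\<^sub>R a \<in> polar L" by (auto simp: polar_def)
  moreover have "1 < z \<bullet> ((1 / b) *\<^sub>R a)" using ab(1) b by (simp add: inner_commute less_divide_eq)
  ultimately show ?thesis by blast
qed

text \<open>Polarity turns the two inclusions between the polar body and ellipses into inclusions between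
  \<open>K - x\<close> and images of the disk under the adjoint map \<open>S\<close> of the map \<open>T\<close> that defines the
  ellipses.  The factor \<open>w\<close> undoes a normalisation of the width of the body.\<close>

lemma bm_factor_from_polar_ellipse:
  fixes K :: "(real^2) set"
  assumes L: "planar_body (shift K x)" and c: "0 < c" and w: "0 < w" and \<eta>: "0 \<le> \<eta>" "\<eta> \<le> 1 / 2"
    and inside: "\<And>y. w * ellipse_norm c k y \<le> 1 - \<eta> \<Longrightarrow> y \<in> polar (shift K x)"
    and outside: "\<And>y. y \<in> polar (shift K x) \<Longrightarrow> w * ellipse_norm c k y \<le> 1 + \<eta>"
  shows "banach_mazur_dist K (cball 0 1) \<le> 1 + 4 * \<eta>"
proof -
  interpret planar_body "shift K x" by (rule L)
  define T where "T y = w *\<^sub>R (vector [y$1 + k * y$2, y$2 / c] :: real^2)" for y :: "real^2"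
  define S where "S v = w *\<^sub>R (vector [v$1, k * v$1 + v$2 / c] :: real^2)" for v :: "real^2"
  define T' where "T' v = (1 / w) *\<^sub>R (vector [v$1 - k * c * v$2, c * v$2] :: real^2)" for v :: "real^2"
  define S' where "S' z = (1 / w) *\<^sub>R (vector [z$1, c * (z$2 - k * z$1)] :: real^2)" for z :: "real^2"
  have TT': "T (T' v) = v" and SS': "S (S' v) = v" and S'S: "S' (S v) = v" for v
    using c w by (simp_all add: T_def T'_def S_def S'_def vec_eq_2 field_simps)
  have adj: "S v \<bullet> y = v \<bullet> T y" for v y
    by (simp add: S_def T_def inner_2 algebra_simps)
  have normT: "norm (T y) = w * ellipse_norm c k y" for y
    using w by (simp add: T_def ellipse_norm_def)
  define \<Phi> where "\<Phi> v = (1 / (1 - \<eta>)) *\<^sub>R S v" for v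
  define l where "l = (1 + \<eta>) / (1 - \<eta>)"
  have \<eta>1: "0 < 1 - \<eta>" using \<eta> by simp
  have l1: "1 \<le> l" using \<eta> by (simp add: l_def le_divide_eq)
  have linS: "linear S"
    by (rule linearI) (simp_all add: S_def vec_eq_2 algebra_simps add_divide_distrib)
  have lin: "linear \<Phi>" unfolding \<Phi>_def by (rule linear_compose_scale_right[OF linS])
  have S_scale: "S (a *\<^sub>R v) = a *\<^sub>R S v" for a v by (rule linear_scale[OF linS])
  have S'_scale: "S' (a *\<^sub>R v) = a *\<^sub>R S' v" for a v by (simp add: S'_def vec_eq_2 algebra_simps)
  have bij: "bij \<Phi>"
    by (rule bij_betw_byWitness[where f' = "\<lambda>z. (1 - \<eta>) *\<^sub>R S' z"])
      (use \<eta>1 in \<open>auto simp: \<Phi>_def SS' S'S S_scale S'_scale\<close>)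
  have ball: "shift (cball 0 1) (0::real^2) = cball 0 1" by (simp add: shift_def)
  have 1: "shift K x \<subseteq> \<Phi> ` cball 0 1"
  proof
    fix z assume z: "z \<in> shift K x"
    let ?v = "S' z"
    have "(1 - \<eta>) * norm ?v \<le> 1"
    proof (cases "?v = 0")
      case False
      let ?y = "T' (((1 - \<eta>) / norm ?v) *\<^sub>R ?v)"
      have "w * ellipse_norm c k ?y = 1 - \<eta>" using False \<eta>1 by (simp add: TT' flip: normT)
      then have "?y \<in> polar (shift K x)" using inside by simp
      then have "z \<bullet> ?y \<le> 1" using z by (simp add: polar_def)
      moreover have "z \<bullet> ?y = ?v \<bullet> (((1 - \<eta>) / norm ?v) *\<^sub>R ?v)"
        using adj[of ?v ?y] by (simp add: SS' TT')
      moreover have "?v \<bullet> (((1 - \<eta>) / norm ?v) *\<^sub>R ?v) = (1 - \<eta>) * norm ?v"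
        using False by (simp add: dot_square_norm power2_eq_square)
      ultimately show ?thesis by simp
    qed simp
    then have "(1 - \<eta>) *\<^sub>R ?v \<in> cball 0 1" using \<eta>1 by simp
    moreover have "z = \<Phi> ((1 - \<eta>) *\<^sub>R ?v)" using \<eta>1 by (simp add: \<Phi>_def S_scale SS')
    ultimately show "z \<in> \<Phi> ` cball 0 1" by blast
  qed
  have 2: "\<Phi> ` cball 0 1 \<subseteq> (\<lambda>z. l *\<^sub>R z) ` shift K x"
  proof
    fix u assume "u \<in> \<Phi> ` cball 0 1"
    then obtain v where v: "norm v \<le> 1" "u = \<Phi> v" by auto
    define z where "z = (1 / (1 + \<eta>)) *\<^sub>R S v"
    have "z \<in> shift K x"
    proof (rule ccontr)
      assume "z \<notin> shift K x"
      then obtain y where y: "y \<in> polar (shift K x)" "1 < z \<bullet> y" using exists_polar_gt_one by blast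
      have "S v \<bullet> y \<le> norm v * norm (T y)" unfolding adj by (rule norm_cauchy_schwarz)
      also have "\<dots> \<le> 1 * (1 + \<eta>)" using v outside[OF y(1)] unfolding normT by (intro mult_mono) (auto simp flip: normT)
      finally show False using y(2) \<eta> by (simp add: z_def divide_le_eq)
    qed
    moreover have "u = l *\<^sub>R z" using \<eta> by (simp add: v(2) \<Phi>_def z_def l_def)
    ultimately show "u \<in> (\<lambda>z. l *\<^sub>R z) ` shift K x" by blast
  qed
  have "l \<in> bm_factors K (cball 0 1)"
    unfolding bm_factors_def using l1 lin bij 1 2 ball
    by (intro CollectI conjI exI[of _ \<Phi>] exI[of _ x] exI[of _ 0]) auto
  then have "banach_mazur_dist K (cball 0 1) \<le> l" by (rule banach_mazur_dist_le)
  also have "l \<le> 1 + 4 * \<eta>"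
  proof -
    have "\<eta> * \<eta> \<le> 1 / 2 * \<eta>" using \<eta> by (intro mult_right_mono) auto
    then show ?thesis using \<eta>1 by (simp add: l_def divide_le_eq algebra_simps)
  qed
  finally show ?thesis .
qed

lemma ellipse_norm_scale: "0 \<le> a \<Longrightarrow> ellipse_norm c k (a *\<^sub>R y) = a * ellipse_norm c k y"
proof -
  assume "0 \<le> a"
  moreover have "vector [(a *\<^sub>R y)$1 + k * (a *\<^sub>R y)$2, (a *\<^sub>R y)$2 / c] = a *\<^sub>R (vector [y$1 + k * y$2, y$2 / c] :: real^2)"
    by (simp add: vec_eq_2 algebra_simps)
  ultimately show ?thesis by (simp add: ellipse_norm_def)
qed

lemma ellipse_norm_uminus: "ellipse_norm c k (- y) = ellipse_norm c k y"
proof -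
  have "vector [(- y)$1 + k * (- y)$2, (- y)$2 / c] = - (vector [y$1 + k * y$2, y$2 / c] :: real^2)"
    by (simp add: vec_eq_2)
  then show ?thesis by (simp add: ellipse_norm_def)
qed

lemma ellipse_norm_nonneg: "0 \<le> ellipse_norm c k y" by (simp add: ellipse_norm_def)

lemma polar_uminus: "y \<in> polar (uminus ` L) \<longleftrightarrow> - y \<in> polar L"
  by (auto simp: polar_def)

definition half_disk :: "(real^2) set" where "half_disk = upper (cball 0 1)"

lemma half_disk_lmeasurable: "half_disk \<in> lmeasurable"
  unfolding half_disk_def upper_def
  by (intro lmeasurable_compact compact_Int_closed closed_Collect_le continuous_intros) simp

lemma half_disk_pos: "0 < measure lebesgue half_disk"
proof -
  let ?p = "vector [0, 1 / 2] :: real^2"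
  have np: "norm ?p = 1 / 2" by (simp add: norm_2)
  have sub: "cball ?p (1 / 2) \<subseteq> half_disk"
  proof
    fix y assume "y \<in> cball ?p (1 / 2)"
    then have d: "norm (y - ?p) \<le> 1 / 2" by (simp add: dist_norm norm_minus_commute)
    then have "\<bar>(y - ?p)$2\<bar> \<le> 1 / 2" using component_le_norm_cart[of "y - ?p" 2] by linarith
    then have "0 \<le> y$2" unfolding abs_le_iff by simp
    moreover have "norm y \<le> norm (y - ?p) + norm ?p" using norm_triangle_ineq[of "y - ?p" ?p] by simp
    ultimately show "y \<in> half_disk" using d np by (simp add: half_disk_def upper_def)
  qed
  have "0 < measure lebesgue (cball ?p (1 / 2))"
    using content_cball_pos[of "1 / 2" ?p] by (simp add: measure_completion)
  also have "\<dots> \<le> measure lebesgue half_disk"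
    using sub half_disk_lmeasurable by (intro measure_mono_fmeasurable) auto
  finally show ?thesis .
qed

lemma measure_half_ellipse:
  assumes c: "0 < c" and \<rho>: "0 < \<rho>"
  shows "{y. 0 \<le> y$2 \<and> ellipse_norm c k y \<le> \<rho>} \<in> lmeasurable" (is "?E \<in> _")
    and "measure lebesgue {y. 0 \<le> y$2 \<and> ellipse_norm c k y \<le> \<rho>} = \<rho>\<^sup>2 * c * measure lebesgue half_disk"
proof -
  define f where "f v = (vector [\<rho> * (v$1 - k * c * v$2), \<rho> * c * v$2] :: real^2)" for v :: "real^2"
  have lin: "linear f" by (rule linearI) (simp_all add: f_def vec_eq_2 algebra_simps)
  have en: "ellipse_norm c k (f v) = \<rho> * norm v" for v
  proof -
    have "vector [(f v)$1 + k * (f v)$2, (f v)$2 / c] = \<rho> *\<^sub>R v"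
      using c by (simp add: f_def vec_eq_2 algebra_simps)
    then show ?thesis using \<rho> by (simp add: ellipse_norm_def)
  qed
  have im: "f ` half_disk = ?E"
  proof (intro subset_antisym subsetI)
    fix y assume "y \<in> f ` half_disk"
    then show "y \<in> ?E" using c \<rho> by (auto simp: half_disk_def upper_def en) (simp add: f_def)
  next
    fix y assume y: "y \<in> ?E"
    define v where "v = (vector [(y$1 + k * y$2) / \<rho>, y$2 / (\<rho> * c)] :: real^2)"
    have fv: "f v = y" using c \<rho> by (simp add: f_def v_def vec_eq_2 field_simps)
    have "norm v \<le> 1" using y en[of v] \<rho> by (simp add: fv)
    moreover have "0 \<le> v$2" using y c \<rho> by (simp add: v_def)
    ultimately show "y \<in> f ` half_disk" using fv by (force simp: half_disk_def upper_def)
  qed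
  have det: "det (matrix f) = \<rho>\<^sup>2 * c"
    by (simp add: det_2 matrix_def f_def axis_def power2_eq_square)
  show "?E \<in> lmeasurable" using measurable_linear_image[OF lin half_disk_lmeasurable] unfolding im .
  show "measure lebesgue ?E = \<rho>\<^sup>2 * c * measure lebesgue half_disk"
    using measure_linear_image[OF lin half_disk_lmeasurable] c unfolding im det by simp
qed

lemma ellipse_norm_change:
  assumes c: "0 < c" "0 < c'"
  shows "\<bar>ellipse_norm c k y - ellipse_norm c' k' y\<bar>
    \<le> (\<bar>k - k'\<bar> * c' + \<bar>c' / c - 1\<bar>) * ellipse_norm c' k' y"
proof -
  let ?u = "vector [y$1 + k * y$2, y$2 / c] :: real^2" and ?v = "vector [y$1 + k' * y$2, y$2 / c'] :: real^2"
  have d1: "(?u - ?v)$1 = (k - k') * c' * (?v$2)" and d2: "(?u - ?v)$2 = (c' / c - 1) * (?v$2)"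
    using c by (simp_all add: field_simps)
  have "\<bar>ellipse_norm c k y - ellipse_norm c' k' y\<bar> \<le> norm (?u - ?v)"
    unfolding ellipse_norm_def by (rule norm_triangle_ineq3)
  also have "\<dots> \<le> \<bar>(?u - ?v)$1\<bar> + \<bar>(?u - ?v)$2\<bar>" by (rule norm_le_abs_sum_2)
  also have "\<dots> = (\<bar>k - k'\<bar> * c' + \<bar>c' / c - 1\<bar>) * \<bar>?v$2\<bar>"
    unfolding d1 d2 abs_mult using c by (simp add: distrib_right add_divide_distrib)
  also have "\<dots> \<le> (\<bar>k - k'\<bar> * c' + \<bar>c' / c - 1\<bar>) * norm ?v"
    using c component_le_norm_cart[of ?v 2] by (intro mult_left_mono) auto
  finally show ?thesis by (simp add: ellipse_norm_def)
qed

context balanced_body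
begin

lemma axis_mem_polar:
  assumes "y \<in> polar L" "y$2 = 0"
  shows "\<bar>y$1\<bar> \<le> 1"
proof -
  have y: "y = (if 0 \<le> y$1 then \<bar>y$1\<bar> *\<^sub>R vector [1, 0] else \<bar>y$1\<bar> *\<^sub>R vector [-1, 0])"
    using assms(2) by (simp add: vec_eq_2)
  have "support L y = \<bar>y$1\<bar>"
    using unit_width support_scale[of "\<bar>y$1\<bar>"] by (subst y) auto
  then show ?thesis using assms(1) by (simp add: mem_polar_iff)
qed

text \<open>Take a point of the upper half close to one end of the chord and the point of the lower half with the
  mirrored position in the coordinates of the lower ellipse.  The segment joining them crosses the first axis inside the polar
  body, hence not beyond that end of the chord.  The crossing point is displaced by \<open>W\<close>, which has the
  sign of \<open>k' - k\<close>, from its position \<open>a\<close> or \<open>- a\<close> for equal shears.  As the displacement has the same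
  direction at both ends, one end bounds \<open>W\<close> from above and the other end bounds it from below.\<close>

lemma kink_bound:
  assumes c: "0 < c" "0 < c'" and \<eta>: "0 < \<eta>" "\<eta> \<le> 1 / 10"
    and up: "\<And>y. 0 \<le> y$2 \<Longrightarrow> ellipse_norm c k y \<le> 1 - \<eta> \<Longrightarrow> y \<in> polar L"
    and down: "\<And>y. 0 \<le> y$2 \<Longrightarrow> ellipse_norm c' k' y \<le> 1 - \<eta> \<Longrightarrow> - y \<in> polar L"
  shows "\<bar>k - k'\<bar> * c' \<le> 2 * sqrt \<eta> * (1 + c' / c)"
proof -
  \<comment> \<open>The point \<open>(a, b)\<close> lies within radius \<open>1 - \<eta>\<close> although \<open>b\<close> is much larger than \<open>1 - a\<close>; the bound is \<open>(1 - a) / b\<close> up to constants.\<close>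
  define a b where "a = 1 - 2 * \<eta>" and "b = sqrt \<eta>"
  have b: "0 < b" "b * b = \<eta>" using \<eta> by (auto simp: b_def)
  have ab: "norm (vector [s * a, b] :: real^2) \<le> 1 - \<eta>" if "s = 1 \<or> s = -1" for s
  proof -
    have "\<eta> * \<eta> \<le> 1 / 10 * \<eta>" using \<eta> by (intro mult_right_mono) auto
    then have "a\<^sup>2 + b\<^sup>2 \<le> (1 - \<eta>)\<^sup>2" using b \<eta> by (simp add: a_def power2_eq_square algebra_simps)
    then have "sqrt ((s * a)\<^sup>2 + b\<^sup>2) \<le> 1 - \<eta>" using \<eta> that by (intro real_le_lsqrt) auto
    then show ?thesis by (simp add: norm_2)
  qed
  define W where "W = c * c' * b * (k' - k) / (c + c')"
  have chord: "\<bar>s * a + W\<bar> \<le> 1" if s: "s = 1 \<or> s = -1" for s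
  proof -
    define p where "p = (vector [s * a - k * c * b, c * b] :: real^2)"
    define q where "q = (vector [- (s * a) - k' * c' * b, c' * b] :: real^2)"
    have "ellipse_norm c k p = norm (vector [s * a, b] :: real^2)"
      using c by (simp add: ellipse_norm_def p_def)
    then have p: "p \<in> polar L" using up[of p] ab[OF s] c b by (simp add: p_def)
    have "ellipse_norm c' k' q = norm (vector [- s * a, b] :: real^2)"
      using c by (simp add: ellipse_norm_def q_def)
    then have q: "- q \<in> polar L" using down[of q] ab[of "- s"] s c b by (auto simp: q_def)
    have cc: "0 < c + c'" using c by simp
    have "(c' / (c + c')) *\<^sub>R p + (c / (c + c')) *\<^sub>R (- q) \<in> polar L"
      using c cc by (intro convexD[OF convex_polar] p q) (auto simp: add_divide_distrib[symmetric])
    moreover have "((c' / (c + c')) *\<^sub>R p + (c / (c + c')) *\<^sub>R (- q))$2 = 0"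
      by (simp add: p_def q_def)
    moreover have "((c' / (c + c')) *\<^sub>R p + (c / (c + c')) *\<^sub>R (- q))$1 = s * a + W"
    proof -
      have "((c' / (c + c')) *\<^sub>R p + (c / (c + c')) *\<^sub>R (- q))$1
          = (c' * (s * a - k * c * b) + c * (s * a + k' * c' * b)) / (c + c')"
        by (simp add: p_def q_def add_divide_distrib diff_divide_distrib algebra_simps)
      also have "\<dots> = ((c + c') * (s * a) + c * c' * b * (k' - k)) / (c + c')"
        by (simp add: algebra_simps)
      also have "\<dots> = s * a + W" unfolding W_def using cc by (simp add: add_divide_distrib)
      finally show ?thesis .
    qed
    ultimately show ?thesis using axis_mem_polar by metis
  qed
  have W: "\<bar>W\<bar> \<le> 2 * (b * b)" using chord[of 1] chord[of "-1"] b by (simp add: a_def)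
  have "\<bar>W\<bar> = b * (\<bar>k - k'\<bar> * c' * c / (c + c'))"
    unfolding W_def using c b by (simp add: abs_mult abs_divide abs_minus_commute)
  with W have "b * (\<bar>k - k'\<bar> * c' * c / (c + c')) \<le> b * (2 * b)" by (simp add: mult_ac)
  then have "\<bar>k - k'\<bar> * c' * c / (c + c') \<le> 2 * b" using b by (simp only: mult_le_cancel_left_pos)
  then have "\<bar>k - k'\<bar> * c' \<le> 2 * b * ((c + c') / c)" using c by (simp add: field_simps)
  also have "(c + c') / c = 1 + c' / c" using c by (simp add: add_divide_distrib)
  finally show ?thesis by (simp add: b_def)
qed

text \<open>Equal areas of the halves force nearly equal heights, \<open>kink_bound\<close> forces nearly equal shears, and so
  the norm belonging to the lower half can be replaced by that of the upper half.  The factor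
  \<open>sqrt \<eta>\<close> in \<open>kink_bound\<close> is the reason for the exponent \<open>1/4\<close>.\<close>

theorem full_ellipse:
  assumes \<epsilon>: "0 < \<epsilon>" "\<epsilon> \<le> 1 / 10 ^ 12"
    and halves: "measure lebesgue (upper (polar (uminus ` L))) = measure lebesgue (upper (polar L))"
    and prod: "pi\<^sup>2 / (1 + \<epsilon>) \<le> measure lebesgue L * (2 * measure lebesgue (upper (polar L)))"
  shows "\<exists>c>0. \<exists>k. \<forall>y.
    (ellipse_norm c k y \<le> 1 - 400 * sqrt (sqrt \<epsilon>) \<longrightarrow> y \<in> polar L) \<and>
    (y \<in> polar L \<longrightarrow> ellipse_norm c k y \<le> 1 + 400 * sqrt (sqrt \<epsilon>))"
proof -
  interpret M: balanced_body "uminus ` L" by (rule balanced_uminus)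
  have \<epsilon>': "\<epsilon> \<le> 1 / 10 ^ 10" using \<epsilon> by simp
  have "measure lebesgue (uminus ` L) = measure lebesgue L"
    using measure_lebesgue_affine[of "-1" "0::real^2" L] by simp
  then have prod': "pi\<^sup>2 / (1 + \<epsilon>) \<le> measure lebesgue (uminus ` L) * (2 * measure lebesgue (upper (polar (uminus ` L))))"
    using prod halves by simp
  define \<eta> where "\<eta> = 2500 * sqrt \<epsilon>"
  obtain c k where c: "0 < c" and ck: "\<And>y. 0 \<le> y$2 \<Longrightarrow> ellipse_norm c k y \<le> 1 - \<eta> \<Longrightarrow> y \<in> polar L"
      "\<And>y. 0 \<le> y$2 \<Longrightarrow> y \<in> polar L \<Longrightarrow> ellipse_norm c k y \<le> 1 + \<eta>"
    using half_ellipse[OF \<epsilon>(1) \<epsilon>' halves prod] unfolding \<eta>_def by blast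
  have uu: "uminus ` uminus ` L = L" by (simp add: image_image)
  obtain c' k' where c': "0 < c'" and ck': "\<And>y. 0 \<le> y$2 \<Longrightarrow> ellipse_norm c' k' y \<le> 1 - \<eta> \<Longrightarrow> - y \<in> polar L"
      "\<And>y. 0 \<le> y$2 \<Longrightarrow> - y \<in> polar L \<Longrightarrow> ellipse_norm c' k' y \<le> 1 + \<eta>"
    using M.half_ellipse[OF \<epsilon>(1) \<epsilon>' _ prod'] halves unfolding \<eta>_def uu polar_uminus by auto
  have \<eta>: "0 < \<eta>" "\<eta> \<le> 1 / 400"
  proof -
    show "0 < \<eta>" using \<epsilon> by (simp add: \<eta>_def)
    have "sqrt \<epsilon> \<le> 1 / 1000000" using \<epsilon> by (intro real_le_lsqrt) (auto simp: power2_eq_square)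
    then show "\<eta> \<le> 1 / 400" by (simp add: \<eta>_def)
  qed
  define m where "m = measure lebesgue half_disk"
  have m: "0 < m" using half_disk_pos by (simp add: m_def)
  define \<mu> where "\<mu> = measure lebesgue (upper (polar L))"
  have area: "(1 - \<eta>)\<^sup>2 * c \<le> \<mu> / m" "\<mu> / m \<le> (1 + \<eta>)\<^sup>2 * c"
    "(1 - \<eta>)\<^sup>2 * c' \<le> \<mu> / m" "\<mu> / m \<le> (1 + \<eta>)\<^sup>2 * c'"
  proof -
    have p: "0 < 1 - \<eta>" "0 < 1 + \<eta>" using \<eta> by auto
    have "(1 - \<eta>)\<^sup>2 * c * m \<le> \<mu>"
      unfolding m_def \<mu>_def measure_half_ellipse(2)[OF c p(1), of k, symmetric]
      using ck(1) measure_half_ellipse(1)[OF c p(1)] upper_lmeasurable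
      by (intro measure_mono_fmeasurable) (auto simp: upper_def fmeasurableD)
    then show "(1 - \<eta>)\<^sup>2 * c \<le> \<mu> / m" using m by (simp add: le_divide_eq)
    have "\<mu> \<le> (1 + \<eta>)\<^sup>2 * c * m"
      unfolding m_def \<mu>_def measure_half_ellipse(2)[OF c p(2), of k, symmetric]
      using ck(2) measure_half_ellipse(1)[OF c p(2)] upper_lmeasurable
      by (intro measure_mono_fmeasurable) (auto simp: upper_def fmeasurableD)
    then show "\<mu> / m \<le> (1 + \<eta>)\<^sup>2 * c" using m by (simp add: divide_le_eq)
    have "(1 - \<eta>)\<^sup>2 * c' * m \<le> \<mu>"
      unfolding m_def \<mu>_def halves[symmetric] measure_half_ellipse(2)[OF c' p(1), of k', symmetric]
      using ck'(1) measure_half_ellipse(1)[OF c' p(1)] M.upper_lmeasurable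
      by (intro measure_mono_fmeasurable) (auto simp: upper_def fmeasurableD polar_uminus)
    then show "(1 - \<eta>)\<^sup>2 * c' \<le> \<mu> / m" using m by (simp add: le_divide_eq)
    have "\<mu> \<le> (1 + \<eta>)\<^sup>2 * c' * m"
      unfolding m_def \<mu>_def halves[symmetric] measure_half_ellipse(2)[OF c' p(2), of k', symmetric]
      using ck'(2) measure_half_ellipse(1)[OF c' p(2)] M.upper_lmeasurable
      by (intro measure_mono_fmeasurable) (auto simp: upper_def fmeasurableD polar_uminus)
    then show "\<mu> / m \<le> (1 + \<eta>)\<^sup>2 * c'" using m by (simp add: divide_le_eq)
  qed
  have ratio: "\<bar>c' / c - 1\<bar> \<le> 5 * \<eta>"
  proof -
    have q: "\<eta> * \<eta> \<le> 1 / 400 * \<eta>" "0 \<le> \<eta> * \<eta> * \<eta>" "\<eta> * \<eta> \<ge> 0" using \<eta> by (auto intro: mult_right_mono)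
    have s: "0 < (1 - \<eta>)\<^sup>2" "0 < (1 + \<eta>)\<^sup>2" using \<eta> by auto
    have e: "(1 + \<eta>)\<^sup>2 = 1 + 2 * \<eta> + \<eta> * \<eta>" "(1 - \<eta>)\<^sup>2 = 1 - 2 * \<eta> + \<eta> * \<eta>"
      "(1 + 5 * \<eta>) * (1 - \<eta>)\<^sup>2 = 1 + 3 * \<eta> - 9 * (\<eta> * \<eta>) + 5 * (\<eta> * \<eta> * \<eta>)"
      "(1 - 5 * \<eta>) * (1 + \<eta>)\<^sup>2 = 1 - 3 * \<eta> - 9 * (\<eta> * \<eta>) - 5 * (\<eta> * \<eta> * \<eta>)"
      by (simp_all add: power2_eq_square algebra_simps)
    have a1: "(1 + \<eta>)\<^sup>2 \<le> (1 + 5 * \<eta>) * (1 - \<eta>)\<^sup>2" unfolding e(1,3) using q \<eta> by linarith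
    have a2: "(1 - 5 * \<eta>) * (1 + \<eta>)\<^sup>2 \<le> (1 - \<eta>)\<^sup>2" unfolding e(2,4) using q \<eta> by linarith
    have "(1 - \<eta>)\<^sup>2 * c' \<le> (1 + \<eta>)\<^sup>2 * c" using area by linarith
    also have "\<dots> \<le> (1 + 5 * \<eta>) * (1 - \<eta>)\<^sup>2 * c" using a1 c by (intro mult_right_mono) auto
    finally have "(1 - \<eta>)\<^sup>2 * c' \<le> (1 - \<eta>)\<^sup>2 * ((1 + 5 * \<eta>) * c)" by (simp add: mult_ac)
    then have 1: "c' \<le> (1 + 5 * \<eta>) * c" using s by (simp only: mult_le_cancel_left_pos)
    have "(1 - 5 * \<eta>) * (1 + \<eta>)\<^sup>2 * c \<le> (1 - \<eta>)\<^sup>2 * c" using a2 c by (intro mult_right_mono) auto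
    also have "\<dots> \<le> (1 + \<eta>)\<^sup>2 * c'" using area by linarith
    finally have "(1 + \<eta>)\<^sup>2 * ((1 - 5 * \<eta>) * c) \<le> (1 + \<eta>)\<^sup>2 * c'" by (simp add: mult_ac)
    then have 2: "(1 - 5 * \<eta>) * c \<le> c'" using s by (simp only: mult_le_cancel_left_pos)
    have "c' / c \<le> 1 + 5 * \<eta>" "1 - 5 * \<eta> \<le> c' / c" using 1 2 c by (simp_all add: divide_le_eq le_divide_eq)
    then show ?thesis by (simp add: abs_le_iff)
  qed
  define r where "r = sqrt \<eta>"
  have r: "0 < r" "r \<le> 1 / 20" "\<eta> = r * r"
  proof -
    show "0 < r" "\<eta> = r * r" using \<eta> by (auto simp: r_def)
    show "r \<le> 1 / 20" unfolding r_def by (rule real_le_lsqrt) (use \<eta> in \<open>auto simp: power2_eq_square\<close>)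
  qed
  have rr: "r * r \<le> 1 / 20 * r" using r by (intro mult_right_mono) auto
  have \<omega>: "\<bar>k - k'\<bar> * c' + \<bar>c' / c - 1\<bar> \<le> 6 * r"
  proof -
    have "\<eta> \<le> 1 / 10" using \<eta> by simp
    then have "\<bar>k - k'\<bar> * c' \<le> 2 * r * (1 + c' / c)"
      unfolding r_def by (rule kink_bound[OF c c' \<eta>(1) _ ck(1) ck'(1)])
    moreover have "1 + c' / c \<le> 21 / 10" using ratio \<eta> by linarith
    then have "2 * r * (1 + c' / c) \<le> 2 * r * (21 / 10)" using r by (intro mult_left_mono) auto
    ultimately show ?thesis using ratio rr r by linarith
  qed
  have cmp: "\<bar>ellipse_norm c k y - ellipse_norm c' k' y\<bar> \<le> 6 * r * ellipse_norm c' k' y" for y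
    using ellipse_norm_change[OF c c', of k y k'] mult_right_mono[OF \<omega> ellipse_norm_nonneg[of c' k' y]]
    by linarith
  have main: "(ellipse_norm c k y \<le> 1 - 8 * r \<longrightarrow> y \<in> polar L) \<and> (y \<in> polar L \<longrightarrow> ellipse_norm c k y \<le> 1 + 8 * r)" for y
  proof (cases "0 \<le> y$2")
    case True
    have "\<eta> \<le> 8 * r" using rr r by linarith
    then show ?thesis using ck[OF True] by force
  next
    case False
    then have ny: "0 \<le> (- y)$2" by simp
    let ?N' = "ellipse_norm c' k' (- y)" and ?N = "ellipse_norm c k (- y)"
    have N: "ellipse_norm c k y = ?N" by (simp add: ellipse_norm_uminus)
    have l: "?N' * (1 - 6 * r) \<le> ?N" "?N \<le> ?N' * (1 + 6 * r)" using cmp[of "- y"] by (auto simp: algebra_simps abs_le_iff)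
    have "y \<in> polar L" if "?N \<le> 1 - 8 * r"
    proof -
      have "?N' * (1 - 6 * r) \<le> (1 - \<eta>) * (1 - 6 * r)"
      proof -
        have "0 \<le> r * r * r" using r by simp
        moreover have "(1 - \<eta>) * (1 - 6 * r) = 1 - 6 * r - r * r + 6 * (r * r * r)"
          by (simp add: r(3) algebra_simps)
        ultimately have "1 - 8 * r \<le> (1 - \<eta>) * (1 - 6 * r)" using rr r(1) by linarith
        then show ?thesis using l(1) that by linarith
      qed
      then have "?N' \<le> 1 - \<eta>" using r by (simp add: mult_le_cancel_right)
      then show ?thesis using ck'(1)[OF ny] by simp
    qed
    moreover have "?N \<le> 1 + 8 * r" if "y \<in> polar L"
    proof -
      have "?N' \<le> 1 + \<eta>" using ck'(2)[OF ny] that by simp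
      then have "?N' * (1 + 6 * r) \<le> (1 + \<eta>) * (1 + 6 * r)" using r by (intro mult_right_mono) auto
      also have "\<dots> = 1 + 6 * r + r * r + 6 * (r * r) * r" by (simp add: r(3) algebra_simps)
      also have "\<dots> \<le> 1 + 8 * r"
      proof -
        have "(r * r) * r \<le> (1 / 20 * r) * 1" using rr r by (intro mult_mono) auto
        then show ?thesis using rr r(1) by linarith
      qed
      finally show ?thesis using l by linarith
    qed
    ultimately show ?thesis by (simp add: N)
  qed
  have "8 * r = 400 * sqrt (sqrt \<epsilon>)"
  proof -
    have "r = sqrt 2500 * sqrt (sqrt \<epsilon>)" unfolding r_def \<eta>_def by (rule real_sqrt_mult)
    also have "sqrt 2500 = (50::real)" by (rule real_sqrt_unique) auto
    finally show ?thesis by simp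
  qed
  then show ?thesis using main c by (intro exI[of _ c]) (auto intro!: exI[of _ k])
qed

theorem symmetric_ellipse:
  assumes \<epsilon>: "0 < \<epsilon>" "\<epsilon> \<le> 1 / 10 ^ 12" and sym: "uminus ` L = L"
    and prod: "pi\<^sup>2 / (1 + \<epsilon>) \<le> measure lebesgue L * (2 * measure lebesgue (upper (polar L)))"
  shows "\<exists>c>0. \<exists>k. \<forall>y.
    (ellipse_norm c k y \<le> 1 - 2500 * sqrt \<epsilon> \<longrightarrow> y \<in> polar L) \<and>
    (y \<in> polar L \<longrightarrow> ellipse_norm c k y \<le> 1 + 2500 * sqrt \<epsilon>)"
proof -
  have "\<epsilon> \<le> 1 / 10 ^ 10" using \<epsilon> by simp
  then obtain c k where c: "0 < c" and ck: "\<And>y. 0 \<le> y$2 \<Longrightarrow>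
    (ellipse_norm c k y \<le> 1 - 2500 * sqrt \<epsilon> \<longrightarrow> y \<in> polar L) \<and>
    (y \<in> polar L \<longrightarrow> ellipse_norm c k y \<le> 1 + 2500 * sqrt \<epsilon>)"
    using half_ellipse[OF \<epsilon>(1) _ _ prod] sym by auto
  have "(ellipse_norm c k y \<le> 1 - 2500 * sqrt \<epsilon> \<longrightarrow> y \<in> polar L) \<and>
    (y \<in> polar L \<longrightarrow> ellipse_norm c k y \<le> 1 + 2500 * sqrt \<epsilon>)" for y
    using ck[of y] ck[of "- y"] polar_uminus[of y L] unfolding sym
    by (cases "0 \<le> y$2") (auto simp: ellipse_norm_uminus)
  then show ?thesis using c by blast
qed

end

section \<open>A point for which the polar body is balanced\<close>

abbreviation upper_area :: "(real^2) set \<Rightarrow> real^2 \<Rightarrow> real" where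
  "upper_area K x \<equiv> measure lebesgue (upper (polar (shift K x)))"

lemma measure_scaleR_image: "measure lebesgue ((*\<^sub>R) a ` S) = a\<^sup>2 * measure lebesgue S" for S :: "(real^2) set"
  using measure_lebesgue_affine[of a 0 S] by simp

lemma planar_body_shift:
  assumes "convex_body K" "x \<in> interior K"
  shows "planar_body (shift K x)"
proof
  show "compact (shift K x)" "convex (shift K x)"
    using assms unfolding shift_def convex_body_def
    by (auto intro: compact_translation_subtract convex_translation_subtract)
  show "0 \<in> interior (shift K x)"
    using assms(2) unfolding shift_def interior_translation_subtract by (auto simp: image_iff)
qed

lemma shift_uminus: "shift (uminus ` K) (- x) = uminus ` shift K x"
  by (auto simp: shift_def image_image)

lemma convex_body_uminus: "convex_body K \<Longrightarrow> convex_body (uminus ` K)" for K :: "(real^2) set"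
  unfolding convex_body_def
  by (auto intro!: compact_continuous_image continuous_intros convex_negations simp: interior_negations)

text \<open>If \<open>x'\<close> is close to \<open>x\<close>, then \<open>K - x'\<close> contains the slightly shrunken body \<open>(1 - \<eta>) (K - x)\<close>, so the
  polar of the former is contained in the enlarged polar of the latter.\<close>

lemma polar_shift_scale:
  assumes K: "convex K" and r: "0 < r" "cball x r \<subseteq> K" and \<eta>: "0 < \<eta>" "\<eta> < 1"
    and near: "norm (x' - x) \<le> \<eta> * r" and y: "y \<in> polar (shift K x')"
  shows "(1 - \<eta>) *\<^sub>R y \<in> polar (shift K x)"
  unfolding polar_def shift_def
proof (clarsimp)
  fix z assume z: "z \<in> K"
  have "x + (1 / \<eta>) *\<^sub>R (x' - x) \<in> K"
    using r near \<eta> by (auto simp: dist_norm divide_le_eq mult.commute intro!: subsetD[OF r(2)])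
  then have "(1 - \<eta>) *\<^sub>R z + \<eta> *\<^sub>R (x + (1 / \<eta>) *\<^sub>R (x' - x)) \<in> K"
    using K z \<eta> by (intro convexD) auto
  also have "(1 - \<eta>) *\<^sub>R z + \<eta> *\<^sub>R (x + (1 / \<eta>) *\<^sub>R (x' - x)) = (1 - \<eta>) *\<^sub>R (z - x) + x'"
    using \<eta> by (simp add: algebra_simps)
  finally have "(1 - \<eta>) *\<^sub>R (z - x) \<in> shift K x'" by (force simp: shift_def)
  then have "((1 - \<eta>) *\<^sub>R (z - x)) \<bullet> y \<le> 1" using y unfolding polar_def by blast
  then show "(1 - \<eta>) * ((z - x) \<bullet> y) \<le> 1" by simp
qed

lemma upper_area_compare:
  assumes K: "convex_body K" and x: "x \<in> interior K" "x' \<in> interior K"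
    and r: "0 < r" "cball x r \<subseteq> K" and \<eta>: "0 < \<eta>" "\<eta> < 1" and near: "norm (x' - x) \<le> \<eta> * r"
  shows "(1 - \<eta>)\<^sup>2 * upper_area K x' \<le> upper_area K x"
proof -
  have "(*\<^sub>R) (1 - \<eta>) ` upper (polar (shift K x')) \<subseteq> upper (polar (shift K x))"
    using polar_shift_scale[OF _ r \<eta> near] K \<eta> by (auto simp: upper_def convex_body_def)
  moreover have "(*\<^sub>R) (1 - \<eta>) ` upper (polar (shift K x')) \<in> lmeasurable"
    by (intro lmeasurable_compact compact_scaling planar_body.compact_upper planar_body_shift K x)
  ultimately have "measure lebesgue ((*\<^sub>R) (1 - \<eta>) ` upper (polar (shift K x'))) \<le> upper_area K x"
    using planar_body.upper_lmeasurable[OF planar_body_shift[OF K x(1)]]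
    by (intro measure_mono_fmeasurable) (auto simp: fmeasurableD)
  then show ?thesis by (simp add: measure_scaleR_image)
qed

lemma upper_area_isCont:
  assumes K: "convex_body K" and x: "x \<in> interior K"
  shows "isCont (upper_area K) x"
proof -
  obtain r where r: "0 < r" "cball x r \<subseteq> K" using x mem_interior_cball by metis
  let ?\<eta> = "\<lambda>x'. norm (x' - x) / r"
  have ev: "\<forall>\<^sub>F x' in at x. 0 < ?\<eta> x' \<and> 2 * ?\<eta> x' < 1 \<and> x' \<in> interior K \<and> cball x' (r / 2) \<subseteq> K"
    unfolding eventually_at
  proof (intro exI[of _ "r / 2"] conjI ballI impI)
    fix x' assume x': "x' \<noteq> x \<and> dist x' x < r / 2"
    then show "0 < ?\<eta> x'" using r by simp
    show "2 * ?\<eta> x' < 1" using x' r by (simp add: dist_norm divide_less_eq)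
    have "cball x' (r / 2) \<subseteq> cball x r"
    proof
      fix z assume "z \<in> cball x' (r / 2)"
      then show "z \<in> cball x r" using x' dist_triangle[of x z x'] by (simp add: dist_commute)
    qed
    then show sub: "cball x' (r / 2) \<subseteq> K" using r by blast
    show "x' \<in> interior K" unfolding mem_interior_cball using sub r by (intro exI[of _ "r / 2"]) auto
  qed (use r in auto)
  have lim: "(?\<eta> \<longlongrightarrow> 0) (at x)"
    using tendsto_norm[OF LIM_zero[OF tendsto_ident_at], of x UNIV] by (auto intro: tendsto_divide_zero)
  show ?thesis unfolding isCont_def
  proof (rule tendsto_sandwich)
    show "((\<lambda>x'. (1 - 2 * ?\<eta> x')\<^sup>2 * upper_area K x) \<longlongrightarrow> upper_area K x) (at x)"
      by (rule tendsto_eq_intros lim refl)+ simp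
    show "((\<lambda>x'. upper_area K x / (1 - ?\<eta> x')\<^sup>2) \<longlongrightarrow> upper_area K x) (at x)"
      by (rule tendsto_eq_intros lim refl)+ simp_all
    show "\<forall>\<^sub>F x' in at x. (1 - 2 * ?\<eta> x')\<^sup>2 * upper_area K x \<le> upper_area K x'"
      using ev
    proof eventually_elim
      case (elim x')
      then show ?case using r
        by (intro upper_area_compare[OF K _ x, where r = "r / 2"]) (auto simp: norm_minus_commute)
    qed
    show "\<forall>\<^sub>F x' in at x. upper_area K x' \<le> upper_area K x / (1 - ?\<eta> x')\<^sup>2"
      using ev
    proof eventually_elim
      case (elim x')
      then have "(1 - ?\<eta> x')\<^sup>2 * upper_area K x' \<le> upper_area K x"
        using r by (intro upper_area_compare[OF K x _ r]) auto
      moreover have "0 < (1 - ?\<eta> x')\<^sup>2" using elim by auto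
      ultimately show ?case by (simp add: le_divide_eq mult.commute)
    qed
  qed
qed

text \<open>Move \<open>x\<close> upwards to the boundary point \<open>b\<close> of \<open>K\<close>.  At distance \<open>\<rho>\<close> from \<open>b\<close> the
  polar body contains a point at height \<open>1 / \<rho>\<close> in the direction of an outer normal at \<open>b\<close>, and together
  with the fixed chord of half-length \<open>1 / w\<close> this point spans a triangle of area \<open>1 / (w * \<rho>)\<close>.  The
  lower half meanwhile only shrinks.\<close>

lemma upper_area_dominates:
  assumes K: "convex_body K" and x: "x \<in> interior K" and w: "0 < w"
    and width: "support (shift K x) (vector [1, 0]) = w" "support (shift K x) (vector [-1, 0]) = w"
  shows "\<exists>\<tau>\<ge>0. x + \<tau> *\<^sub>R vector [0, 1] \<in> interior K \<and>
    measure lebesgue (upper (polar (uminus ` shift K (x + \<tau> *\<^sub>R vector [0, 1]))))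
      < upper_area K (x + \<tau> *\<^sub>R vector [0, 1])"
proof -
  let ?p = "\<lambda>\<tau>. x + \<tau> *\<^sub>R (vector [0, 1] :: real^2)"
  have cK: "compact K" "convex K" using K by (auto simp: convex_body_def)
  interpret L: planar_body "shift K x" by (rule planar_body_shift[OF K x])
  define S where "S = {\<tau>. 0 \<le> \<tau> \<and> ?p \<tau> \<notin> interior K}"
  have "open (?p -` interior K)" by (intro open_vimage open_interior continuous_intros)
  moreover have "S = {0..} - ?p -` interior K" by (auto simp: S_def)
  ultimately have clS: "closed S" by (metis closed_Diff closed_atLeast)
  have neS: "S \<noteq> {}"
  proof -
    obtain B where B: "\<And>z. z \<in> K \<Longrightarrow> norm z \<le> B" using compact_imp_bounded[OF cK(1)] bounded_iff by metis
    have "0 \<le> B" using B interior_subset x norm_ge_zero by (metis order_trans subsetD)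
    let ?t = "B + norm x + 1"
    have "norm (?p ?t) \<ge> norm (?t *\<^sub>R (vector [0, 1] :: real^2)) - norm x"
      using norm_triangle_ineq2[of "?p ?t" x] norm_triangle_ineq4[of "?p ?t" x] by simp
    moreover have "norm (?t *\<^sub>R (vector [0, 1] :: real^2)) = ?t" using \<open>0 \<le> B\<close> by (simp add: norm_2)
    ultimately have "?p ?t \<notin> K" using B[of "?p ?t"] by auto
    then have "?t \<in> S" using \<open>0 \<le> B\<close> interior_subset by (auto simp: S_def)
    then show ?thesis by blast
  qed
  define \<beta> where "\<beta> = Inf S"
  have bdd: "bdd_below S" by (auto simp: S_def intro: bdd_belowI[of _ 0])
  have \<beta>S: "\<beta> \<in> S" unfolding \<beta>_def by (rule closed_contains_Inf[OF neS bdd clS])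
  have below: "?p \<tau> \<in> interior K" if "0 \<le> \<tau>" "\<tau> < \<beta>" for \<tau>
    using that cInf_lower[OF _ bdd, of \<tau>] by (force simp: S_def \<beta>_def)
  have "\<beta> \<noteq> 0" using \<beta>S x by (auto simp: S_def)
  then have \<beta>: "0 < \<beta>" using \<beta>S by (simp add: S_def)
  let ?b = "?p \<beta>"
  obtain a where a: "\<And>z. z \<in> K \<Longrightarrow> a \<bullet> z \<le> a \<bullet> ?b" "a \<noteq> 0"
  proof -
    have "interior K \<inter> {?b} = {}" using \<beta>S by (simp add: S_def)
    then obtain a c where ac: "a \<noteq> 0" "\<forall>z\<in>interior K. a \<bullet> z \<le> c" "c \<le> a \<bullet> ?b"
      using separating_hyperplane_sets[of "interior K" "{?b}"] x cK by (auto simp: convex_interior)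
    have "closure (interior K) \<subseteq> {z. a \<bullet> z \<le> c}"
      using ac(2) by (intro closure_minimal closed_halfspace_le) auto
    then have "K \<subseteq> {z. a \<bullet> z \<le> c}"
      using convex_closure_interior[OF cK(2)] x closure_subset by blast
    then show ?thesis using that[of a] ac by force
  qed
  have "0 < a$2"
  proof -
    obtain r where r: "0 < r" "cball x r \<subseteq> K" using x mem_interior_cball by metis
    have "x + (r / norm a) *\<^sub>R a \<in> K" using r a(2) by (auto simp: dist_norm intro!: subsetD[OF r(2)])
    from a(1)[OF this] have "(r / norm a) * (a \<bullet> a) \<le> \<beta> * a$2"
      unfolding inner_add_right inner_scaleR_right by (simp add: inner_2[of a "vector [0, 1]"])
    moreover have "0 < (r / norm a) * (a \<bullet> a)" using r a(2) by simp
    ultimately have "0 < \<beta> * a$2" by linarith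
    then show ?thesis using \<beta> by (simp add: zero_less_mult_iff)
  qed
  define y0 where "y0 = (1 / a$2) *\<^sub>R a"
  have y0: "y0$2 = 1" "\<And>z. z \<in> K \<Longrightarrow> (z - ?b) \<bullet> y0 \<le> 0"
  proof -
    show "y0$2 = 1" using \<open>0 < a$2\<close> by (simp add: y0_def)
    fix z assume "z \<in> K"
    have "(z - ?b) \<bullet> a \<le> 0" using a(1)[OF \<open>z \<in> K\<close>]
      by (simp only: inner_commute[of _ a] inner_diff_right)
    then show "(z - ?b) \<bullet> y0 \<le> 0" using \<open>0 < a$2\<close> by (simp add: y0_def mult_le_0_iff divide_le_0_iff)
  qed
  define g where "g = measure lebesgue (upper (polar (uminus ` shift K x)))"
  have g: "0 \<le> g" by (simp add: g_def)
  define \<rho> where "\<rho> = min \<beta> (1 / (w * (g + 1)))"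
  have \<rho>: "0 < \<rho>" "\<rho> \<le> \<beta>" "g + 1 \<le> 1 / (w * \<rho>)"
  proof -
    show "0 < \<rho>" "\<rho> \<le> \<beta>" using \<beta> w g by (auto simp: \<rho>_def)
    have "\<rho> \<le> 1 / (w * (g + 1))" by (simp add: \<rho>_def)
    then show "g + 1 \<le> 1 / (w * \<rho>)" using \<open>0 < \<rho>\<close> w g by (simp add: le_divide_eq mult_ac)
  qed
  define \<tau> where "\<tau> = \<beta> - \<rho>"
  have \<tau>: "0 \<le> \<tau>" "\<tau> < \<beta>" using \<rho> by (auto simp: \<tau>_def)
  have int: "?p \<tau> \<in> interior K" using below \<tau> by blast
  interpret M: planar_body "shift K (?p \<tau>)" by (rule planar_body_shift[OF K int])
  have "measure lebesgue (upper (polar (uminus ` shift K (?p \<tau>)))) \<le> g"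
    unfolding g_def
  proof (rule measure_mono_fmeasurable)
    show "upper (polar (uminus ` shift K (?p \<tau>))) \<subseteq> upper (polar (uminus ` shift K x))"
    proof
      fix y assume y: "y \<in> upper (polar (uminus ` shift K (?p \<tau>)))"
      have "- 1 \<le> (z - x) \<bullet> y" if "z \<in> K" for z
      proof -
        have "- 1 \<le> (z - ?p \<tau>) \<bullet> y" using y that by (auto simp: upper_def polar_def shift_def)
        moreover have "(z - ?p \<tau>) \<bullet> y = (z - x) \<bullet> y - \<tau> * y$2"
          by (simp add: inner_2 algebra_simps)
        moreover have "0 \<le> \<tau> * y$2" using y \<tau> by (simp add: upper_def)
        ultimately show ?thesis by linarith
      qed
      then show "y \<in> upper (polar (uminus ` shift K x))"
        using y by (auto simp: upper_def polar_def shift_def)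
    qed
    show "upper (polar (uminus ` shift K (?p \<tau>))) \<in> sets lebesgue"
      using planar_body.upper_lmeasurable[OF M.planar_body_uminus] by (rule fmeasurableD)
    show "upper (polar (uminus ` shift K x)) \<in> lmeasurable"
      by (rule planar_body.upper_lmeasurable[OF L.planar_body_uminus])
  qed
  also have "g < g + 1" by simp
  also have "\<dots> \<le> 1 / (w * \<rho>)" by (rule \<rho>(3))
  also have "\<dots> \<le> upper_area K (?p \<tau>)"
  proof -
    let ?u = "vector [1 / w, 0] :: real^2" and ?v = "vector [- 1 / w, 0] :: real^2" and ?y = "(1 / \<rho>) *\<^sub>R y0"
    have zx: "\<bar>(z - x)$1\<bar> \<le> w" if "z \<in> K" for z
    proof -
      have "z - x \<in> shift K x" using that by (simp add: shift_def)
      from L.inner_le_support[OF this, of "vector [1, 0]"] L.inner_le_support[OF this, of "vector [-1, 0]"]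
      show ?thesis unfolding width by (simp add: inner_2 abs_le_iff)
    qed
    have u: "?u \<in> upper (polar (shift K (?p \<tau>)))" and v: "?v \<in> upper (polar (shift K (?p \<tau>)))"
    proof -
      have "(z - ?p \<tau>) \<bullet> ?u \<le> 1" "(z - ?p \<tau>) \<bullet> ?v \<le> 1" if "z \<in> K" for z
      proof -
        have "(z - ?p \<tau>) \<bullet> ?u = (z - x)$1 / w" "(z - ?p \<tau>) \<bullet> ?v = - (z - x)$1 / w"
          by (simp_all add: inner_2 diff_divide_distrib)
        moreover have "(z - x)$1 \<le> w" "- (z - x)$1 \<le> w" using zx[OF that] by (auto simp only: abs_le_iff)
        ultimately show "(z - ?p \<tau>) \<bullet> ?u \<le> 1" "(z - ?p \<tau>) \<bullet> ?v \<le> 1"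
          using w by (simp_all only: divide_le_eq_1_pos)
      qed
      then show "?u \<in> upper (polar (shift K (?p \<tau>)))" "?v \<in> upper (polar (shift K (?p \<tau>)))"
        by (auto simp: upper_def polar_def shift_def)
    qed
    have y: "?y \<in> upper (polar (shift K (?p \<tau>)))"
    proof -
      have "(z - ?p \<tau>) \<bullet> ?y \<le> 1" if "z \<in> K" for z
      proof -
        have "(z - ?p \<tau>) \<bullet> y0 = (z - ?b) \<bullet> y0 + \<rho> * y0$2"
          by (simp add: inner_2 \<tau>_def algebra_simps)
        then have "(z - ?p \<tau>) \<bullet> y0 \<le> \<rho>" using y0(2)[OF that] by (simp add: y0(1))
        then show ?thesis using \<rho>(1) by (simp add: divide_le_eq)
      qed
      then show ?thesis using y0(1) \<rho>(1) by (auto simp: upper_def polar_def shift_def)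
    qed
    have "convex (upper (polar (shift K (?p \<tau>))))"
      unfolding upper_def by (intro convex_Int M.convex_polar) (use convex_halfspace_ge[of 0 "axis 2 1 :: real^2"] in \<open>simp add: inner_axis' \<close>)
    then have "convex hull {?v, ?u, ?y} \<subseteq> upper (polar (shift K (?p \<tau>)))"
      using u v y by (intro hull_minimal) auto
    moreover have "convex hull {?v, ?u, ?y} \<in> lmeasurable"
      by (intro lmeasurable_compact finite_imp_compact_convex_hull) simp
    ultimately have "measure lebesgue (convex hull {?v, ?u, ?y}) \<le> upper_area K (?p \<tau>)"
      using M.upper_lmeasurable by (intro measure_mono_fmeasurable) (auto simp: fmeasurableD)
    moreover have "measure lebesgue (convex hull {?v, ?u, ?y}) = 1 / (w * \<rho>)"
    proof -
      have "measure lebesgue (convex hull {?v, ?u, ?y}) = measure lborel (convex hull {?v, ?u, ?y})"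
        by (rule measure_completion) (simp add: compact_imp_closed finite_imp_compact_convex_hull)
      also have "\<dots> = 1 / (w * \<rho>)"
        unfolding content_triangle using w \<rho>(1) y0(1) by (simp add: abs_mult field_simps)
      finally show ?thesis .
    qed
    ultimately show ?thesis by simp
  qed
  finally show ?thesis using \<tau>(1) int by blast
qed

lemma midline_point:
  fixes K :: "(real^2) set"
  assumes K: "convex_body K"
  obtains x w where "x \<in> interior K" "0 < w"
    "\<And>y. y \<in> interior K \<Longrightarrow> y$1 = x$1 \<Longrightarrow>
      support (shift K y) (vector [1, 0]) = w \<and> support (shift K y) (vector [-1, 0]) = w"
proof -
  have cK: "compact K" "convex K" using K by (auto simp: convex_body_def)
  obtain q where q: "q \<in> interior K" using K by (auto simp: convex_body_def)
  have ne: "K \<noteq> {}" using q interior_subset by blast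
  have co: "continuous_on K (\<lambda>z. z$1)" by (intro continuous_intros)
  obtain u where u: "u \<in> K" "\<And>z. z \<in> K \<Longrightarrow> z$1 \<le> u$1" using continuous_attains_sup[OF cK(1) ne co] by blast
  obtain v where v: "v \<in> K" "\<And>z. z \<in> K \<Longrightarrow> v$1 \<le> z$1" using continuous_attains_inf[OF cK(1) ne co] by blast
  obtain r where r: "0 < r" "cball q r \<subseteq> K" using q mem_interior_cball by metis
  have "q + r *\<^sub>R vector [1, 0] \<in> K" "q - r *\<^sub>R vector [1, 0] \<in> K"
    using r by (auto intro!: subsetD[OF r(2)] simp: dist_norm norm_2)
  then have quv: "q$1 < u$1" "v$1 < q$1" using u(2) v(2) r(1) by fastforce+
  define m where "m = (u$1 + v$1) / 2"
  have toward: "\<exists>x\<in>interior K. x$1 = m" if z: "z \<in> K" and s: "0 \<le> s" "s < 1" and m: "q$1 + s * (z$1 - q$1) = m" for z s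
  proof (intro bexI)
    show "z - (1 - s) *\<^sub>R (z - q) \<in> interior K"
      by (rule mem_interior_convex_shrink[OF cK(2) q z]) (use s in auto)
    show "(z - (1 - s) *\<^sub>R (z - q))$1 = m" using m by (simp add: algebra_simps)
  qed
  have "\<exists>x\<in>interior K. x$1 = m"
  proof (cases "q$1 \<le> m")
    case True
    have "m < u$1" using quv by (simp add: m_def)
    with True quv show ?thesis
      by (intro toward[OF u(1), of "(m - q$1) / (u$1 - q$1)"]) (auto simp: divide_less_eq)
  next
    case False
    have "v$1 < m" using quv by (simp add: m_def)
    with False quv show ?thesis
      by (intro toward[OF v(1), of "(q$1 - m) / (q$1 - v$1)"])
        (auto simp: divide_less_eq field_simps)
  qed
  then obtain x where x: "x \<in> interior K" "x$1 = m" by blast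
  define w where "w = (u$1 - v$1) / 2"
  show ?thesis
  proof (rule that[OF x(1), of w])
    show "0 < w" using quv by (simp add: w_def)
    fix y assume y: "y \<in> interior K" "y$1 = x$1"
    interpret planar_body "shift K y" by (rule planar_body_shift[OF K y(1)])
    have mw: "y$1 + w = u$1" "y$1 - w = v$1" using y(2) x(2) by (auto simp: m_def w_def field_simps)
    show "support (shift K y) (vector [1, 0]) = w \<and> support (shift K y) (vector [-1, 0]) = w"
    proof (intro conjI antisym)
      show "support (shift K y) (vector [1, 0]) \<le> w" "support (shift K y) (vector [-1, 0]) \<le> w"
        unfolding support_le_iff using u(2) v(2) mw by (force simp: shift_def inner_2)+
      have "u - y \<in> shift K y" "v - y \<in> shift K y" using u v by (auto simp: shift_def)
      then show "w \<le> support (shift K y) (vector [1, 0])" "w \<le> support (shift K y) (vector [-1, 0])"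
        using inner_le_support[of "u - y" "vector [1, 0]"] inner_le_support[of "v - y" "vector [-1, 0]"] mw
        by (auto simp: inner_2)
    qed
  qed
qed

text \<open>The intermediate value theorem along the midline; the reflection of \<open>upper_area_dominates\<close> provides
  the point where the lower half is the larger one.\<close>

theorem balancing_point:
  fixes K :: "(real^2) set"
  assumes K: "convex_body K"
  obtains x w where "x \<in> interior K" "0 < w"
    "support (shift K x) (vector [1, 0]) = w" "support (shift K x) (vector [-1, 0]) = w"
    "measure lebesgue (upper (polar (uminus ` shift K x))) = upper_area K x"
proof -
  obtain x w where x: "x \<in> interior K" and w: "0 < w" and width: "\<And>y. y \<in> interior K \<Longrightarrow> y$1 = x$1 \<Longrightarrow>
      support (shift K y) (vector [1, 0]) = w \<and> support (shift K y) (vector [-1, 0]) = w"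
    using midline_point[OF K] by blast
  let ?e = "vector [0, 1] :: real^2"
  let ?G = "\<lambda>y. measure lebesgue (upper (polar (uminus ` shift K y)))"
  have G: "?G y = upper_area (uminus ` K) (- y)" for y by (simp add: shift_uminus)
  have K': "convex_body (uminus ` K)" by (rule convex_body_uminus[OF K])
  have int': "y \<in> interior (uminus ` K) \<longleftrightarrow> - y \<in> interior K" for y
    by (auto simp: interior_negations image_iff) (metis minus_minus)
  obtain t1 where t1: "0 \<le> t1" "x + t1 *\<^sub>R ?e \<in> interior K" "?G (x + t1 *\<^sub>R ?e) < upper_area K (x + t1 *\<^sub>R ?e)"
    using upper_area_dominates[OF K x w] width[OF x] by blast
  have neg: "- vector [1, 0] = (vector [-1, 0] :: real^2)" "- vector [-1, 0] = (vector [1, 0] :: real^2)"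
    by (simp_all add: vec_eq_2)
  have width': "support (shift (uminus ` K) (- x)) (vector [1, 0]) = w"
    "support (shift (uminus ` K) (- x)) (vector [-1, 0]) = w"
    using width[OF x] planar_body.support_uminus[OF planar_body_shift[OF K x]] by (simp_all add: shift_uminus neg)
  obtain t2 where t2: "0 \<le> t2" "- x + t2 *\<^sub>R ?e \<in> interior (uminus ` K)"
    "measure lebesgue (upper (polar (uminus ` shift (uminus ` K) (- x + t2 *\<^sub>R ?e))))
      < upper_area (uminus ` K) (- x + t2 *\<^sub>R ?e)"
    using upper_area_dominates[OF K' _ w width'] x by (auto simp: int')
  have flip: "- x + t2 *\<^sub>R ?e = - (x + (- t2) *\<^sub>R ?e)" by simp
  have t2': "x + (- t2) *\<^sub>R ?e \<in> interior K" "upper_area K (x + (- t2) *\<^sub>R ?e) < ?G (x + (- t2) *\<^sub>R ?e)"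
    using t2(2,3) unfolding flip int' shift_uminus by (simp_all add: image_image)
  define D where "D t = upper_area K (x + t *\<^sub>R ?e) - ?G (x + t *\<^sub>R ?e)" for t
  have inside: "x + t *\<^sub>R ?e \<in> interior K" if "- t2 \<le> t" "t \<le> t1" for t
  proof -
    have "convex ((\<lambda>t. x + t *\<^sub>R ?e) -` interior K)"
    proof -
      have "(\<lambda>t. x + t *\<^sub>R ?e) -` interior K = (\<lambda>t. t *\<^sub>R ?e) -` ((\<lambda>z. - x + z) ` interior K)"
        by (auto simp: image_iff) (metis add.commute add_diff_cancel_left' uminus_add_conv_diff)
      then show ?thesis
        by (simp only:) (intro convex_linear_vimage convex_translation convex_interior linear_scaleR_left;
          use K in \<open>simp add: convex_body_def\<close>)
    qed
    then have "closed_segment (- t2) t1 \<subseteq> (\<lambda>t. x + t *\<^sub>R ?e) -` interior K"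
      using t1(2) t2'(1) by (intro closed_segment_subset) auto
    then show ?thesis using that by (auto simp: closed_segment_eq_real_ivl subset_iff split: if_splits)
  qed
  have contD: "continuous_on {- t2..t1} D"
    unfolding D_def G
  proof (intro continuous_on_diff continuous_at_imp_continuous_on ballI)
    fix t assume t: "t \<in> {- t2..t1}"
    have "isCont (upper_area K \<circ> (\<lambda>t. x + t *\<^sub>R ?e)) t"
      by (rule continuous_at_compose) (use t inside upper_area_isCont[OF K] in auto)
    then show "isCont (\<lambda>t. upper_area K (x + t *\<^sub>R ?e)) t" by (simp add: o_def)
    have "isCont (upper_area (uminus ` K) \<circ> (\<lambda>t. - (x + t *\<^sub>R ?e))) t"
      by (rule continuous_at_compose) (use t inside upper_area_isCont[OF K'] int' in \<open>auto simp del: minus_add_distrib\<close>)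
    then show "isCont (\<lambda>t. upper_area (uminus ` K) (- (x + t *\<^sub>R ?e))) t" by (simp add: o_def)
  qed
  have "D (- t2) \<le> 0" "0 \<le> D t1" using t1(3) t2'(2) by (simp_all add: D_def)
  then obtain t where t: "- t2 \<le> t" "t \<le> t1" "D t = 0"
    using IVT'[of D "- t2" 0 t1] contD t1(1) t2(1) by auto
  show ?thesis
  proof (rule that[of "x + t *\<^sub>R ?e" w])
    show "x + t *\<^sub>R ?e \<in> interior K" using inside t by blast
    then show "support (shift K (x + t *\<^sub>R ?e)) (vector [1, 0]) = w"
      "support (shift K (x + t *\<^sub>R ?e)) (vector [-1, 0]) = w"
      using width[of "x + t *\<^sub>R ?e"] by auto
    show "?G (x + t *\<^sub>R ?e) = upper_area K (x + t *\<^sub>R ?e)" using t(3) by (simp add: D_def)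
  qed (rule w)
qed

section \<open>The stability theorem\<close>

lemma measure_uminus_image: "measure lebesgue (uminus ` S) = measure lebesgue S" for S :: "(real^2) set"
  using measure_scaleR_image[of "-1" S] by simp

lemma measure_polar_le_halves:
  assumes "planar_body L"
  shows "measure lebesgue (polar L)
    \<le> measure lebesgue (upper (polar L)) + measure lebesgue (upper (polar (uminus ` L)))"
proof -
  interpret planar_body L by fact
  interpret M: planar_body "uminus ` L" by (rule planar_body_uminus)
  have "polar L \<subseteq> upper (polar L) \<union> uminus ` upper (polar (uminus ` L))"
  proof
    fix y assume y: "y \<in> polar L"
    then have "- y \<in> upper (polar (uminus ` L))" if "y$2 < 0"
      using that by (simp add: upper_def polar_uminus)
    then show "y \<in> upper (polar L) \<union> uminus ` upper (polar (uminus ` L))"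
      using y by (cases "0 \<le> y$2") (auto simp: upper_def image_iff intro: bexI[of _ "- y"])
  qed
  moreover have "compact (uminus ` upper (polar (uminus ` L)))"
    by (intro compact_continuous_image M.compact_upper continuous_intros)
  then have m: "uminus ` upper (polar (uminus ` L)) \<in> lmeasurable" by (rule lmeasurable_compact)
  ultimately have "measure lebesgue (polar L) \<le> measure lebesgue (upper (polar L) \<union> uminus ` upper (polar (uminus ` L)))"
    using upper_lmeasurable lmeasurable_compact[OF compact_polar]
    by (intro measure_mono_fmeasurable) (auto simp: fmeasurableD)
  also have "\<dots> \<le> measure lebesgue (upper (polar L)) + measure lebesgue (uminus ` upper (polar (uminus ` L)))"
    using upper_lmeasurable m by (intro measure_Un_le) (auto simp: fmeasurableD)
  finally show ?thesis by (simp add: measure_uminus_image)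
qed

lemma polar_scaleR_iff: "y \<in> polar ((*\<^sub>R) a ` L) \<longleftrightarrow> a *\<^sub>R y \<in> polar L"
  by (auto simp: polar_def)

lemma upper_polar_scaleR:
  assumes "0 < w"
  shows "upper (polar ((*\<^sub>R) (1 / w) ` L)) = (*\<^sub>R) w ` upper (polar L)"
proof (intro subset_antisym subsetI)
  fix y assume "y \<in> upper (polar ((*\<^sub>R) (1 / w) ` L))"
  then have "(1 / w) *\<^sub>R y \<in> upper (polar L)" using assms by (simp add: upper_def polar_scaleR_iff)
  moreover have "y = w *\<^sub>R ((1 / w) *\<^sub>R y)" using assms by simp
  ultimately show "y \<in> (*\<^sub>R) w ` upper (polar L)" by blast
next
  fix y assume "y \<in> (*\<^sub>R) w ` upper (polar L)"
  then show "y \<in> upper (polar ((*\<^sub>R) (1 / w) ` L))"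
    using assms by (auto simp: upper_def polar_scaleR_iff)
qed

lemma (in planar_body) balanced_body_scaleR:
  assumes w: "0 < w" and width: "support L (vector [1, 0]) = w" "support L (vector [-1, 0]) = w"
  shows "balanced_body ((*\<^sub>R) (1 / w) ` L)"
proof
  show "compact ((*\<^sub>R) (1 / w) ` L)" "convex ((*\<^sub>R) (1 / w) ` L)"
    by (intro compact_scaling compact_L convex_scaling convex_L)+
  show "0 \<in> interior ((*\<^sub>R) (1 / w) ` L)"
  proof -
    obtain r where r: "0 < r" "cball 0 r \<subseteq> L" using zero_interior mem_interior_cball by metis
    have "cball 0 (r / w) \<subseteq> (*\<^sub>R) (1 / w) ` L"
    proof
      fix y :: "real^2" assume "y \<in> cball 0 (r / w)"
      then have "w *\<^sub>R y \<in> L" using r w by (intro subsetD[OF r(2)]) (simp add: field_simps)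
      moreover have "y = (1 / w) *\<^sub>R (w *\<^sub>R y)" using w by simp
      ultimately show "y \<in> (*\<^sub>R) (1 / w) ` L" by blast
    qed
    then show ?thesis unfolding mem_interior_cball using r w by (intro exI[of _ "r / w"]) auto
  qed
  have "support ((*\<^sub>R) (1 / w) ` L) y = support L ((1 / w) *\<^sub>R y)" for y
    unfolding support_def image_image by simp
  then have "support ((*\<^sub>R) (1 / w) ` L) y = (1 / w) * support L y" for y
    using w by (simp add: support_scale)
  then show "support ((*\<^sub>R) (1 / w) ` L) (vector [1, 0]) = 1" "support ((*\<^sub>R) (1 / w) ` L) (vector [-1, 0]) = 1"
    using w width by simp_all
qed

context
  fixes K :: "(real^2) set" and x :: "real^2" and w \<epsilon> :: real
  assumes K: "convex_body K" and x: "x \<in> interior K" and w: "0 < w"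
    and width: "support (shift K x) (vector [1, 0]) = w" "support (shift K x) (vector [-1, 0]) = w"
    and \<epsilon>: "0 < \<epsilon>" "\<epsilon> \<le> 1 / 10 ^ 12"
    and prod: "pi\<^sup>2 / (1 + \<epsilon>) \<le> measure lebesgue K * (2 * upper_area K x)"
begin

private abbreviation "L \<equiv> (*\<^sub>R) (1 / w) ` shift K x"

private lemma body: "balanced_body L"
  by (rule planar_body.balanced_body_scaleR[OF planar_body_shift[OF K x] w width])

private lemma prod_scaled: "pi\<^sup>2 / (1 + \<epsilon>) \<le> measure lebesgue L * (2 * measure lebesgue (upper (polar L)))"
proof -
  have "measure lebesgue (shift K x) = measure lebesgue K"
    unfolding shift_def by (rule measure_translation_subtract)
  then show ?thesis
    using prod w by (simp add: upper_polar_scaleR[OF w] measure_scaleR_image power_divide)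
qed

private lemma from_ellipse:
  assumes c: "0 < c" and \<eta>: "0 \<le> \<eta>" "\<eta> \<le> 1 / 2"
    and ck: "\<And>y. (ellipse_norm c k y \<le> 1 - \<eta> \<longrightarrow> y \<in> polar L) \<and> (y \<in> polar L \<longrightarrow> ellipse_norm c k y \<le> 1 + \<eta>)"
  shows "banach_mazur_dist K (cball 0 1) \<le> 1 + 4 * \<eta>"
proof (rule bm_factor_from_polar_ellipse[OF planar_body_shift[OF K x] c w \<eta>])
  fix y
  have eq: "w * ellipse_norm c k y = ellipse_norm c k (w *\<^sub>R y)" using w by (simp add: ellipse_norm_scale)
  have mem: "w *\<^sub>R y \<in> polar L \<longleftrightarrow> y \<in> polar (shift K x)" using w by (simp add: polar_scaleR_iff)
  show "w * ellipse_norm c k y \<le> 1 - \<eta> \<Longrightarrow> y \<in> polar (shift K x)"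
    "y \<in> polar (shift K x) \<Longrightarrow> w * ellipse_norm c k y \<le> 1 + \<eta>"
    using ck[of "w *\<^sub>R y"] unfolding eq mem by auto
qed

lemma bm_dist_le_fourth_root:
  assumes halves: "measure lebesgue (upper (polar (uminus ` shift K x))) = upper_area K x"
  shows "banach_mazur_dist K (cball 0 1) \<le> 1 + 1600 * sqrt (sqrt \<epsilon>)"
proof -
  have "uminus ` L = (*\<^sub>R) (1 / w) ` uminus ` shift K x" by (simp add: image_image)
  then have "measure lebesgue (upper (polar (uminus ` L))) = measure lebesgue (upper (polar L))"
    using halves by (simp only: upper_polar_scaleR[OF w] measure_scaleR_image)
  from balanced_body.full_ellipse[OF body \<epsilon> this prod_scaled]
  obtain c k where "0 < c" and ck: "\<And>y. (ellipse_norm c k y \<le> 1 - 400 * sqrt (sqrt \<epsilon>) \<longrightarrow> y \<in> polar L) \<and>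
      (y \<in> polar L \<longrightarrow> ellipse_norm c k y \<le> 1 + 400 * sqrt (sqrt \<epsilon>))" by blast
  have "sqrt \<epsilon> \<le> (1 / 10 ^ 3)\<^sup>2" by (rule real_le_lsqrt) (use \<epsilon> in \<open>auto simp: power2_eq_square\<close>)
  then have "sqrt (sqrt \<epsilon>) \<le> 1 / 10 ^ 3" by (rule real_le_lsqrt[rotated]) simp
  then have "banach_mazur_dist K (cball 0 1) \<le> 1 + 4 * (400 * sqrt (sqrt \<epsilon>))"
    using \<epsilon> by (intro from_ellipse[OF \<open>0 < c\<close> _ _ ck]) auto
  then show ?thesis by simp
qed

lemma bm_dist_le_square_root:
  assumes sym: "uminus ` shift K x = shift K x"
  shows "banach_mazur_dist K (cball 0 1) \<le> 1 + 10000 * sqrt \<epsilon>"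
proof -
  have "uminus ` L = (*\<^sub>R) (1 / w) ` uminus ` shift K x" by (simp add: image_image)
  then have "uminus ` L = L" using sym by simp
  from balanced_body.symmetric_ellipse[OF body \<epsilon> this prod_scaled]
  obtain c k where "0 < c" and ck: "\<And>y. (ellipse_norm c k y \<le> 1 - 2500 * sqrt \<epsilon> \<longrightarrow> y \<in> polar L) \<and>
      (y \<in> polar L \<longrightarrow> ellipse_norm c k y \<le> 1 + 2500 * sqrt \<epsilon>)" by blast
  have "sqrt \<epsilon> \<le> 1 / 10 ^ 6" by (rule real_le_lsqrt) (use \<epsilon> in \<open>auto simp: power2_eq_square\<close>)
  then have "banach_mazur_dist K (cball 0 1) \<le> 1 + 4 * (2500 * sqrt \<epsilon>)"
    using \<epsilon> by (intro from_ellipse[OF \<open>0 < c\<close> _ _ ck]) auto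
  then show ?thesis by simp
qed

end

lemma zero_interior_symmetric:
  fixes K :: "(real^2) set"
  assumes "convex_body K" "origin_symmetric K"
  shows "0 \<in> interior K"
proof -
  obtain q where q: "q \<in> interior K" using assms(1) by (auto simp: convex_body_def)
  have "- q \<in> uminus ` interior K" using q by simp
  then have "- q \<in> interior K"
    using assms(2) interior_negations[of K] by (simp add: origin_symmetric_def)
  then have "(1 / 2) *\<^sub>R q + (1 / 2) *\<^sub>R (- q) \<in> interior K"
    using q assms(1) by (intro convexD convex_interior) (auto simp: convex_body_def)
  then show ?thesis by simp
qed

text \<open>The hypothesis is transferred from the Santalo point to the balancing point, where the polar body is
  at least as large.\<close>

lemma product_at_point:
  fixes K :: "(real^2) set"
  assumes K: "convex_body K" and s: "santalo_point K s" and x: "x \<in> interior K"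
    and halves: "measure lebesgue (upper (polar (uminus ` shift K x))) = upper_area K x"
    and prod: "P \<le> volume (polar_at K s) * volume K"
  shows "P \<le> volume K * (2 * upper_area K x)"
proof -
  have "volume (polar_at K s) \<le> volume (polar_at K x)" using s x by (simp add: santalo_point_def)
  also have "\<dots> \<le> 2 * upper_area K x"
    using measure_polar_le_halves[OF planar_body_shift[OF K x]] halves by (simp add: polar_at_def)
  finally have "volume (polar_at K s) * volume K \<le> (2 * upper_area K x) * volume K"
    by (intro mult_right_mono) auto
  then show ?thesis using prod by (simp add: mult.commute)
qed

theorem mainTheorem1:
  shows "\<exists>\<gamma>>0. \<exists>\<epsilon>\<^sub>0>0. \<forall>(\<epsilon>::real) (K::(real^2) set) s.
    0 < \<epsilon> \<and> \<epsilon> < \<epsilon>\<^sub>0 \<and> convex_body K \<and> santalo_point K s \<and>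
    volume (polar_at K s) * volume K \<ge> pi\<^sup>2 / (1 + \<epsilon>) \<longrightarrow>
      banach_mazur_dist K (cball 0 1) \<le> 1 + \<gamma> * \<epsilon> powr (1/4) \<and>
      (origin_symmetric K \<longrightarrow>
        banach_mazur_dist K (cball 0 1) \<le> 1 + \<gamma> * \<epsilon> powr (1/2))"
proof -
  have "banach_mazur_dist K (cball 0 1) \<le> 1 + 10000 * \<epsilon> powr (1/4) \<and>
      (origin_symmetric K \<longrightarrow> banach_mazur_dist K (cball 0 1) \<le> 1 + 10000 * \<epsilon> powr (1/2))"
    if H: "0 < \<epsilon>" "\<epsilon> < 1 / 10 ^ 12" "convex_body K" "santalo_point K s"
      "pi\<^sup>2 / (1 + \<epsilon>) \<le> volume (polar_at K s) * volume K"
    for \<epsilon> :: real and K :: "(real^2) set" and s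
  proof (intro conjI impI)
    have \<epsilon>: "\<epsilon> \<le> 1 / 10 ^ 12" using H by simp
    have half: "sqrt \<epsilon> = \<epsilon> powr (1/2)" using H(1) by (simp add: powr_half_sqrt)
    have "sqrt (sqrt \<epsilon>) = (\<epsilon> powr (1/2)) powr (1/2)" using H(1) by (simp add: powr_half_sqrt)
    then have fourth: "sqrt (sqrt \<epsilon>) = \<epsilon> powr (1/4)" by (simp add: powr_powr)
    obtain x w where x: "x \<in> interior K" and w: "0 < w"
      and width: "support (shift K x) (vector [1, 0]) = w" "support (shift K x) (vector [-1, 0]) = w"
      and halves: "measure lebesgue (upper (polar (uminus ` shift K x))) = upper_area K x"
      using balancing_point[OF H(3)] by blast
    have "banach_mazur_dist K (cball 0 1) \<le> 1 + 1600 * sqrt (sqrt \<epsilon>)"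
      by (rule bm_dist_le_fourth_root[OF H(3) x w width H(1) \<epsilon> product_at_point[OF H(3,4) x halves H(5)] halves])
    also have "\<dots> \<le> 1 + 10000 * \<epsilon> powr (1/4)" unfolding fourth by simp
    finally show "banach_mazur_dist K (cball 0 1) \<le> 1 + 10000 * \<epsilon> powr (1/4)" .
    assume sym: "origin_symmetric K"
    have z: "0 \<in> interior K" by (rule zero_interior_symmetric[OF H(3) sym])
    interpret planar_body "shift K 0" by (rule planar_body_shift[OF H(3) z])
    have sK: "uminus ` shift K 0 = shift K 0" using sym by (simp add: shift_def origin_symmetric_def)
    define v where "v = support (shift K 0) (vector [1, 0])"
    have "- vector [-1, 0] = (vector [1, 0] :: real^2)" by (simp add: vec_eq_2)
    then have v': "support (shift K 0) (vector [-1, 0]) = v"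
      using support_uminus[of "vector [-1, 0]"] by (simp add: sK v_def)
    have "(vector [1, 0] :: real^2) \<noteq> 0" by (simp add: vec_eq_2)
    then have "0 < v" unfolding v_def by (rule support_pos)
    have h0: "measure lebesgue (upper (polar (uminus ` shift K 0))) = upper_area K 0" by (simp only: sK)
    have "banach_mazur_dist K (cball 0 1) \<le> 1 + 10000 * sqrt \<epsilon>"
      by (rule bm_dist_le_square_root[OF H(3) z \<open>0 < v\<close> v_def[symmetric] v' H(1) \<epsilon>
            product_at_point[OF H(3,4) z h0 H(5)] sK])
    then show "banach_mazur_dist K (cball 0 1) \<le> 1 + 10000 * \<epsilon> powr (1/2)" unfolding half .
  qed
  then show ?thesis
    by (intro exI[of _ 10000] conjI exI[of _ "1 / 10 ^ 12"]) auto
qed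

end
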